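(* Let $\chi_1\in C_0^{2,6,\alpha}(\mathbb{T}\times\tilde Y)$ be the unique solution of the continuous cell problem $\mathcal{L}\chi_1=-v_1$, and let $\hat v_{1,N}$ be the solution of the discrete cell problem with $\Delta t=1/N$. Then, as $\Delta t\to0$, $$\|\chi_1-\hat v_{1,N}\|_{C^{2,6,\alpha}(\mathbb{T}\times\tilde Y)}=\mathcal{O}(\Delta t),$$ where the constant in $\mathcal{O}(\Delta t)$ may depend on $v_1,v_2$ and $\sigma$.
   Context: Let $\mathbb{T}=\mathbb{R}/\mathbb{Z}$ and $\tilde Y=\mathbb{R}^2/\mathbb{Z}^2$. Let $\sigma>0$. Let $v_1(t,x_2)$ and $v_2(t,x_1)$ be smooth real functions, $1$-periodic in each argument, with $\int_0^1 v_1(t,x_2)\,\mathrm{d}x_2=0$ and $\int_0^1 v_2(t,x_1)\,\mathrm{d}x_1=0$ for all $t$. The generator is $\mathcal{L}=\partial_\tau+v_1(\tau,x_2)\partial_{x_1}+v_2(\tau,x_1)\partial_{x_2}+\frac{\sigma^2}{2}(\partial_{x_1x_1}+\partial_{x_2x_2})$. $C_0^{2,6,\alpha}(\mathbb{T}\times\tilde Y)$ ($0<\alpha<1$) is the Hölder space of periodic functions with Hölder-continuous (exponent $\alpha$) derivatives up to order $2$ in $\tau$ and order $6$ in $\mathbf{x}$, with zero spatial mean $\int_{\tilde Y}w(\tau,\mathbf{x})\mathrm{d}\mathbf{x}=0$ for every $\tau$. Let $N\in\mathbb{N}$, $\Delta t=1/N$. For starting time $\tau$ and point $\mathbf{X}^0$,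 the scheme generates $\mathbf{X}^n=(x_1^n,x_2^n)$ by $$x_1^{n+1}=x_1^n+v_1(\tau+(n+\tfrac12)\Delta t,x_2^n)\Delta t+\sigma\sqrt{\Delta t}\,\xi_1^n,$$ $$x_2^{n+1}=x_2^n+v_2\big(\tau+(n+\tfrac12)\Delta t,\;x_1^n+v_1(\tau+(n+\tfrac12)\Delta t,x_2^n)\Delta t\big)\Delta t+\sigma\sqrt{\Delta t}\,\xi_2^n,$$ with $\xi_1^n,\xi_2^n$ i.i.d. $\mathcal{N}(0,1)$. The one-step operator is $(I_{\Delta t}\phi)(\tau,\mathbf{x})=\mathbb{E}[\phi(\tau+\Delta t,\mathbf{X}^1)\mid\mathbf{X}^0=\mathbf{x}]$. The discrete cell problem solution is $\hat v_{1,N}(\tau,\mathbf{x})=\Delta t\sum_{i\ge0}\mathbb{E}[v_1(\tau+(i+\frac12)\Delta t,x_2^i)\mid\mathbf{X}^0=\mathbf{x}]$ (chain started at time $\tau$), which is the unique bounded solution with zero spatial mean of $\hat v_{1,N}=I_{\Delta t}\hat v_{1,N}+\Delta t\,v_1(\tau+\frac{\Delta t}{2},\cdot)$. *)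

theory Defs
  imports "HOL-Analysis.Analysis" "HOL-Probability.Distributions"
begin

(* Functions on T x Y~ are represented as 1-periodic functions  w tau x1 x2. *)
type_synonym fn3 = "real \<Rightarrow> real \<Rightarrow> real \<Rightarrow> real"

definition dA :: "(real \<Rightarrow> real \<Rightarrow> real) \<Rightarrow> real \<Rightarrow> real \<Rightarrow> real" where
  "dA g = (\<lambda>a b. deriv (\<lambda>s. g s b) a)"
definition dB :: "(real \<Rightarrow> real \<Rightarrow> real) \<Rightarrow> real \<Rightarrow> real \<Rightarrow> real" where
  "dB g = (\<lambda>a b. deriv (\<lambda>s. g a s) b)"
definition Dv :: "nat \<Rightarrow> nat \<Rightarrow> (real \<Rightarrow> real \<Rightarrow> real) \<Rightarrow> real \<Rightarrow> real \<Rightarrow> real" where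
  "Dv k j g = (dA ^^ k) ((dB ^^ j) g)"

definition smooth2 :: "(real \<Rightarrow> real \<Rightarrow> real) \<Rightarrow> bool" where
  "smooth2 g \<longleftrightarrow> (\<forall>k j.
      continuous_on UNIV (\<lambda>p::real\<times>real. Dv k j g (fst p) (snd p)) \<and>
      (\<forall>a b. (\<lambda>s. Dv k j g s b) differentiable (at a)) \<and>
      (\<forall>a b. (\<lambda>s. (dB ^^ j) g a s) differentiable (at b)))"

definition periodic2 :: "(real \<Rightarrow> real \<Rightarrow> real) \<Rightarrow> bool" where
  "periodic2 g \<longleftrightarrow> (\<forall>a b. g (a + 1) b = g a b \<and> g a (b + 1) = g a b)"

definition pdt :: "fn3 \<Rightarrow> fn3" where
  "pdt w = (\<lambda>t x1 x2. deriv (\<lambda>s. w s x1 x2) t)"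
definition pd1 :: "fn3 \<Rightarrow> fn3" where
  "pd1 w = (\<lambda>t x1 x2. deriv (\<lambda>s. w t s x2) x1)"
definition pd2 :: "fn3 \<Rightarrow> fn3" where
  "pd2 w = (\<lambda>t x1 x2. deriv (\<lambda>s. w t x1 s) x2)"

definition D3 :: "nat \<Rightarrow> nat \<Rightarrow> nat \<Rightarrow> fn3 \<Rightarrow> fn3" where
  "D3 k j1 j2 w = (pdt ^^ k) ((pd1 ^^ j1) ((pd2 ^^ j2) w))"

definition idx26 :: "(nat \<times> nat \<times> nat) set" where
  "idx26 = {(k, j1, j2). k \<le> 2 \<and> j1 + j2 \<le> 6}"

definition periodic3 :: "fn3 \<Rightarrow> bool" where
  "periodic3 w \<longleftrightarrow> (\<forall>t x1 x2. w (t + 1) x1 x2 = w t x1 x2 \<and>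
                     w t (x1 + 1) x2 = w t x1 x2 \<and> w t x1 (x2 + 1) = w t x1 x2)"

definition tdist :: "real \<Rightarrow> real \<Rightarrow> real" where
  "tdist a b = \<bar>(a - b) - of_int (round (a - b))\<bar>"
definition tdist3 :: "real \<times> real \<times> real \<Rightarrow> real \<times> real \<times> real \<Rightarrow> real" where
  "tdist3 p q = sqrt ((tdist (fst p) (fst q))\<^sup>2 + (tdist (fst (snd p)) (fst (snd q)))\<^sup>2
                     + (tdist (snd (snd p)) (snd (snd q)))\<^sup>2)"

definition sup_vals :: "fn3 \<Rightarrow> real set" where
  "sup_vals g = {\<bar>g t x1 x2\<bar> | t x1 x2. True}"
definition hoelder_quots :: "real \<Rightarrow> fn3 \<Rightarrow> real set" where
  "hoelder_quots \<alpha> g = {\<bar>g (fst p) (fst (snd p)) (snd (snd p)) - g (fst q) (fst (snd q)) (snd (snd q))\<bar>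
                          / (tdist3 p q powr \<alpha>) | p q. tdist3 p q > 0}"

definition C26 :: "real \<Rightarrow> fn3 \<Rightarrow> bool" where
  "C26 \<alpha> w \<longleftrightarrow> periodic3 w \<and>
     (\<forall>(k, j1, j2) \<in> idx26.
        (k > 0 \<longrightarrow> (\<forall>t x1 x2. (\<lambda>s. D3 (k - 1) j1 j2 w s x1 x2) differentiable (at t))) \<and>
        (k = 0 \<and> j1 > 0 \<longrightarrow> (\<forall>t x1 x2. (\<lambda>s. D3 0 (j1 - 1) j2 w t s x2) differentiable (at x1))) \<and>
        (k = 0 \<and> j1 = 0 \<and> j2 > 0 \<longrightarrow> (\<forall>t x1 x2. (\<lambda>s. D3 0 0 (j2 - 1) w t x1 s) differentiable (at x2))) \<and>
        bdd_above (sup_vals (D3 k j1 j2 w)) \<and>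
        bdd_above (hoelder_quots \<alpha> (D3 k j1 j2 w)))"

definition mean_zero :: "fn3 \<Rightarrow> bool" where
  "mean_zero w \<longleftrightarrow> (\<forall>t. integral (cbox (0, 0) (1, 1)) (\<lambda>(x1::real, x2::real). w t x1 x2) = 0)"

definition C26_0 :: "real \<Rightarrow> fn3 \<Rightarrow> bool" where
  "C26_0 \<alpha> w \<longleftrightarrow> C26 \<alpha> w \<and> mean_zero w"

definition norm26 :: "real \<Rightarrow> fn3 \<Rightarrow> real" where
  "norm26 \<alpha> w = (\<Sum>(k, j1, j2) \<in> idx26.
       Sup (sup_vals (D3 k j1 j2 w)) + Sup (hoelder_quots \<alpha> (D3 k j1 j2 w)))"

definition gen :: "(real \<Rightarrow> real \<Rightarrow> real) \<Rightarrow> (real \<Rightarrow> real \<Rightarrow> real) \<Rightarrow> real \<Rightarrow> fn3 \<Rightarrow> fn3" where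
  "gen v1 v2 \<sigma> w = (\<lambda>t x1 x2. pdt w t x1 x2 + v1 t x2 * pd1 w t x1 x2 + v2 t x1 * pd2 w t x1 x2
        + \<sigma>\<^sup>2 / 2 * (pd1 (pd1 w) t x1 x2 + pd2 (pd2 w) t x1 x2))"

(* one-step operator (I_dt phi)(tau,x) = E[phi(tau+dt, X^1) | X^0 = x], chain started at time tau *)
definition step_op :: "(real \<Rightarrow> real \<Rightarrow> real) \<Rightarrow> (real \<Rightarrow> real \<Rightarrow> real) \<Rightarrow> real \<Rightarrow> real \<Rightarrow> fn3 \<Rightarrow> fn3" where
  "step_op v1 v2 \<sigma> dt \<phi> = (\<lambda>t x1 x2.
     let tm = t + dt / 2;
         y1 = x1 + v1 tm x2 * dt;
         y2 = x2 + v2 tm y1 * dt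
     in integral\<^sup>L lborel (\<lambda>\<xi>1. integral\<^sup>L lborel (\<lambda>\<xi>2.
           \<phi> (t + dt) (y1 + \<sigma> * sqrt dt * \<xi>1) (y2 + \<sigma> * sqrt dt * \<xi>2)
             * std_normal_density \<xi>1 * std_normal_density \<xi>2)))"

(* discrete cell problem solution
   hat v_{1,N}(tau,x) = dt * sum_{i>=0} E[v1(tau+(i+1/2)dt, x2^i) | X^0 = x],  dt = 1/N;
   the i-th expectation is (I_dt^i h)(tau,x) with h(tau,x) = v1(tau + dt/2, x2). *)
definition vhat1 :: "(real \<Rightarrow> real \<Rightarrow> real) \<Rightarrow> (real \<Rightarrow> real \<Rightarrow> real) \<Rightarrow> real \<Rightarrow> nat \<Rightarrow> fn3" where
  "vhat1 v1 v2 \<sigma> N = (let dt = 1 / real N in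
     (\<lambda>t x1 x2. dt * (\<Sum>i. ((step_op v1 v2 \<sigma> dt) ^^ i) (\<lambda>s y1 y2. v1 (s + dt / 2) y2) t x1 x2)))"

end

(*
  The one-step operator is a product of Koopman operators of shears (half a time step, the two drift
  shears, half a time step) with Gaussian averaging in space.

  Stability. The shears preserve Lebesgue measure on the spatial torus and commute with derivatives
  up to errors of size s = dt that contain at least one spatial derivative. Gaussian averaging G
  satisfies the pointwise reverse Poincare inequality (G f)^2 + sigma^2 s |grad G f|^2 <= G(f^2), by
  Bessel's inequality for the functions 1, xi and integration by parts. Together with the Poincare
  inequality for mean zero functions the gained gradients absorb all errors, once derivatives of
  order m are weighted with eta^m for a small eta. Hence these Sobolev energies decay like
  (1 + c s)^(-n) along the iteration, uniformly in s.

  Convergence. Each factor is 1 + s A + O(s^2) on smooth functions, so the one-step operator is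
  1 + s L + O(s^2). By stability the discrete solutions are bounded in every C^m; by consistency each
  of them solves the discrete problem of any other step size up to O(s + s'), so they form a Cauchy
  sequence with rate s + s' in every C^m. Their limit V is smooth and solves L V = - v1, and the energy
  identity on the torus shows that V is the given solution chi1. No regularity theory for chi1 is used.
*)

theory Submission
  imports Defs "HOL-Real_Asymp.Real_Asymp"
begin

section \<open>Smooth functions of three real variables\<close>

text \<open>The noise acts on space only, so nothing damps pure time derivatives; commutator errors
  must be controlled by spatial gradients alone. This is possible because a drift shear produces
  errors only through derivatives along its own direction. Splitting off that spatial derivative
  leaves a strictly shorter word, which makes the system of energy estimates triangular. Writing the
  midpoint rule as two half steps of time translation turns the drift into a product of shears of
  space-time, so time is just another coordinate. Per step both the gain and the errors are of order
  \<open>s\<close>; rates uniform in \<open>s\<close> come from Young's inequality with a parameter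
  proportional to \<open>s\<close>. The direct route of inserting \<open>\<chi>1\<close> into the
  discrete problem is closed: the consistency estimate costs twenty derivatives, while
  \<open>\<chi>1\<close> has two in time and six in space. Consistency is therefore applied to the
  discrete solutions, and \<open>\<chi>1\<close> enters only through uniqueness, for which its few
  derivatives suffice.\<close>

text \<open>Points are triples \<open>(\<tau>, x\<^sub>1, x\<^sub>2)\<close>.\<close>

type_synonym pt = "real \<times> real \<times> real"

declare split_paired_All [simp del] split_paired_Ex [simp del]

datatype dir = DT | DX | DY

lemma UNIV_dir: "UNIV = {DT, DX, DY}"
  using dir.exhaust by auto

instance dir :: finite
  by standard (simp add: UNIV_dir)

lemma sum_dir: "(\<Sum>a\<in>UNIV. g a) = g DT + g DX + (g DY :: real)"
  by (simp add: UNIV_dir)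

primrec ax :: "dir \<Rightarrow> pt" where
  "ax DT = (1, 0, 0)" | "ax DX = (0, 1, 0)" | "ax DY = (0, 0, 1)"

text \<open>Partial derivatives are read off from the Frechet derivative and not from one-variable
  limits, so that the chain rule for nonlinear maps applies.\<close>

definition pd :: "dir \<Rightarrow> (pt \<Rightarrow> real) \<Rightarrow> pt \<Rightarrow> real" where
  "pd a f = (\<lambda>z. frechet_derivative f (at z) (ax a))"

abbreviation D :: "dir list \<Rightarrow> (pt \<Rightarrow> real) \<Rightarrow> pt \<Rightarrow> real" where
  "D w f \<equiv> foldr pd w f"

text \<open>Shifted by one against the usual scale: level \<open>n\<close> demands that all
  derivatives up to order \<open>n\<close> are differentiable, so continuity never has to be asked
  for.\<close>

primrec Ck :: "nat \<Rightarrow> (pt \<Rightarrow> real) \<Rightarrow> bool" where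
  "Ck 0 f \<longleftrightarrow> (\<forall>z. f differentiable at z)"
| "Ck (Suc n) f \<longleftrightarrow> (\<forall>z. f differentiable at z) \<and> (\<forall>a. Ck n (pd a f))"

definition smooth :: "(pt \<Rightarrow> real) \<Rightarrow> bool" where
  "smooth f \<longleftrightarrow> (\<forall>n. Ck n f)"

lemma Ck_differentiable: "Ck n f \<Longrightarrow> f differentiable at z"
  by (cases n) auto

lemma Ck_SucD: "Ck (Suc n) f \<Longrightarrow> Ck n f"
  by (induction n arbitrary: f) auto

lemma smooth_differentiable: "smooth f \<Longrightarrow> f differentiable at z"
  unfolding smooth_def using Ck_differentiable by blast

lemma smooth_pd: "smooth f \<Longrightarrow> smooth (pd a f)"
  unfolding smooth_def by (metis Ck.simps(2))

lemma smooth_D: "smooth f \<Longrightarrow> smooth (D w f)"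
  by (induction w) (auto intro: smooth_pd)

lemma smooth_continuous: "smooth f \<Longrightarrow> continuous_on A f"
  using smooth_differentiable differentiable_imp_continuous_within
  by (meson continuous_at_imp_continuous_on)

lemma D_snoc: "D (w @ [a]) f = D w (pd a f)"
  by simp

lemma pd_eqI: "(f has_derivative F) (at z) \<Longrightarrow> pd a f z = F (ax a)"
  unfolding pd_def using frechet_derivative_at by metis

lemma pt_decomp: "(h::pt) = fst h *\<^sub>R ax DT + fst (snd h) *\<^sub>R ax DX + snd (snd h) *\<^sub>R ax DY"
  by (cases h) simp

lemma has_derivative_pd:
  assumes "f differentiable at z"
  shows "(f has_derivative (\<lambda>h. fst h * pd DT f z + fst (snd h) * pd DX f z + snd (snd h) * pd DY f z)) (at z)"
proof -
  let ?F = "frechet_derivative f (at z)"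
  have F: "(f has_derivative ?F) (at z)" using assms by (simp add: frechet_derivative_works)
  interpret bounded_linear ?F using F by (rule has_derivative_bounded_linear)
  have "?F h = fst h * pd DT f z + fst (snd h) * pd DX f z + snd (snd h) * pd DY f z" for h
    by (subst pt_decomp[of h]) (simp add: add scaleR pd_def del: ax.simps)
  then show ?thesis using F by (metis (no_types, lifting) ext)
qed

lemma pd_line:
  assumes "f differentiable at (z + r *\<^sub>R ax a)"
  shows "((\<lambda>r. f (z + r *\<^sub>R ax a)) has_real_derivative pd a f (z + r *\<^sub>R ax a)) (at r)"
proof -
  let ?F = "frechet_derivative f (at (z + r *\<^sub>R ax a))"
  have F: "(f has_derivative ?F) (at (z + r *\<^sub>R ax a))" using assms by (simp add: frechet_derivative_works)
  interpret bounded_linear ?F using F by (rule has_derivative_bounded_linear)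
  have "((\<lambda>r. z + r *\<^sub>R ax a) has_derivative (\<lambda>h. h *\<^sub>R ax a)) (at r)"
    by (auto intro!: derivative_eq_intros)
  from has_derivative_compose[OF this F]
  have "((\<lambda>r. f (z + r *\<^sub>R ax a)) has_derivative (\<lambda>h. ?F (h *\<^sub>R ax a))) (at r)" .
  moreover have "(\<lambda>h. ?F (h *\<^sub>R ax a)) = (*) (pd a f (z + r *\<^sub>R ax a))"
    by (rule ext) (simp add: scaleR pd_def)
  ultimately show ?thesis by (simp add: has_field_derivative_def)
qed

lemma pd_const [simp]: "pd a (\<lambda>z. c) = (\<lambda>z. 0)"
  by (rule ext, subst pd_eqI[OF has_derivative_const]) simp

lemma pd_add:
  assumes "\<And>z. f differentiable at z" "\<And>z. g differentiable at z"
  shows "pd a (\<lambda>z. f z + g z) = (\<lambda>z. pd a f z + pd a g z)"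
proof
  fix z
  have "(f has_derivative frechet_derivative f (at z)) (at z)" "(g has_derivative frechet_derivative g (at z)) (at z)"
    using assms by (simp_all add: frechet_derivative_works)
  from pd_eqI[OF has_derivative_add[OF this]] show "pd a (\<lambda>z. f z + g z) z = pd a f z + pd a g z"
    by (simp add: pd_def)
qed

lemma pd_mult:
  assumes "\<And>z. f differentiable at z" "\<And>z. g differentiable at z"
  shows "pd a (\<lambda>z. f z * g z) = (\<lambda>z. pd a f z * g z + f z * pd a g z)"
proof
  fix z
  have "(f has_derivative frechet_derivative f (at z)) (at z)" "(g has_derivative frechet_derivative g (at z)) (at z)"
    using assms by (simp_all add: frechet_derivative_works)
  from pd_eqI[OF has_derivative_mult[OF this]] show "pd a (\<lambda>z. f z * g z) z = pd a f z * g z + f z * pd a g z"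
    by (simp add: pd_def)
qed

text \<open>With constant \<open>b\<close> this is a translation, so one chain rule serves the drift
  steps, the half steps in time and the periodicity arguments.\<close>

definition shear :: "dir \<Rightarrow> (pt \<Rightarrow> real) \<Rightarrow> real \<Rightarrow> pt \<Rightarrow> pt" where
  "shear j b s z = z + (s * b z) *\<^sub>R ax j"

lemma has_derivative_shear:
  assumes f: "\<And>z. f differentiable at z" and b: "\<And>z. b differentiable at z"
  shows "((\<lambda>z. f (shear j b s z)) has_derivative
     (\<lambda>h. frechet_derivative f (at (shear j b s z)) (h + (s * frechet_derivative b (at z) h) *\<^sub>R ax j))) (at z)"
proof -
  have F: "(f has_derivative frechet_derivative f (at y)) (at y)" for y
    using f by (simp add: frechet_derivative_works)
  have B: "(b has_derivative frechet_derivative b (at z)) (at z)"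
    using b by (simp add: frechet_derivative_works)
  have "(shear j b s has_derivative (\<lambda>h. h + (s * frechet_derivative b (at z) h) *\<^sub>R ax j)) (at z)"
    unfolding shear_def[abs_def] using B by (auto intro!: derivative_eq_intros)
  from has_derivative_compose[OF this F] show ?thesis .
qed

lemma pd_shear:
  assumes f: "\<And>z. f differentiable at z" and b: "\<And>z. b differentiable at z"
  shows "pd a (\<lambda>z. f (shear j b s z)) =
     (\<lambda>z. pd a f (shear j b s z) + s * pd a b z * pd j f (shear j b s z))"
proof
  fix z
  have "(f has_derivative frechet_derivative f (at (shear j b s z))) (at (shear j b s z))"
    using f by (simp add: frechet_derivative_works)
  then interpret bounded_linear "frechet_derivative f (at (shear j b s z))"
    by (rule has_derivative_bounded_linear)
  show "pd a (\<lambda>z. f (shear j b s z)) z = pd a f (shear j b s z) + s * pd a b z * pd j f (shear j b s z)"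
    by (subst pd_eqI[OF has_derivative_shear[OF f b]]) (simp add: add scaleR pd_def)
qed

lemma Ck_const: "Ck n (\<lambda>z. c)"
  by (induction n arbitrary: c) simp_all

lemma Ck_add: "Ck n f \<Longrightarrow> Ck n g \<Longrightarrow> Ck n (\<lambda>z. f z + g z)"
  by (induction n arbitrary: f g) (auto simp: pd_add)

lemma Ck_mult: "Ck n f \<Longrightarrow> Ck n g \<Longrightarrow> Ck n (\<lambda>z. f z * g z)"
proof (induction n arbitrary: f g)
  case (Suc n)
  then have "Ck n f" "Ck n g" using Ck_SucD by blast+
  with Suc show ?case by (auto simp: pd_mult intro!: Ck_add)
qed simp

lemma Ck_shear: "Ck n f \<Longrightarrow> Ck n b \<Longrightarrow> Ck n (\<lambda>z. f (shear j b s z))"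
proof (induction n arbitrary: f)
  case 0
  then have d: "\<And>z. f differentiable at z" "\<And>z. b differentiable at z" by auto
  show ?case using has_derivative_shear[OF d] unfolding differentiable_def Ck.simps by blast
next
  case (Suc n)
  then have n: "Ck n f" "Ck n b" using Ck_SucD by blast+
  have d: "\<And>z. f differentiable at z" "\<And>z. b differentiable at z" using Suc by auto
  have "(\<lambda>z. f (shear j b s z)) differentiable at z" for z
    using has_derivative_shear[OF d] unfolding differentiable_def by blast
  moreover have "Ck n (pd a (\<lambda>z. f (shear j b s z)))" for a
  proof -
    have "Ck n (pd a f)" "Ck n (pd j f)" "Ck n (pd a b)" using Suc.prems by auto
    then show ?thesis unfolding pd_shear[OF d]
      by (intro Ck_add Ck_mult[OF Ck_mult[OF Ck_const]] Suc.IH n(2))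
  qed
  ultimately show ?case by simp
qed

lemma smooth_const [intro]: "smooth (\<lambda>z. c)"
  by (simp add: smooth_def Ck_const)

lemma smooth_add [intro]: "smooth f \<Longrightarrow> smooth g \<Longrightarrow> smooth (\<lambda>z. f z + g z)"
  by (simp add: smooth_def Ck_add)

lemma smooth_mult [intro]: "smooth f \<Longrightarrow> smooth g \<Longrightarrow> smooth (\<lambda>z. f z * g z)"
  by (simp add: smooth_def Ck_mult)

lemma smooth_cmult [intro]: "smooth f \<Longrightarrow> smooth (\<lambda>z. c * f z)"
  by (intro smooth_mult smooth_const)

lemma smooth_diff [intro]: "smooth f \<Longrightarrow> smooth g \<Longrightarrow> smooth (\<lambda>z. f z - g z)"
  using smooth_add[OF _ smooth_cmult[of g "-1"], of f] by simp

lemma smooth_shear: "smooth f \<Longrightarrow> smooth b \<Longrightarrow> smooth (\<lambda>z. f (shear j b s z))"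
  by (simp add: smooth_def Ck_shear)

lemma smooth_sum [intro]:
  assumes "\<And>i. i \<in> A \<Longrightarrow> smooth (g i)"
  shows "smooth (\<lambda>z. \<Sum>i\<in>A. g i z)"
proof (cases "finite A")
  case True
  then show ?thesis using assms by (induction A rule: finite_induct) auto
qed auto

lemma pd_cmult: "smooth f \<Longrightarrow> pd a (\<lambda>z. c * f z) = (\<lambda>z. c * pd a f z)"
  by (subst pd_mult) (auto intro: smooth_differentiable)

lemma D_add: "smooth f \<Longrightarrow> smooth g \<Longrightarrow> D w (\<lambda>z. f z + g z) = (\<lambda>z. D w f z + D w g z)"
  by (induction w) (auto simp: pd_add smooth_differentiable smooth_D)

lemma D_cmult: "smooth f \<Longrightarrow> D w (\<lambda>z. c * f z) = (\<lambda>z. c * D w f z)"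
  by (induction w) (auto simp: pd_cmult smooth_D)

lemma D_diff: "smooth f \<Longrightarrow> smooth g \<Longrightarrow> D w (\<lambda>z. f z - g z) = (\<lambda>z. D w f z - D w g z)"
  using D_add[OF _ smooth_cmult[of g "-1"], of f w] D_cmult[of g w "-1"] by simp

lemma D_zero [simp]: "D w (\<lambda>z. 0) = (\<lambda>z. 0)"
  by (induction w) auto

lemma pd_diff: "smooth f \<Longrightarrow> smooth g \<Longrightarrow> pd a (\<lambda>z. f z - g z) = (\<lambda>z. pd a f z - pd a g z)"
  using D_diff[of f g "[a]"] by simp

lemma D_sum:
  assumes "\<And>i. i \<in> A \<Longrightarrow> smooth (g i)"
  shows "D w (\<lambda>z. \<Sum>i\<in>A. g i z) = (\<lambda>z. \<Sum>i\<in>A. D w (g i) z)"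
proof (cases "finite A")
  case True
  then show ?thesis using assms
    by (induction A rule: finite_induct) (auto simp: D_add smooth_sum)
qed auto

text \<open>Peano's form of Schwarz' theorem: \<open>g(p,q) - g(p,0)\<close> is the integral of \<open>g\<^sub>b\<close>, so
  \<open>g\<^sub>a\<close> is obtained by differentiating under the integral sign.\<close>

lemma mixed_partials:
  fixes g ga gb gab :: "real \<Rightarrow> real \<Rightarrow> real"
  assumes ga: "\<And>p q. ((\<lambda>p. g p q) has_real_derivative ga p q) (at p)"
    and gb: "\<And>p q. ((\<lambda>q. g p q) has_real_derivative gb p q) (at q)"
    and gab: "\<And>p q. ((\<lambda>p. gb p q) has_real_derivative gab p q) (at p)"
    and cgb: "\<And>p. continuous_on UNIV (gb p)"
    and cgab: "continuous_on UNIV (\<lambda>x. gab (fst x) (snd x))"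
  shows "((\<lambda>q. ga p q) has_real_derivative gab p q) (at q)"
proof -
  \<comment> \<open>Any base point below \<open>q\<close> would do; the gap keeps \<open>q\<close>
    in the interior of \<open>{c..q+1}\<close>.\<close>
  define c where "c = q - 1"
  have 1: "integral {c..r} (gb p') = g p' r - g p' c" if "r \<ge> c" for p' r
    using that gb
    by (intro integral_unique fundamental_theorem_of_calculus)
       (auto simp: has_real_derivative_iff_has_vector_derivative[symmetric] intro: DERIV_subset)
  have cg: "continuous_on S (gab p')" for p' S
    by (rule continuous_on_compose2[OF cgab, of S "\<lambda>q. (p', q)", simplified]) (auto intro!: continuous_intros)
  have 2: "ga p r = ga p c + integral {c..r} (gab p)" if "r \<ge> c" for r
  proof -
    have "((\<lambda>p'. integral (cbox c r) (gb p')) has_field_derivative integral (cbox c r) (gab p)) (at p within UNIV)"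
      using cgb by (intro leibniz_rule_field_derivative gab integrable_continuous)
         (auto intro: continuous_on_subset simp: split_beta intro!: continuous_on_subset[OF cgab])
    moreover have "((\<lambda>p'. g p' r - g p' c) has_field_derivative ga p r - ga p c) (at p)"
      by (intro DERIV_diff ga)
    ultimately have "integral {c..r} (gab p) = ga p r - ga p c"
      using 1[OF that] by (simp add: DERIV_unique)
    then show ?thesis by simp
  qed
  have "((\<lambda>r. integral {c..r} (gab p)) has_real_derivative gab p q) (at q within {c..q+1})"
    by (rule integral_has_real_derivative[OF cg]) (simp add: c_def)
  then have "((\<lambda>r. ga p c + integral {c..r} (gab p)) has_real_derivative gab p q) (at q within {c..q+1})"
    by (auto intro!: derivative_eq_intros)
  moreover have "at q within {c..q+1} = at q"
    by (rule at_within_interior) (simp add: c_def)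
  ultimately have "((\<lambda>r. ga p c + integral {c..r} (gab p)) has_real_derivative gab p q) (at q)"
    by metis
  then show ?thesis
    by (rule has_field_derivative_transform_within_open[where S = "{c<..}"])
       (simp, simp add: c_def, rule 2[symmetric], simp)
qed

lemma pd_commute:
  assumes "smooth f"
  shows "pd a (pd b f) = pd b (pd a f)"
proof
  fix z
  let ?L = "\<lambda>p q. z + p *\<^sub>R ax a + q *\<^sub>R ax b"
  have L: "?L p q = (z + q *\<^sub>R ax b) + p *\<^sub>R ax a" for p q by simp
  have A: "((\<lambda>p. h (?L p q)) has_real_derivative pd a h (?L p q)) (at p)" if "smooth h" for h p q
    unfolding L by (rule pd_line[OF smooth_differentiable[OF that]])
  have B: "((\<lambda>q. h (?L p q)) has_real_derivative pd b h (?L p q)) (at q)" if "smooth h" for h p q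
    by (rule pd_line[OF smooth_differentiable[OF that]])
  note sm = assms smooth_pd[OF assms] smooth_pd[OF smooth_pd[OF assms]]
  have C: "continuous_on UNIV (\<lambda>x. h (?L (fst x) (snd x)))" if "smooth h" for h
    by (rule continuous_on_compose2[OF smooth_continuous[OF that], of UNIV])
       (auto intro!: continuous_intros)
  have C': "continuous_on UNIV (\<lambda>q. h (?L p q))" if "smooth h" for h p
    by (rule continuous_on_compose2[OF smooth_continuous[OF that], of UNIV])
       (auto intro!: continuous_intros)
  have "((\<lambda>q. pd a f (?L 0 q)) has_real_derivative pd a (pd b f) (?L 0 0)) (at 0)"
    by (rule mixed_partials[of "\<lambda>p q. f (?L p q)" "\<lambda>p q. pd a f (?L p q)" "\<lambda>p q. pd b f (?L p q)"
          "\<lambda>p q. pd a (pd b f) (?L p q)"]) (intro A B C C' sm)+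
  moreover have "((\<lambda>q. pd a f (?L 0 q)) has_real_derivative pd b (pd a f) (?L 0 0)) (at 0)"
    by (rule B[OF sm(2)])
  ultimately show "pd a (pd b f) z = pd b (pd a f) z"
    by (simp add: DERIV_unique)
qed

lemma D_pd_commute: "smooth f \<Longrightarrow> D w (pd a f) = pd a (D w f)"
proof (induction w)
  case (Cons b w)
  then show ?case using pd_commute[OF smooth_D[of f w], of b a] by simp
qed simp

section \<open>Words of derivatives and jets\<close>

definition words :: "nat \<Rightarrow> dir list set" where
  "words n = {w. length w \<le> n}"

lemma finite_words [simp]: "finite (words n)"
  using finite_lists_length_le[of "UNIV::dir set" n] by (simp add: words_def)

lemma words_iff [simp]: "w \<in> words n \<longleftrightarrow> length w \<le> n"
  by (simp add: words_def)

text \<open>The last letter is split off, not the first: it is the derivative that is applied first.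
  A jet of order \<open>Suc n\<close> of \<open>f\<close> thus becomes jets of order
  \<open>n\<close> of the partials of \<open>f\<close>, and estimates go by induction with
  \<open>f\<close> arbitrary.\<close>

lemma words_Suc: "words (Suc n) = insert [] (\<Union>a. (\<lambda>w. w @ [a]) ` words n)"
proof -
  have "w \<in> insert [] (\<Union>a. (\<lambda>w. w @ [a]) ` words n)" if "length w \<le> Suc n" for w
  proof (cases w rule: rev_exhaust)
    case (snoc w' a) then show ?thesis using that by (auto simp: words_def)
  qed simp
  then show ?thesis by (auto simp: words_def)
qed

lemma sum_words_Suc:
  "(\<Sum>w\<in>words (Suc n). g w) = g [] + (\<Sum>a\<in>UNIV. \<Sum>w\<in>words n. g (w @ [a]) :: real)"
proof -
  have "(\<Sum>w\<in>words (Suc n). g w) = g [] + (\<Sum>w\<in>(\<Union>a. (\<lambda>w. w @ [a]) ` words n). g w)"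
    unfolding words_Suc by (subst sum.insert) auto
  also have "(\<Sum>w\<in>(\<Union>a. (\<lambda>w. w @ [a]) ` words n). g w) = (\<Sum>a\<in>UNIV. \<Sum>w\<in>(\<lambda>w. w @ [a]) ` words n. g w)"
    by (rule sum.UNION_disjoint) auto
  also have "\<dots> = (\<Sum>a\<in>UNIV. \<Sum>w\<in>words n. g (w @ [a]))"
    by (simp add: sum.reindex inj_on_def)
  finally show ?thesis .
qed

text \<open>Words rather than multi-indices: every mixed derivative is counted once for each ordering.\<close>

definition J :: "nat \<Rightarrow> (pt \<Rightarrow> real) \<Rightarrow> pt \<Rightarrow> real" where
  "J n f z = (\<Sum>w\<in>words n. \<bar>D w f z\<bar>)"

lemma J_0: "J 0 f z = \<bar>f z\<bar>"
  by (simp add: J_def words_def)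

lemma J_Suc: "J (Suc n) f z = \<bar>f z\<bar> + (\<Sum>a\<in>UNIV. J n (pd a f) z)"
  by (simp add: J_def sum_words_Suc)

lemma J_nonneg [simp]: "0 \<le> J n f z"
  by (simp add: J_def sum_nonneg)

lemma J_mono: "n \<le> m \<Longrightarrow> J n f z \<le> J m f z"
  unfolding J_def by (rule sum_mono2) auto

lemma D_le_J: "length w \<le> n \<Longrightarrow> \<bar>D w f z\<bar> \<le> J n f z"
  unfolding J_def by (rule member_le_sum) auto

lemma abs_le_J: "\<bar>f z\<bar> \<le> J n f z"
  using D_le_J[of "[]" n f z] by simp

lemma J_pd: "J n (pd a f) z \<le> J (Suc n) f z"
proof -
  have "J n (pd a f) z \<le> (\<Sum>a\<in>UNIV. J n (pd a f) z)"
    by (rule member_le_sum) auto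
  then show ?thesis by (simp add: J_Suc)
qed

lemma J_add: "smooth f \<Longrightarrow> smooth g \<Longrightarrow> J n (\<lambda>z. f z + g z) z \<le> J n f z + J n g z"
  unfolding J_def by (auto simp: D_add sum.distrib[symmetric] intro!: sum_mono)

lemma J_diff: "smooth f \<Longrightarrow> smooth g \<Longrightarrow> J n (\<lambda>z. f z - g z) z \<le> J n f z + J n g z"
  unfolding J_def by (auto simp: D_diff sum.distrib[symmetric] intro!: sum_mono)

lemma J_cmult: "smooth f \<Longrightarrow> J n (\<lambda>z. c * f z) z = \<bar>c\<bar> * J n f z"
  unfolding J_def by (auto simp: D_cmult abs_mult sum_distrib_left)

lemma J_mult:
  "smooth f \<Longrightarrow> smooth g \<Longrightarrow> J n (\<lambda>z. f z * g z) z \<le> 2 ^ n * J n f z * J n g z"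
proof (induction n arbitrary: f g)
  case 0
  then show ?case by (simp add: J_0 abs_mult)
next
  case (Suc n)
  note sm = Suc.prems smooth_pd[OF Suc.prems(1)] smooth_pd[OF Suc.prems(2)]
  let ?F = "\<Sum>a\<in>UNIV. J n (pd a f) z" and ?G = "\<Sum>a\<in>UNIV. J n (pd a g) z"
  have 1: "J n (pd a (\<lambda>z. f z * g z)) z \<le> 2 ^ n * (J n (pd a f) z * J (Suc n) g z + J (Suc n) f z * J n (pd a g) z)" for a
  proof -
    have "J n (pd a (\<lambda>z. f z * g z)) z = J n (\<lambda>z. pd a f z * g z + f z * pd a g z) z"
      using sm by (subst pd_mult) (auto intro: smooth_differentiable)
    also have "\<dots> \<le> J n (\<lambda>z. pd a f z * g z) z + J n (\<lambda>z. f z * pd a g z) z"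
      using sm by (intro J_add smooth_mult) 
    also have "\<dots> \<le> 2 ^ n * J n (pd a f) z * J n g z + 2 ^ n * J n f z * J n (pd a g) z"
      using sm by (intro add_mono Suc.IH)
    also have "\<dots> = 2 ^ n * (J n (pd a f) z * J n g z + J n f z * J n (pd a g) z)"
      by (simp add: algebra_simps)
    also have "\<dots> \<le> 2 ^ n * (J n (pd a f) z * J (Suc n) g z + J (Suc n) f z * J n (pd a g) z)"
      by (intro mult_left_mono add_mono mult_right_mono J_mono) auto
    finally show ?thesis .
  qed
  have F: "?F = J (Suc n) f z - \<bar>f z\<bar>" and G: "?G = J (Suc n) g z - \<bar>g z\<bar>"
    by (simp_all add: J_Suc)
  have "J (Suc n) (\<lambda>z. f z * g z) z \<le> \<bar>f z\<bar> * \<bar>g z\<bar> +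
     (\<Sum>a\<in>UNIV. 2 ^ n * (J n (pd a f) z * J (Suc n) g z + J (Suc n) f z * J n (pd a g) z))"
    unfolding J_Suc[of n "\<lambda>z. f z * g z"] by (intro add_mono sum_mono 1) (simp add: abs_mult)
  also have "\<dots> = \<bar>f z\<bar> * \<bar>g z\<bar> + 2 ^ n * (?F * J (Suc n) g z + J (Suc n) f z * ?G)"
    by (simp add: sum_distrib_left[symmetric] sum_distrib_right[symmetric] sum.distrib)
  also have "\<dots> = \<bar>f z\<bar> * \<bar>g z\<bar> + 2 ^ Suc n * (J (Suc n) f z * J (Suc n) g z)
      - 2 ^ n * (\<bar>f z\<bar> * J (Suc n) g z + J (Suc n) f z * \<bar>g z\<bar>)"
    unfolding F G by (simp add: algebra_simps)
  \<comment> \<open>The subtracted terms pay for the product of order zero: already one of them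
    dominates it, since \<open>2 ^ n\<close> is at least 1.\<close>
  also have "\<dots> \<le> 2 ^ Suc n * (J (Suc n) f z * J (Suc n) g z)"
  proof -
    have "\<bar>f z\<bar> * \<bar>g z\<bar> \<le> \<bar>f z\<bar> * J (Suc n) g z + J (Suc n) f z * \<bar>g z\<bar>"
      by (intro add_increasing2 mult_left_mono abs_le_J mult_nonneg_nonneg) auto
    also have "\<dots> \<le> 2 ^ n * (\<bar>f z\<bar> * J (Suc n) g z + J (Suc n) f z * \<bar>g z\<bar>)"
    proof -
      have "1 * (\<bar>f z\<bar> * J (Suc n) g z + J (Suc n) f z * \<bar>g z\<bar>) \<le> 2 ^ n * (\<bar>f z\<bar> * J (Suc n) g z + J (Suc n) f z * \<bar>g z\<bar>)"
        by (intro mult_right_mono add_nonneg_nonneg mult_nonneg_nonneg) auto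
      then show ?thesis by simp
    qed
    finally show ?thesis by simp
  qed
  finally show ?case by (simp add: mult.assoc)
qed

section \<open>Periodic functions and jet bounds\<close>

definition periodic :: "(pt \<Rightarrow> real) \<Rightarrow> bool" where
  "periodic f \<longleftrightarrow> (\<forall>z a. f (z + ax a) = f z)"

definition Sm :: "(pt \<Rightarrow> real) \<Rightarrow> bool" where
  "Sm f \<longleftrightarrow> smooth f \<and> periodic f"

definition Cp :: "(pt \<Rightarrow> real) \<Rightarrow> bool" where
  "Cp f \<longleftrightarrow> continuous_on UNIV f \<and> periodic f"

lemma Sm_smooth: "Sm f \<Longrightarrow> smooth f"
  by (simp add: Sm_def)

lemma Sm_Cp: "Sm f \<Longrightarrow> Cp f"
  by (simp add: Sm_def Cp_def smooth_continuous)

lemma periodic_int: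
  assumes "periodic f"
  shows "f (z + of_int m *\<^sub>R ax a) = f z"
proof -
  have nat: "f (z + of_nat n *\<^sub>R ax a) = f z" for n z
  proof (induction n)
    case (Suc n)
    have "f (z + of_nat (Suc n) *\<^sub>R ax a) = f ((z + of_nat n *\<^sub>R ax a) + ax a)"
      by (simp add: algebra_simps)
    also have "\<dots> = f z" using assms Suc by (metis periodic_def)
    finally show ?case .
  qed simp
  show ?thesis
  proof (cases "m \<ge> 0")
    case True
    then show ?thesis using nat[of z "nat m"] by simp
  next
    case False
    then show ?thesis using nat[of "z + of_int m *\<^sub>R ax a" "nat (-m)"] by simp
  qed
qed

lemma periodic_frac:
  assumes "periodic f"
  shows "f (t, x, y) = f (frac t, frac x, frac y)"
proof -
  have "(t, x, y) = (frac t, frac x, frac y) + of_int \<lfloor>t\<rfloor> *\<^sub>R ax DT + of_int \<lfloor>x\<rfloor> *\<^sub>R ax DX + of_int \<lfloor>y\<rfloor> *\<^sub>R ax DY"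
    by (simp add: frac_def)
  then show ?thesis using periodic_int[OF assms] by metis
qed

lemma Cp_bounded:
  assumes "Cp f"
  obtains B where "B \<ge> 0" "\<And>z. \<bar>f z\<bar> \<le> B"
proof -
  have "compact (f ` cbox 0 (1,1,1))"
  proof -
    have "continuous_on UNIV f" using assms by (simp add: Cp_def)
    then have "continuous_on (cbox 0 (1,1,1)) f" by (rule continuous_on_subset) simp
    then show ?thesis using compact_cbox by (rule compact_continuous_image)
  qed
  then have "bounded (f ` cbox 0 (1,1,1))" by (rule compact_imp_bounded)
  then obtain B where B: "\<And>z. z \<in> cbox 0 (1,1,1) \<Longrightarrow> \<bar>f z\<bar> \<le> B"
    unfolding bounded_iff by auto
  have "\<bar>f z\<bar> \<le> B" for z
  proof -
    obtain t x y where z: "z = (t, x, y)" by (cases z)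
    have "(frac t, frac x, frac y) \<in> cbox 0 (1,1,1)"
      by (auto simp: cbox_Pair_eq zero_prod_def frac_lt_1 less_imp_le)
    from B[OF this] show ?thesis using periodic_frac[of f t x y] assms z by (simp add: Cp_def)
  qed
  then have "\<And>z. \<bar>f z\<bar> \<le> max B 0" by (simp add: le_max_iff_disj)
  then show ?thesis using that[of "max B 0"] by simp
qed

text \<open>A shift by a period is a shear with constant \<open>b\<close>, for which the chain rule
  has no extra term.\<close>

lemma periodic_pd:
  assumes "smooth f" "periodic f"
  shows "periodic (pd a f)"
proof -
  have "pd a f z = pd a f (z + ax j)" for z j
  proof -
    have "(\<lambda>z. f (shear j (\<lambda>_. 1) 1 z)) = f"
      using assms(2) by (auto simp: shear_def periodic_def)
    then have "pd a f z = pd a (\<lambda>z. f (shear j (\<lambda>_. 1) 1 z)) z" by simp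
    also have "\<dots> = pd a f (z + ax j)"
      using assms(1) by (subst pd_shear) (auto intro: smooth_differentiable simp: shear_def)
    finally show ?thesis .
  qed
  then show ?thesis by (auto simp: periodic_def)
qed

lemma Sm_pd: "Sm f \<Longrightarrow> Sm (pd a f)"
  by (simp add: Sm_def smooth_pd periodic_pd)

lemma Sm_D: "Sm f \<Longrightarrow> Sm (D w f)"
  by (induction w) (auto intro: Sm_pd)

lemma Sm_const [intro]: "Sm (\<lambda>z. c)"
  by (auto simp: Sm_def periodic_def)

lemma Sm_add [intro]: "Sm f \<Longrightarrow> Sm g \<Longrightarrow> Sm (\<lambda>z. f z + g z)"
  and Sm_diff [intro]: "Sm f \<Longrightarrow> Sm g \<Longrightarrow> Sm (\<lambda>z. f z - g z)"
  and Sm_mult [intro]: "Sm f \<Longrightarrow> Sm g \<Longrightarrow> Sm (\<lambda>z. f z * g z)"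
  and Sm_cmult [intro]: "Sm f \<Longrightarrow> Sm (\<lambda>z. c * f z)"
  by (auto simp: Sm_def periodic_def)

lemma Sm_sum [intro]: "(\<And>i. i \<in> A \<Longrightarrow> Sm (g i)) \<Longrightarrow> Sm (\<lambda>z. \<Sum>i\<in>A. g i z)"
  by (auto simp: Sm_def periodic_def)

lemma Sm_shear:
  assumes "Sm f" "Sm b"
  shows "Sm (\<lambda>z. f (shear j b s z))"
proof -
  have "f (shear j b s (z + ax a)) = f (shear j b s z)" for z a
  proof -
    have "shear j b s (z + ax a) = shear j b s z + ax a"
      using assms by (simp add: shear_def Sm_def periodic_def)
    then show ?thesis using assms by (simp add: Sm_def periodic_def)
  qed
  then show ?thesis using assms by (auto simp: Sm_def periodic_def intro: smooth_shear)
qed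

lemma Cp_const [intro]: "Cp (\<lambda>z. c)"
  and Cp_add [intro]: "Cp f \<Longrightarrow> Cp g \<Longrightarrow> Cp (\<lambda>z. f z + g z)"
  and Cp_diff [intro]: "Cp f \<Longrightarrow> Cp g \<Longrightarrow> Cp (\<lambda>z. f z - g z)"
  and Cp_mult [intro]: "Cp f \<Longrightarrow> Cp g \<Longrightarrow> Cp (\<lambda>z. f z * g z)"
  and Cp_power [intro]: "Cp f \<Longrightarrow> Cp (\<lambda>z. (f z)^n)"
  and Cp_cmult [intro]: "Cp f \<Longrightarrow> Cp (\<lambda>z. c * f z)"
  and Cp_abs [intro]: "Cp f \<Longrightarrow> Cp (\<lambda>z. \<bar>f z\<bar>)"
  by (auto simp: Cp_def periodic_def intro!: continuous_intros)

lemma Cp_sum [intro]: "(\<And>i. i \<in> A \<Longrightarrow> Cp (g i)) \<Longrightarrow> Cp (\<lambda>z. \<Sum>i\<in>A. g i z)"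
  by (auto simp: Cp_def periodic_def intro!: continuous_intros)

lemma Cp_J: "Sm f \<Longrightarrow> Cp (J n f)"
  unfolding J_def[abs_def] by (intro Cp_sum Cp_abs Sm_Cp Sm_D)

definition bnd :: "nat \<Rightarrow> (pt \<Rightarrow> real) \<Rightarrow> real \<Rightarrow> bool" where
  "bnd n f B \<longleftrightarrow> (\<forall>z. J n f z \<le> B)"

lemma bndD: "bnd n f B \<Longrightarrow> J n f z \<le> B"
  by (simp add: bnd_def)

lemma bnd_nonneg: "bnd n f B \<Longrightarrow> 0 \<le> B"
  using J_nonneg[of n f 0] bndD[of n f B 0] by linarith

lemma Sm_bnd:
  assumes "Sm f"
  obtains B where "B \<ge> 0" "bnd n f B"
proof -
  obtain B where "B \<ge> 0" "\<And>z. \<bar>J n f z\<bar> \<le> B" using Cp_bounded[OF Cp_J[OF assms, of n]] by metis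
  then show ?thesis using that[of B] by (simp add: bnd_def)
qed

lemma bnd_mono: "bnd m f B \<Longrightarrow> n \<le> m \<Longrightarrow> B \<le> C \<Longrightarrow> bnd n f C"
  unfolding bnd_def using J_mono[of n m f] by (meson order_trans)

lemma bnd_pd: "bnd (Suc n) f B \<Longrightarrow> bnd n (pd a f) B"
  unfolding bnd_def by (meson J_pd order_trans)

lemma bnd_add: "smooth f \<Longrightarrow> smooth g \<Longrightarrow> bnd n f A \<Longrightarrow> bnd n g B \<Longrightarrow> bnd n (\<lambda>z. f z + g z) (A + B)"
  unfolding bnd_def by (intro allI order_trans[OF J_add add_mono]) auto

lemma bnd_diff: "smooth f \<Longrightarrow> smooth g \<Longrightarrow> bnd n f A \<Longrightarrow> bnd n g B \<Longrightarrow> bnd n (\<lambda>z. f z - g z) (A + B)"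
  unfolding bnd_def by (intro allI order_trans[OF J_diff add_mono]) auto

lemma bnd_cmult: "smooth f \<Longrightarrow> bnd n f A \<Longrightarrow> bnd n (\<lambda>z. c * f z) (\<bar>c\<bar> * A)"
  unfolding bnd_def by (simp add: J_cmult mult_left_mono)

lemma bnd_mult:
  assumes "smooth f" "smooth g" "bnd n f A" "bnd n g B"
  shows "bnd n (\<lambda>z. f z * g z) (2 ^ n * A * B)"
  unfolding bnd_def
proof
  fix z
  have "J n (\<lambda>z. f z * g z) z \<le> 2 ^ n * J n f z * J n g z"
    using assms by (intro J_mult)
  also have "\<dots> \<le> 2 ^ n * A * B"
    using assms by (intro mult_mono) (auto simp: bnd_def bnd_nonneg)
  finally show "J n (\<lambda>z. f z * g z) z \<le> 2 ^ n * A * B" .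
qed

lemma bnd_sum:
  assumes "finite A" "\<And>i. i \<in> A \<Longrightarrow> smooth (g i)" "\<And>i. i \<in> A \<Longrightarrow> bnd n (g i) (B i)"
  shows "bnd n (\<lambda>z. \<Sum>i\<in>A. g i z) (\<Sum>i\<in>A. B i)"
  using assms
proof (induction A rule: finite_induct)
  case empty
  then show ?case by (simp add: bnd_def J_def)
next
  case (insert i A)
  then show ?case by (auto intro!: bnd_add)
qed

section \<open>Taylor expansion along segments, and limits of smooth functions\<close>

definition dird :: "pt \<Rightarrow> (pt \<Rightarrow> real) \<Rightarrow> pt \<Rightarrow> real" where
  "dird h f z = (\<Sum>a\<in>UNIV. (h \<bullet> ax a) * pd a f z)"

lemma dird_ax: "dird (ax j) f = pd j f"
  by (cases j) (auto simp: dird_def sum_dir)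

lemma smooth_dird: "smooth f \<Longrightarrow> smooth (dird h f)"
  unfolding dird_def[abs_def] by (intro smooth_sum smooth_cmult smooth_pd)

lemma smooth_dird_pow: "smooth f \<Longrightarrow> smooth ((dird h ^^ m) f)"
  by (induction m) (auto intro: smooth_dird)

lemma has_derivative_dird:
  assumes "smooth f" shows "(f has_derivative (\<lambda>h. dird h f z)) (at z)"
  using has_derivative_pd[OF smooth_differentiable[OF assms], of z]
  by (simp add: dird_def sum_dir inner_prod_def)

lemma dird_line:
  assumes "smooth f"
  shows "((\<lambda>r. f (z + r *\<^sub>R h)) has_real_derivative dird h f (z + r *\<^sub>R h)) (at r)"
proof -
  have "((\<lambda>r. z + r *\<^sub>R h) has_derivative (\<lambda>r. r *\<^sub>R h)) (at r)"
    by (auto intro!: derivative_eq_intros)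
  from has_derivative_compose[OF this has_derivative_dird[OF assms]]
  have "((\<lambda>r. f (z + r *\<^sub>R h)) has_derivative (\<lambda>x. dird (x *\<^sub>R h) f (z + r *\<^sub>R h))) (at r)" .
  moreover have "(\<lambda>x. dird (x *\<^sub>R h) f (z + r *\<^sub>R h)) = (*) (dird h f (z + r *\<^sub>R h))"
    by (rule ext) (simp add: dird_def sum_distrib_left mult_ac)
  ultimately show ?thesis unfolding has_field_derivative_def by simp
qed

lemma dird_taylor:
  assumes "smooth f"
  shows "\<exists>y. f (z + h) = (\<Sum>m<n. (dird h ^^ m) f z / fact m) + (dird h ^^ n) f y / fact n"
proof -
  have "\<exists>t. \<bar>t\<bar> \<le> \<bar>1\<bar> \<and> f (z + 1 *\<^sub>R h) = (\<Sum>m<n. (dird h ^^ m) f (z + 0 *\<^sub>R h) / fact m * 1 ^ m)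
      + (dird h ^^ n) f (z + t *\<^sub>R h) / fact n * 1 ^ n"
    by (rule Maclaurin_all_le[where diff = "\<lambda>m r. (dird h ^^ m) f (z + r *\<^sub>R h)"])
       (auto simp: dird_line smooth_dird_pow assms)
  then show ?thesis by auto
qed

lemma abs_dird: "\<bar>dird h f z\<bar> \<le> norm h * (\<Sum>a\<in>UNIV. \<bar>pd a f z\<bar>)"
proof -
  have "norm (ax a) = 1" for a by (cases a) (auto simp: norm_Pair)
  then have "\<bar>h \<bullet> ax a\<bar> \<le> norm h" for a
    using Cauchy_Schwarz_ineq2[of h "ax a"] by simp
  then show ?thesis
    unfolding dird_def sum_distrib_left
    by (intro order_trans[OF sum_abs] sum_mono) (simp add: abs_mult mult_right_mono)
qed

text \<open>The constant does not depend on the point. This uniformity allows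
  \<open>Av_has_derivative\<close> to average the remainder over an arbitrary probability
  measure.\<close>

lemma quadratic_remainder:
  assumes f: "smooth f" and B: "bnd 2 f B"
  shows "\<bar>f (z + h) - f z - dird h f z\<bar> \<le> B * (norm h)\<^sup>2"
proof -
  obtain y where y: "f (z + h) = (\<Sum>m<2. (dird h ^^ m) f z / fact m) + (dird h ^^ 2) f y / fact 2"
    using dird_taylor[OF f, of z h 2] by blast
  have 1: "pd b (dird h f) y = dird h (pd b f) y" for b
  proof -
    have "pd b (dird h f) y = (\<Sum>a\<in>UNIV. (h \<bullet> ax a) * pd b (pd a f) y)"
      using D_sum[of UNIV "\<lambda>a z. (h \<bullet> ax a) * pd a f z" "[b]"] f
      by (simp add: dird_def[abs_def] smooth_pd smooth_cmult pd_cmult)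
    then show ?thesis by (simp add: dird_def pd_commute[OF f, of b])
  qed
  have "\<bar>dird h (dird h f) y\<bar> \<le> norm h * (\<Sum>a\<in>UNIV. \<bar>dird h (pd a f) y\<bar>)"
    using abs_dird[of h "dird h f" y] by (simp add: 1)
  also have "\<dots> \<le> norm h * (\<Sum>a\<in>UNIV. norm h * (\<Sum>b\<in>UNIV. \<bar>pd b (pd a f) y\<bar>))"
    by (intro mult_left_mono sum_mono abs_dird) auto
  also have "\<dots> = (norm h)\<^sup>2 * (\<Sum>a\<in>UNIV. \<Sum>b\<in>UNIV. \<bar>pd b (pd a f) y\<bar>)"
    by (simp add: sum_distrib_left power2_eq_square mult.assoc)
  also have "\<dots> \<le> (norm h)\<^sup>2 * J 2 f y"
    by (intro mult_left_mono) (auto simp: numeral_2_eq_2 J_Suc J_0 sum.distrib intro!: add_increasing sum_nonneg)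
  also have "\<dots> \<le> (norm h)\<^sup>2 * B"
    using B by (intro mult_left_mono) (auto simp: bnd_def)
  finally have "\<bar>dird h (dird h f) y\<bar> \<le> (norm h)\<^sup>2 * B" .
  moreover have "0 \<le> (norm h)\<^sup>2 * B" using bnd_nonneg[OF B] by simp
  ultimately show ?thesis unfolding y by (simp add: numeral_2_eq_2 mult.commute)
qed

text \<open>Limits are given for all words at once. So each \<open>g w\<close> is differentiable
  with partials \<open>g (a # w)\<close> by the theorem on sequences of derivatives, and smoothness
  follows by induction over the order with \<open>w\<close> arbitrary.\<close>

lemma smooth_limit:
  fixes F :: "nat \<Rightarrow> pt \<Rightarrow> real" and g :: "dir list \<Rightarrow> pt \<Rightarrow> real"
  assumes F: "\<And>n. smooth (F n)"
    and g: "\<And>w. uniform_limit UNIV (\<lambda>n. D w (F n)) (g w) sequentially"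
  shows "smooth (g [])" "D w (g []) = g w"
proof -
  let ?g' = "\<lambda>w x h. \<Sum>a\<in>UNIV. (h \<bullet> ax a) * g (a # w) x"
  have lim: "(\<lambda>n. D w (F n) x) \<longlonglongrightarrow> g w x" for w x
    using tendsto_uniform_limitI[OF g] by simp
  have der: "(g w has_derivative ?g' w x) (at x)" for w x
  proof -
    have "\<exists>G. \<forall>x\<in>UNIV. (\<lambda>n. D w (F n) x) \<longlonglongrightarrow> G x \<and> (G has_derivative ?g' w x) (at x within UNIV)"
    proof (rule has_derivative_sequence[where ?x0.0 = 0 and l = "g w 0"])
      show "\<And>n x. (D w (F n) has_derivative (\<lambda>h. dird h (D w (F n)) x)) (at x)"
        by (intro has_derivative_dird smooth_D F)
      show "(\<lambda>n. D w (F n) 0) \<longlonglongrightarrow> g w 0" by (rule lim)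
      fix e :: real assume "e > 0"
      \<comment> \<open>One third for each of the three axes.\<close>
      then have e: "e / 3 > 0" by simp
      have "\<forall>\<^sub>F n in sequentially. \<forall>a. \<forall>x. dist (D (a # w) (F n) x) (g (a # w) x) < e / 3"
        using uniform_limitD[OF g[of "_ # w"] e] by (simp add: eventually_all_finite)
      then show "\<forall>\<^sub>F n in sequentially. \<forall>x\<in>UNIV. \<forall>h. norm (dird h (D w (F n)) x - ?g' w x h) \<le> e * norm h"
      proof (rule eventually_mono, intro ballI allI)
        fix n x h assume n: "\<forall>a. \<forall>x. dist (D (a # w) (F n) x) (g (a # w) x) < e / 3"
        have ax1: "norm (ax a) = 1" for a by (cases a) (auto simp: norm_Pair)
        have "norm (dird h (D w (F n)) x - ?g' w x h) = \<bar>\<Sum>a\<in>UNIV. (h \<bullet> ax a) * (D (a#w) (F n) x - g (a#w) x)\<bar>"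
          by (simp add: dird_def sum_subtractf algebra_simps)
        also have "\<dots> \<le> (\<Sum>a\<in>(UNIV::dir set). norm h * (e/3))"
        proof (intro order_trans[OF sum_abs] sum_mono)
          fix a :: dir
          have "\<bar>h \<bullet> ax a\<bar> \<le> norm h" using Cauchy_Schwarz_ineq2[of h "ax a"] ax1 by simp
          moreover have "\<bar>D (a#w) (F n) x - g (a#w) x\<bar> \<le> e/3" using n by (auto simp: dist_real_def intro: less_imp_le)
          ultimately show "\<bar>h \<bullet> ax a * (D (a#w) (F n) x - g (a#w) x)\<bar> \<le> norm h * (e/3)"
            unfolding abs_mult by (intro mult_mono) auto
        qed
        also have "\<dots> = e * norm h" by (simp add: sum_dir del: sum_constant)
        finally show "norm (dird h (D w (F n)) x - ?g' w x h) \<le> e * norm h" .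
      qed
    qed auto
    then obtain G where G: "\<And>x. (\<lambda>n. D w (F n) x) \<longlonglongrightarrow> G x" "\<And>x. (G has_derivative ?g' w x) (at x)" by auto
    then have "G = g w" using lim LIMSEQ_unique by blast
    then show ?thesis using G by simp
  qed
  have pd: "pd a (g w) = g (a # w)" for a w
    by (rule ext, subst pd_eqI[OF der]) (cases a; simp add: sum_dir)
  have dg: "g w differentiable at x" for w x
    using der unfolding differentiable_def by blast
  have "Ck n (g w)" for n w
    by (induction n arbitrary: w) (simp_all add: dg pd)
  then show "smooth (g [])" by (simp add: smooth_def)
  show "D w (g []) = g w" by (induction w) (simp_all add: pd)
qed

section \<open>Averaging operators\<close>

definition prm :: "real measure \<Rightarrow> bool" where
  "prm \<mu> \<longleftrightarrow> prob_space \<mu> \<and> sets \<mu> = sets borel"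

text \<open>One operator for two purposes: with the uniform law and \<open>c = 1\<close> it averages
  over a period, with the Gaussian law and \<open>c = \<sigma> * sqrt s\<close> it is the noise of
  one step.\<close>

definition Av :: "real measure \<Rightarrow> real \<Rightarrow> dir \<Rightarrow> (pt \<Rightarrow> real) \<Rightarrow> pt \<Rightarrow> real" where
  "Av \<mu> c a f z = (\<integral>\<xi>. f (z + (c * \<xi>) *\<^sub>R ax a) \<partial>\<mu>)"

lemma prm_measurable:
  assumes "prm \<mu>" "continuous_on UNIV g"
  shows "g \<in> borel_measurable \<mu>"
proof -
  have "g \<in> borel_measurable borel" using assms(2) by (rule borel_measurable_continuous_onI)
  then show ?thesis using assms(1) by (simp add: prm_def measurable_cong_sets[of \<mu> borel])
qed

lemma continuous_line: "continuous_on UNIV f \<Longrightarrow> continuous_on UNIV (\<lambda>\<xi>::real. f (z + (c * \<xi>) *\<^sub>R ax a))"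
  by (rule continuous_on_compose2[of UNIV f]) (auto intro!: continuous_intros)

lemma prm_integrable:
  fixes g :: "real \<Rightarrow> real"
  assumes "prm \<mu>" "continuous_on UNIV g" "\<And>x. \<bar>g x\<bar> \<le> B"
  shows "integrable \<mu> g"
proof -
  interpret prob_space \<mu> using assms(1) by (simp add: prm_def)
  show ?thesis
    by (rule integrable_const_bound[where B = B]) (use assms in \<open>auto intro: prm_measurable\<close>)
qed

lemma Av_integrable:
  assumes "prm \<mu>" "Cp f"
  shows "integrable \<mu> (\<lambda>\<xi>. f (z + (c * \<xi>) *\<^sub>R ax a))"
proof -
  obtain B where B: "\<And>z. \<bar>f z\<bar> \<le> B" using Cp_bounded[OF assms(2)] by blast
  show ?thesis
    using assms(2) by (intro prm_integrable[OF assms(1) continuous_line B]) (simp add: Cp_def)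
qed

lemma Av_const [simp]: "prm \<mu> \<Longrightarrow> Av \<mu> c a (\<lambda>z. k) z = k"
  by (simp add: Av_def prm_def prob_space.prob_space)

lemma Av_add: "prm \<mu> \<Longrightarrow> Cp f \<Longrightarrow> Cp g \<Longrightarrow> Av \<mu> c a (\<lambda>z. f z + g z) z = Av \<mu> c a f z + Av \<mu> c a g z"
  unfolding Av_def by (intro Bochner_Integration.integral_add Av_integrable)

lemma Av_diff: "prm \<mu> \<Longrightarrow> Cp f \<Longrightarrow> Cp g \<Longrightarrow> Av \<mu> c a (\<lambda>z. f z - g z) z = Av \<mu> c a f z - Av \<mu> c a g z"
  unfolding Av_def by (intro Bochner_Integration.integral_diff Av_integrable)

lemma Av_cmult: "Av \<mu> c a (\<lambda>z. k * f z) z = k * Av \<mu> c a f z"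
  unfolding Av_def by simp

lemma Av_sum:
  assumes "prm \<mu>" "\<And>i. i \<in> A \<Longrightarrow> Cp (g i)"
  shows "Av \<mu> c a (\<lambda>z. \<Sum>i\<in>A. g i z) z = (\<Sum>i\<in>A. Av \<mu> c a (g i) z)"
  unfolding Av_def using assms by (intro Bochner_Integration.integral_sum Av_integrable) auto

lemma Av_mono:
  "prm \<mu> \<Longrightarrow> Cp f \<Longrightarrow> Cp g \<Longrightarrow> (\<And>z. f z \<le> g z) \<Longrightarrow> Av \<mu> c a f z \<le> Av \<mu> c a g z"
  unfolding Av_def by (intro integral_mono Av_integrable) auto

lemma Av_nonneg: "(\<And>z. 0 \<le> f z) \<Longrightarrow> 0 \<le> Av \<mu> c a f z"
  unfolding Av_def by (intro Bochner_Integration.integral_nonneg) auto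

lemma Av_bound:
  assumes "prm \<mu>" "Cp f" "\<And>z. \<bar>f z\<bar> \<le> B"
  shows "\<bar>Av \<mu> c a f z\<bar> \<le> B"
proof -
  have "f z \<le> B" "- B \<le> f z" for z using assms(3)[of z] by auto
  then have "Av \<mu> c a f z \<le> B" "-B \<le> Av \<mu> c a f z"
    using Av_mono[of \<mu> f "\<lambda>_. B" c a z] Av_mono[of \<mu> "\<lambda>_. -B" f c a z] assms Cp_const by auto
  then show ?thesis by simp
qed

lemma Cp_Av:
  assumes "prm \<mu>" "Cp f"
  shows "Cp (Av \<mu> c a f)"
proof -
  obtain B where B: "\<And>z. \<bar>f z\<bar> \<le> B" using Cp_bounded[OF assms(2)] by blast
  interpret prob_space \<mu> using assms(1) by (simp add: prm_def)
  have cf: "continuous_on UNIV f" using assms(2) by (simp add: Cp_def)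
  have "isCont (Av \<mu> c a f) z" for z
    unfolding continuous_at_sequentially
  proof (intro allI impI)
    fix u :: "nat \<Rightarrow> pt" assume u: "u \<longlonglongrightarrow> z"
    have "(\<lambda>n. \<integral>\<xi>. f (u n + (c * \<xi>) *\<^sub>R ax a) \<partial>\<mu>) \<longlonglongrightarrow> (\<integral>\<xi>. f (z + (c * \<xi>) *\<^sub>R ax a) \<partial>\<mu>)"
    proof (rule integral_dominated_convergence[where w = "\<lambda>_. B"])
      show "AE \<xi> in \<mu>. (\<lambda>n. f (u n + (c * \<xi>) *\<^sub>R ax a)) \<longlonglongrightarrow> f (z + (c * \<xi>) *\<^sub>R ax a)"
      proof (intro AE_I2)
        fix \<xi>
        have "isCont f (z + (c * \<xi>) *\<^sub>R ax a)"
          using cf by (simp add: continuous_on_eq_continuous_at)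
        moreover have "(\<lambda>n. u n + (c * \<xi>) *\<^sub>R ax a) \<longlonglongrightarrow> z + (c * \<xi>) *\<^sub>R ax a"
          by (intro tendsto_add u tendsto_const)
        ultimately show "(\<lambda>n. f (u n + (c * \<xi>) *\<^sub>R ax a)) \<longlonglongrightarrow> f (z + (c * \<xi>) *\<^sub>R ax a)"
          by (rule isCont_tendsto_compose)
      qed
      show "(\<lambda>\<xi>. f (z + (c * \<xi>) *\<^sub>R ax a)) \<in> borel_measurable \<mu>"
        by (intro prm_measurable assms continuous_line cf)
      show "(\<lambda>\<xi>. f (u n + (c * \<xi>) *\<^sub>R ax a)) \<in> borel_measurable \<mu>" for n
        by (intro prm_measurable assms continuous_line cf)
    qed (use B in auto)
    then show "(Av \<mu> c a f \<circ> u) \<longlonglongrightarrow> Av \<mu> c a f z" by (simp add: Av_def comp_def)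
  qed
  moreover have "periodic (Av \<mu> c a f)"
  proof -
    have "f (z + ax b + x *\<^sub>R ax a) = f (z + x *\<^sub>R ax a)" for z b x
    proof -
      have "z + ax b + x *\<^sub>R ax a = (z + x *\<^sub>R ax a) + ax b" by simp
      then show ?thesis using assms(2) unfolding Cp_def periodic_def by metis
    qed
    then show ?thesis by (simp add: periodic_def Av_def)
  qed
  ultimately show ?thesis by (simp add: Cp_def continuous_at_imp_continuous_on)
qed

text \<open>Fubini; boundedness makes the integrand integrable for the product of the two
  probability measures. This moves the spatial mean past the Gaussian averages.\<close>

lemma Av_commute:
  assumes "prm \<mu>" "prm \<nu>" "Cp f"
  shows "Av \<mu> c a (Av \<nu> d b f) = Av \<nu> d b (Av \<mu> c a f)"
proof
  fix z
  obtain B where B: "\<And>z. \<bar>f z\<bar> \<le> B" using Cp_bounded[OF assms(3)] by blast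
  interpret M: prob_space \<mu> using assms(1) by (simp add: prm_def)
  interpret N: prob_space \<nu> using assms(2) by (simp add: prm_def)
  interpret P: pair_prob_space \<mu> \<nu> ..
  let ?g = "\<lambda>x y. f (z + (c * x) *\<^sub>R ax a + (d * y) *\<^sub>R ax b)"
  have s: "sets (\<mu> \<Otimes>\<^sub>M \<nu>) = sets (borel :: (real \<times> real) measure)"
    using assms sets_pair_measure_cong[of \<mu> borel \<nu> borel]
    unfolding prm_def by (metis borel_prod)
  have "continuous_on UNIV (\<lambda>p::real\<times>real. ?g (fst p) (snd p))"
    using assms(3) unfolding Cp_def
    by (rule continuous_on_compose2[of UNIV f, OF conjunct1]) (auto intro!: continuous_intros)
  then have "(\<lambda>p. ?g (fst p) (snd p)) \<in> borel_measurable (\<mu> \<Otimes>\<^sub>M \<nu>)"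
    unfolding measurable_cong_sets[OF s refl] by (rule borel_measurable_continuous_onI)
  then have i: "integrable (\<mu> \<Otimes>\<^sub>M \<nu>) (case_prod ?g)"
    by (intro P.integrable_const_bound[where B = B]) (use B in \<open>auto simp: split_beta'\<close>)
  have "Av \<mu> c a (Av \<nu> d b f) z = (\<integral>x. (\<integral>y. ?g x y \<partial>\<nu>) \<partial>\<mu>)" by (simp add: Av_def)
  also have "\<dots> = (\<integral>y. (\<integral>x. ?g x y \<partial>\<mu>) \<partial>\<nu>)"
    using P.Fubini_integral[OF i] by simp
  also have "\<dots> = Av \<nu> d b (Av \<mu> c a f) z" by (simp add: Av_def add_ac)
  finally show "Av \<mu> c a (Av \<nu> d b f) z = Av \<nu> d b (Av \<mu> c a f) z" .
qed

text \<open>Jensen's inequality, as nonnegativity of the variance.\<close>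

lemma Av_square:
  assumes "prm \<mu>" "Cp f"
  shows "(Av \<mu> c a f z)\<^sup>2 \<le> Av \<mu> c a (\<lambda>z. (f z)\<^sup>2) z"
proof -
  let ?m = "Av \<mu> c a f z"
  have "0 \<le> Av \<mu> c a (\<lambda>y. (f y - ?m)\<^sup>2) z" by (rule Av_nonneg) simp
  also have "(\<lambda>y. (f y - ?m)\<^sup>2) = (\<lambda>y. ((f y)\<^sup>2 - (2 * ?m) * f y) + ?m\<^sup>2)"
    by (auto simp: power2_eq_square algebra_simps)
  also have "Av \<mu> c a \<dots> z = Av \<mu> c a (\<lambda>z. (f z)\<^sup>2) z - 2 * ?m * ?m + ?m\<^sup>2"
  proof -
    have "Av \<mu> c a (\<lambda>y. ((f y)\<^sup>2 - (2 * ?m) * f y) + ?m\<^sup>2) z = Av \<mu> c a (\<lambda>y. (f y)\<^sup>2 - (2 * ?m) * f y) z + Av \<mu> c a (\<lambda>y. ?m\<^sup>2) z"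
      using assms by (intro Av_add Cp_diff Cp_power Cp_cmult Cp_const)
    also have "Av \<mu> c a (\<lambda>y. (f y)\<^sup>2 - (2 * ?m) * f y) z = Av \<mu> c a (\<lambda>y. (f y)\<^sup>2) z - Av \<mu> c a (\<lambda>y. (2 * ?m) * f y) z"
      using assms by (intro Av_diff Cp_power Cp_cmult)
    finally show ?thesis using assms(1) by (simp only: Av_cmult Av_const)
  qed
  finally show ?thesis by (simp add: power2_eq_square)
qed

text \<open>The uniform quadratic remainder survives averaging because the measure has mass one, so
  no dominated convergence for difference quotients is involved.\<close>

lemma Av_has_derivative:
  assumes "prm \<mu>" "Sm f"
  shows "(Av \<mu> c a f has_derivative (\<lambda>h. \<Sum>b\<in>UNIV. (h \<bullet> ax b) * Av \<mu> c a (pd b f) z)) (at z)"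
proof -
  obtain B where B0: "B \<ge> 0" and B: "bnd 2 f B" using Sm_bnd[OF assms(2)] by blast
  let ?F = "\<lambda>h. \<Sum>b\<in>UNIV. (h \<bullet> ax b) * Av \<mu> c a (pd b f) z"
  have C: "Cp f" "\<And>b. Cp (pd b f)" using assms by (auto intro: Sm_Cp Sm_pd)
  have rem: "\<bar>Av \<mu> c a f (z + h) - Av \<mu> c a f z - ?F h\<bar> \<le> B * (norm h)\<^sup>2" for h
  proof -
    have tr: "Cp (\<lambda>y. f (y + h))"
    proof -
      have "f (y + ax b + h) = f (y + h)" for y b
      proof -
        have "y + ax b + h = (y + h) + ax b" by simp
        then show ?thesis using C(1) unfolding Cp_def periodic_def by metis
      qed
      moreover have "continuous_on UNIV (\<lambda>y. f (y + h))"
        using C(1) unfolding Cp_def by (rule continuous_on_compose2[of UNIV f, OF conjunct1]) (auto intro!: continuous_intros)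
      ultimately show ?thesis by (auto simp: Cp_def periodic_def)
    qed
    have dC: "Cp (dird h f)" unfolding dird_def[abs_def] by (intro Cp_sum Cp_cmult C)
    have 1: "Av \<mu> c a f (z + h) = Av \<mu> c a (\<lambda>y. f (y + h)) z" by (simp add: Av_def add_ac)
    have "Av \<mu> c a (dird h f) z = ?F h"
      unfolding dird_def[abs_def] using C assms(1) by (subst Av_sum) (auto simp: Av_cmult)
    then have "Av \<mu> c a f (z + h) - Av \<mu> c a f z - ?F h = Av \<mu> c a (\<lambda>y. f (y + h) - f y - dird h f y) z"
      unfolding 1 using tr C dC assms(1) by (subst Av_diff Av_diff; (intro Cp_diff)?; simp?)+
    also have "\<bar>\<dots>\<bar> \<le> B * (norm h)\<^sup>2"
      using tr C dC assms(1) quadratic_remainder[OF Sm_smooth[OF assms(2)] B]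
      by (intro Av_bound Cp_diff) auto
    finally show ?thesis .
  qed
  show ?thesis
    unfolding has_derivative_at_alt
  proof (intro conjI allI impI)
    show "bounded_linear ?F"
      by (intro bounded_linear_sum bounded_linear_mult_const bounded_linear_inner_left)
    fix e :: real assume e: "e > 0"
    \<comment> \<open>The radius uses \<open>B + 1\<close> because \<open>B\<close> may be
      zero.\<close>
    have "norm (Av \<mu> c a f y - Av \<mu> c a f z - ?F (y - z)) \<le> e * norm (y - z)"
      if y: "norm (y - z) < e / (B + 1)" for y
    proof -
      have "(B + 1) * norm (y - z) \<le> e" using y B0 by (simp add: field_simps)
      then have "B * norm (y - z) \<le> e" 
        using mult_right_mono[of B "B + 1" "norm (y - z)"] by simp
      then have "B * norm (y - z) * norm (y - z) \<le> e * norm (y - z)" by (rule mult_right_mono) simp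
      then show ?thesis using rem[of "y - z"] by (simp add: power2_eq_square mult.assoc)
    qed
    then show "\<exists>d>0. \<forall>y. norm (y - z) < d \<longrightarrow> norm (Av \<mu> c a f y - Av \<mu> c a f z - ?F (y - z)) \<le> e * norm (y - z)"
      using e B0 by (intro exI[of _ "e / (B + 1)"]) auto
  qed
qed

lemma pd_Av:
  assumes "prm \<mu>" "Sm f"
  shows "pd b (Av \<mu> c a f) = Av \<mu> c a (pd b f)"
  by (rule ext, subst pd_eqI[OF Av_has_derivative[OF assms]]) (cases b; simp add: sum_dir)

lemma Sm_Av:
  assumes "prm \<mu>" "Sm f"
  shows "Sm (Av \<mu> c a f)"
proof -
  have "Ck n (Av \<mu> c a g)" if "Sm g" for n g
    using that
  proof (induction n arbitrary: g)
    case 0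
    then show ?case using Av_has_derivative[OF assms(1)] unfolding differentiable_def Ck.simps by blast
  next
    case (Suc n)
    then show ?case using Av_has_derivative[OF assms(1)] Sm_pd[OF Suc.prems] pd_Av[OF assms(1)]
      unfolding differentiable_def Ck.simps by fastforce
  qed
  then show ?thesis using Cp_Av[OF assms(1) Sm_Cp[OF assms(2)]] assms by (simp add: Sm_def smooth_def Cp_def)
qed

lemma D_Av:
  assumes "prm \<mu>" "Sm f"
  shows "D w (Av \<mu> c a f) = Av \<mu> c a (D w f)"
  by (induction w) (auto simp: pd_Av assms Sm_D)

lemma bnd_Av:
  assumes "prm \<mu>" "Sm f" "bnd n f B"
  shows "bnd n (Av \<mu> c a f) B"
  unfolding bnd_def
proof
  fix z
  have C: "Cp (D w f)" for w using assms by (intro Sm_Cp Sm_D)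
  have "J n (Av \<mu> c a f) z = (\<Sum>w\<in>words n. \<bar>Av \<mu> c a (D w f) z\<bar>)"
    using assms by (simp add: J_def D_Av)
  also have "\<dots> \<le> (\<Sum>w\<in>words n. Av \<mu> c a (\<lambda>z. \<bar>D w f z\<bar>) z)"
  proof (rule sum_mono)
    fix w
    have "Av \<mu> c a (D w f) z \<le> Av \<mu> c a (\<lambda>z. \<bar>D w f z\<bar>) z"
      by (intro Av_mono assms C Cp_abs) simp
    moreover have "Av \<mu> c a (\<lambda>z. - 1 * D w f z) z \<le> Av \<mu> c a (\<lambda>z. \<bar>D w f z\<bar>) z"
      by (intro Av_mono assms C Cp_abs Cp_cmult) simp
    ultimately show "\<bar>Av \<mu> c a (D w f) z\<bar> \<le> Av \<mu> c a (\<lambda>z. \<bar>D w f z\<bar>) z"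
      unfolding Av_cmult by simp
  qed
  also have "\<dots> = Av \<mu> c a (J n f) z"
    unfolding J_def[abs_def] using assms(1) C by (subst Av_sum) auto
  also have "\<dots> \<le> Av \<mu> c a (\<lambda>_. B) z"
    using assms by (intro Av_mono Cp_J Cp_const) (auto simp: bnd_def)
  finally show "J n (Av \<mu> c a f) z \<le> B" using assms(1) by simp
qed

section \<open>The uniform and the Gaussian distribution\<close>

definition unif :: "real measure" where
  "unif = density lborel (\<lambda>x. ennreal (indicator {0..1} x))"

definition gauss :: "real measure" where
  "gauss = density lborel (\<lambda>x. ennreal (std_normal_density x))"

lemma prm_unif [simp]: "prm unif"
proof -
  have "emeasure unif (space unif) = emeasure lborel {0..1::real}"
    by (simp add: unif_def emeasure_density ennreal_indicator)
  also have "\<dots> = 1" by simp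
  finally show ?thesis unfolding prm_def by (auto intro!: prob_spaceI simp: unif_def)
qed

lemma prm_gauss [simp]: "prm gauss"
  unfolding prm_def gauss_def using prob_space_normal_density[of 1 0] by simp

lemma integral_gauss:
  "g \<in> borel_measurable borel \<Longrightarrow> (\<integral>x. g x \<partial>gauss) = (\<integral>x. std_normal_density x * g x \<partial>lborel)"
  unfolding gauss_def by (subst integral_real_density) auto

lemma integral_unif:
  assumes "continuous_on UNIV (g :: real \<Rightarrow> real)"
  shows "(\<integral>x. g x \<partial>unif) = integral {0..1} g"
proof -
  have m: "g \<in> borel_measurable borel" using assms by (rule borel_measurable_continuous_onI)
  have "(\<integral>x. g x \<partial>unif) = (LINT x:{0..1}|lborel. g x)"
    unfolding unif_def using m by (subst integral_real_density) (auto simp: set_lebesgue_integral_def)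
  also have "\<dots> = integral {0..1} g"
    using continuous_on_subset[OF assms] by (intro set_borel_integral_eq_integral borel_integrable_atLeastAtMost') auto
  finally show ?thesis .
qed

section \<open>Poincare, Sobolev and Gaussian inequalities\<close>

abbreviation Au :: "dir \<Rightarrow> (pt \<Rightarrow> real) \<Rightarrow> pt \<Rightarrow> real" where
  "Au \<equiv> Av unif 1"

abbreviation Ga :: "real \<Rightarrow> dir \<Rightarrow> (pt \<Rightarrow> real) \<Rightarrow> pt \<Rightarrow> real" where
  "Ga \<equiv> Av gauss"

lemma continuous_line1: "continuous_on UNIV f \<Longrightarrow> continuous_on A (\<lambda>\<xi>::real. f (z + \<xi> *\<^sub>R ax a))"
  using continuous_on_subset[OF continuous_line[of f z 1 a], of A] by simp

lemma Au_eq: "Cp f \<Longrightarrow> Au a f z = integral {0..1} (\<lambda>\<xi>. f (z + \<xi> *\<^sub>R ax a))"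
  unfolding Av_def by (subst integral_unif) (auto simp: Cp_def intro: continuous_line1)

lemma Au_derivative:
  assumes C: "Cp F" "Cp Fa"
    and d: "\<And>z r. ((\<lambda>r. F (z + r *\<^sub>R ax a)) has_real_derivative Fa (z + r *\<^sub>R ax a)) (at r)"
  shows "Au a Fa z = 0"
proof -
  have "((\<lambda>\<xi>. Fa (z + \<xi> *\<^sub>R ax a)) has_integral (F (z + 1 *\<^sub>R ax a) - F (z + 0 *\<^sub>R ax a))) {0..1}"
    using d[of z] by (intro fundamental_theorem_of_calculus)
      (auto simp: has_real_derivative_iff_has_vector_derivative[symmetric] intro: DERIV_subset)
  then show ?thesis using C by (simp add: Au_eq integral_unique Cp_def periodic_def)
qed

text \<open>The circle is cut open at another point: after reduction to
  \<open>0 \<le> p \<le> 1\<close> the window from \<open>p\<close> to \<open>1 + p\<close> is split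
  at 1 and its tail is moved back by a period.\<close>

lemma Au_shift:
  assumes "Cp f"
  shows "Au a f (z + r *\<^sub>R ax a) = Au a f z"
proof -
  define g where "g \<xi> = f (z + \<xi> *\<^sub>R ax a)" for \<xi>
  have per: "periodic f" using assms by (simp add: Cp_def)
  have cg: "continuous_on A g" for A
    unfolding g_def using assms by (intro continuous_line1) (simp add: Cp_def)
  have gper: "g (\<xi> + 1) = g \<xi>" for \<xi>
  proof -
    have "z + (\<xi> + 1) *\<^sub>R ax a = (z + \<xi> *\<^sub>R ax a) + ax a" by (simp add: algebra_simps)
    then show ?thesis unfolding g_def using per by (metis periodic_def)
  qed
  have gi: "g integrable_on {x..y}" for x y by (intro integrable_continuous_real cg)
  have shift: "integral {0..1} (\<lambda>\<xi>. g (\<xi> + p)) = integral {0..1} g" if p: "0 \<le> p" "p \<le> 1" for p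
  proof -
    have "integral {0..1} (\<lambda>\<xi>. g (\<xi> + p)) = integral {p..1+p} g"
      using integral_shift_real_ivl[of p p "1 + p" g] by simp
    also have "\<dots> = integral {p..1} g + integral {1..1+p} g"
      using p by (intro Henstock_Kurzweil_Integration.integral_combine[symmetric] gi) auto
    also have "integral {1..1+p} g = integral {0..p} (\<lambda>\<xi>. g (\<xi> + 1))"
      using integral_shift_real_ivl[of 1 1 "1 + p" g] by simp
    also have "\<dots> = integral {0..p} g" by (simp add: gper)
    also have "integral {p..1} g + integral {0..p} g = integral {0..1} g"
      using Henstock_Kurzweil_Integration.integral_combine[of 0 p 1 g] p gi by simp
    finally show ?thesis .
  qed
  have "Au a f (z + r *\<^sub>R ax a) = Au a f ((z + frac r *\<^sub>R ax a) + of_int \<lfloor>r\<rfloor> *\<^sub>R ax a)"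
    by (simp add: frac_def algebra_simps)
  also have "\<dots> = Au a f (z + frac r *\<^sub>R ax a)"
    using Cp_Av[OF prm_unif assms] by (intro periodic_int) (simp add: Cp_def)
  also have "\<dots> = integral {0..1} (\<lambda>\<xi>. g (\<xi> + frac r))"
    using assms by (simp add: Au_eq g_def algebra_simps)
  also have "\<dots> = integral {0..1} g" by (rule shift) (auto intro: less_imp_le frac_lt_1)
  also have "\<dots> = Au a f z" using assms by (simp add: Au_eq g_def[abs_def])
  finally show ?thesis .
qed

lemma Au_zero:
  assumes "Cp f" "\<And>z. 0 \<le> f z" "Au a f z = 0"
  shows "f z = 0"
proof -
  have "integral {0..1} (\<lambda>\<xi>. f (z + \<xi> *\<^sub>R ax a)) = 0" using assms by (simp add: Au_eq)
  moreover have "continuous_on {0..1} (\<lambda>\<xi>::real. f (z + \<xi> *\<^sub>R ax a))"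
    using assms(1) by (intro continuous_line1) (simp add: Cp_def)
  ultimately have "\<forall>\<xi>\<in>{0..1}. f (z + \<xi> *\<^sub>R ax a) = 0"
    using integral_eq_0_iff[of 0 1 "\<lambda>\<xi>. f (z + \<xi> *\<^sub>R ax a)"] assms(2) by simp
  from bspec[OF this, of 0] show ?thesis by simp
qed

text \<open>However large \<open>q\<close> is, only its fractional part matters by periodicity, so
  the path of integration lies within one period.\<close>

lemma difference_le_Au:
  assumes "Sm f"
  shows "\<bar>f (z + q *\<^sub>R ax a) - f z\<bar> \<le> Au a (\<lambda>z. \<bar>pd a f z\<bar>) z"
proof -
  have C: "Cp (pd a f)" "Cp (\<lambda>z. \<bar>pd a f z\<bar>)" using assms by (auto intro!: Sm_Cp Sm_pd Cp_abs)
  define p where "p = frac q"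
  have p: "0 \<le> p" "p \<le> 1" by (auto simp: p_def intro: less_imp_le frac_lt_1)
  have i: "(\<lambda>\<xi>::real. pd a f (z + \<xi> *\<^sub>R ax a)) integrable_on {x..y}" 
     "(\<lambda>\<xi>::real. \<bar>pd a f (z + \<xi> *\<^sub>R ax a)\<bar>) integrable_on {x..y}" for x y
    using C by (auto intro!: integrable_continuous_real continuous_line1 continuous_on_rabs simp: Cp_def)
  have "f (z + q *\<^sub>R ax a) = f ((z + p *\<^sub>R ax a) + of_int \<lfloor>q\<rfloor> *\<^sub>R ax a)"
    by (simp add: p_def frac_def algebra_simps)
  also have "\<dots> = f (z + p *\<^sub>R ax a)" using assms by (intro periodic_int) (simp add: Sm_def)
  finally have 1: "f (z + q *\<^sub>R ax a) = f (z + p *\<^sub>R ax a)" .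
  have "((\<lambda>\<xi>. pd a f (z + \<xi> *\<^sub>R ax a)) has_integral (f (z + p *\<^sub>R ax a) - f (z + 0 *\<^sub>R ax a))) {0..p}"
    using p pd_line[OF smooth_differentiable[OF Sm_smooth[OF assms]], of z]
    by (intro fundamental_theorem_of_calculus)
      (auto simp: has_real_derivative_iff_has_vector_derivative[symmetric] intro: DERIV_subset)
  then have "\<bar>f (z + p *\<^sub>R ax a) - f z\<bar> = norm (integral {0..p} (\<lambda>\<xi>. pd a f (z + \<xi> *\<^sub>R ax a)))"
    by (simp add: integral_unique)
  also have "\<dots> \<le> integral {0..p} (\<lambda>\<xi>. \<bar>pd a f (z + \<xi> *\<^sub>R ax a)\<bar>)"
    by (intro integral_norm_bound_integral i) auto
  also have "\<dots> \<le> integral {0..1} (\<lambda>\<xi>. \<bar>pd a f (z + \<xi> *\<^sub>R ax a)\<bar>)"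
    using p by (intro integral_subset_le i) auto
  finally show ?thesis using C by (simp add: 1 Au_eq)
qed

text \<open>Unlike \<open>Av_mono\<close> this compares along the line through \<open>z\<close>
  only; the constants in \<open>poincare_1\<close> depend on that line.\<close>

lemma Au_line_mono:
  assumes "Cp f" "\<And>q. f (z + q *\<^sub>R ax a) \<le> k"
  shows "Au a f z \<le> k"
proof -
  have "Au a f z \<le> (\<integral>\<xi>. k \<partial>unif)"
    unfolding Av_def using Av_integrable[OF prm_unif assms(1), of z 1 a] assms(2)
    by (intro integral_mono) (auto intro!: prm_integrable[of _ _ "\<bar>k\<bar>"])
  then show ?thesis using Av_const[OF prm_unif, of 1 a k z] unfolding Av_def by metis
qed

text \<open>By \<open>difference_le_Au\<close> and Jensen, the squared difference of any two values
  on the circle is at most the mean of the squared derivative. Averaging over both endpoints gives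
  twice the variance. The constant 1 is not sharp, but it suffices to bound each energy by its
  dissipation.\<close>

lemma poincare_1:
  assumes "Sm f"
  shows "Au a (\<lambda>z. (f z)\<^sup>2) z \<le> (Au a f z)\<^sup>2 + Au a (\<lambda>z. (pd a f z)\<^sup>2) z"
proof -
  have C0: "Cp f" "Cp (pd a f)" using assms by (auto intro!: Sm_Cp Sm_pd)
  note C = C0(1) Cp_power[OF C0(1), of 2] C0(2) Cp_abs[OF C0(2)]
  define m where "m = Au a f z"
  define s where "s = Au a (\<lambda>z. (f z)\<^sup>2) z"
  define k where "k = Au a (\<lambda>z. (pd a f z)\<^sup>2) z"
  have sq: "(f (y + q *\<^sub>R ax a) - f y)\<^sup>2 \<le> k" if "y = z + r *\<^sub>R ax a" for y q r
  proof -
    have "\<bar>f (y + q *\<^sub>R ax a) - f y\<bar>\<^sup>2 \<le> (Au a (\<lambda>z. \<bar>pd a f z\<bar>) y)\<^sup>2"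
      using difference_le_Au[OF assms] by (intro power_mono) auto
    also have "\<dots> \<le> Au a (\<lambda>z. \<bar>pd a f z\<bar>\<^sup>2) y" using C by (intro Av_square) auto
    also have "\<dots> = k"
      using C Au_shift[of "\<lambda>z. (pd a f z)\<^sup>2" a z r] that by (auto simp: k_def)
    finally show ?thesis by simp
  qed
  \<comment> \<open>The average over the second endpoint with \<open>y\<close> fixed; the average
    over \<open>y\<close> follows below.\<close>
  have 1: "s - 2 * f y * m + (f y)\<^sup>2 \<le> k" if y: "y = z + r *\<^sub>R ax a" for y r
  proof -
    have "Au a (\<lambda>x. ((f x)\<^sup>2 - (2 * f y) * f x) + (f y)\<^sup>2) y \<le> k"
    proof (rule Au_line_mono)
      fix q
      show "(f (y + q *\<^sub>R ax a))\<^sup>2 - 2 * f y * f (y + q *\<^sub>R ax a) + (f y)\<^sup>2 \<le> k"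
        using sq[OF y, of q] by (simp add: power2_eq_square algebra_simps)
    qed (intro Cp_add Cp_diff C Cp_cmult Cp_const)
    also have "Au a (\<lambda>x. ((f x)\<^sup>2 - (2 * f y) * f x) + (f y)\<^sup>2) y
        = Au a (\<lambda>x. (f x)\<^sup>2 - (2 * f y) * f x) y + Au a (\<lambda>x. (f y)\<^sup>2) y"
      by (intro Av_add prm_unif Cp_diff C Cp_cmult Cp_const)
    also have "Au a (\<lambda>x. (f x)\<^sup>2 - (2 * f y) * f x) y = Au a (\<lambda>x. (f x)\<^sup>2) y - Au a (\<lambda>x. (2 * f y) * f x) y"
      by (intro Av_diff prm_unif C Cp_cmult)
    also have "Au a (\<lambda>x. (2 * f y) * f x) y = (2 * f y) * Au a f y" by (rule Av_cmult)
    also have "Au a (\<lambda>x. (f x)\<^sup>2) y = s" using Au_shift[OF C(2)] by (simp add: s_def y)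
    also have "Au a f y = m" using Au_shift[OF C(1)] by (simp add: m_def y)
    finally show ?thesis by simp
  qed
  have "Au a (\<lambda>y. (s - (2 * m) * f y) + (f y)\<^sup>2) z \<le> k"
  proof (rule Au_line_mono)
    fix q show "s - 2 * m * f (z + q *\<^sub>R ax a) + (f (z + q *\<^sub>R ax a))\<^sup>2 \<le> k"
      using 1[OF refl, of q] by (simp add: mult.commute mult.left_commute)
  qed (intro Cp_add Cp_diff C Cp_cmult Cp_const)
  also have "Au a (\<lambda>y. (s - (2 * m) * f y) + (f y)\<^sup>2) z = Au a (\<lambda>y. s - (2 * m) * f y) z + Au a (\<lambda>y. (f y)\<^sup>2) z"
    by (intro Av_add prm_unif Cp_diff C Cp_cmult Cp_const)
  also have "Au a (\<lambda>y. s - (2 * m) * f y) z = Au a (\<lambda>y. s) z - Au a (\<lambda>y. (2 * m) * f y) z"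
    by (intro Av_diff prm_unif C Cp_cmult Cp_const)
  also have "Au a (\<lambda>y. (2 * m) * f y) z = (2 * m) * m" unfolding m_def by (rule Av_cmult)
  finally have "2 * s - 2 * m * m \<le> k" by (simp add: s_def)
  moreover have "0 \<le> k" unfolding k_def by (intro Av_nonneg) simp
  ultimately have "s \<le> m\<^sup>2 + k" by (simp add: power2_eq_square)
  then show ?thesis unfolding s_def m_def k_def .
qed

text \<open>Average \<open>|f z| \<le> |f y| + k\<close> over \<open>y\<close> on the line, square,
  and apply Jensen to both terms.\<close>

lemma sobolev_1:
  assumes "Sm f"
  shows "(f z)\<^sup>2 \<le> 2 * Au a (\<lambda>z. (f z)\<^sup>2 + (pd a f z)\<^sup>2) z"
proof -
  have C0: "Cp f" "Cp (pd a f)" using assms by (auto intro!: Sm_Cp Sm_pd)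
  note C = C0 Cp_abs[OF C0(1)] Cp_abs[OF C0(2)]
  define k where "k = Au a (\<lambda>z. \<bar>pd a f z\<bar>) z"
  have "Au a (\<lambda>y. (\<bar>f z\<bar> - k) - \<bar>f y\<bar>) z \<le> 0"
  proof (rule Au_line_mono)
    fix q show "\<bar>f z\<bar> - k - \<bar>f (z + q *\<^sub>R ax a)\<bar> \<le> 0"
      using difference_le_Au[OF assms, of z q a] unfolding k_def by linarith
  qed (intro Cp_diff Cp_const C)
  moreover have "Au a (\<lambda>y. (\<bar>f z\<bar> - k) - \<bar>f y\<bar>) z = Au a (\<lambda>y. \<bar>f z\<bar> - k) z - Au a (\<lambda>y. \<bar>f y\<bar>) z"
    by (intro Av_diff prm_unif C Cp_const)
  ultimately have "\<bar>f z\<bar> \<le> Au a (\<lambda>y. \<bar>f y\<bar>) z + k" by simp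
  then have "\<bar>f z\<bar>\<^sup>2 \<le> (Au a (\<lambda>y. \<bar>f y\<bar>) z + k)\<^sup>2" by (intro power_mono) auto
  also have "\<dots> \<le> 2 * (Au a (\<lambda>y. \<bar>f y\<bar>) z)\<^sup>2 + 2 * k\<^sup>2"
    using sum_squares_bound[of "Au a (\<lambda>y. \<bar>f y\<bar>) z" k] by (simp add: power2_sum)
  also have "\<dots> \<le> 2 * Au a (\<lambda>y. \<bar>f y\<bar>\<^sup>2) z + 2 * Au a (\<lambda>y. \<bar>pd a f y\<bar>\<^sup>2) z"
    unfolding k_def by (intro add_mono mult_left_mono Av_square prm_unif C) auto
  also have "\<dots> = 2 * Au a (\<lambda>z. (f z)\<^sup>2 + (pd a f z)\<^sup>2) z"
    using C by (subst Av_add) (auto simp: algebra_simps)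
  finally show ?thesis by simp
qed

section \<open>The spatial mean at a fixed time, kept as a function on space-time\<close>

definition M :: "(pt \<Rightarrow> real) \<Rightarrow> pt \<Rightarrow> real" where
  "M f = Au DX (Au DY f)"

lemma M_swap: "Cp f \<Longrightarrow> M f = Au DY (Au DX f)"
  unfolding M_def by (rule Av_commute) auto

lemma Cp_M: "Cp f \<Longrightarrow> Cp (M f)"
  unfolding M_def by (intro Cp_Av prm_unif)

lemma M_const [simp]: "M (\<lambda>z. k) = (\<lambda>z. k)"
proof -
  have "Au a (\<lambda>z. k) = (\<lambda>z. k)" for a by (rule ext) simp
  then show ?thesis by (simp add: M_def)
qed

lemma M_add: "Cp f \<Longrightarrow> Cp g \<Longrightarrow> M (\<lambda>z. f z + g z) z = M f z + M g z"
proof -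
  assume C: "Cp f" "Cp g"
  then have "Au DY (\<lambda>z. f z + g z) = (\<lambda>z. Au DY f z + Au DY g z)" by (intro ext Av_add prm_unif)
  with C show ?thesis by (simp add: M_def Av_add Cp_Av)
qed

lemma M_diff: "Cp f \<Longrightarrow> Cp g \<Longrightarrow> M (\<lambda>z. f z - g z) z = M f z - M g z"
proof -
  assume C: "Cp f" "Cp g"
  then have "Au DY (\<lambda>z. f z - g z) = (\<lambda>z. Au DY f z - Au DY g z)" by (intro ext Av_diff prm_unif)
  with C show ?thesis by (simp add: M_def Av_diff Cp_Av)
qed

lemma M_cmult: "M (\<lambda>z. k * f z) z = k * M f z"
  unfolding M_def by (simp add: Av_cmult[abs_def])

lemma M_sum:
  assumes "\<And>i. i \<in> A \<Longrightarrow> Cp (g i)"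
  shows "M (\<lambda>z. \<Sum>i\<in>A. g i z) z = (\<Sum>i\<in>A. M (g i) z)"
proof -
  have "Au DY (\<lambda>z. \<Sum>i\<in>A. g i z) = (\<lambda>z. \<Sum>i\<in>A. Au DY (g i) z)"
    using assms by (intro ext Av_sum prm_unif)
  with assms show ?thesis by (simp add: M_def Av_sum Cp_Av)
qed

lemma M_mono: "Cp f \<Longrightarrow> Cp g \<Longrightarrow> (\<And>z. f z \<le> g z) \<Longrightarrow> M f z \<le> M g z"
  unfolding M_def by (intro Av_mono prm_unif Cp_Av)

lemma M_nonneg: "(\<And>z. 0 \<le> f z) \<Longrightarrow> 0 \<le> M f z"
  unfolding M_def by (intro Av_nonneg)

lemma M_shift:
  assumes "Cp f" "j = DX \<or> j = DY"
  shows "M f (z + r *\<^sub>R ax j) = M f z"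
proof (cases "j = DX")
  case True
  then show ?thesis unfolding M_def using assms by (simp add: Au_shift Cp_Av del: ax.simps)
next
  case False
  then show ?thesis unfolding M_swap[OF assms(1)] using assms by (simp add: Au_shift Cp_Av del: ax.simps)
qed

lemma Cp_shear:
  assumes "Cp f" "Cp b"
  shows "Cp (\<lambda>z. f (shear j b s z))"
proof -
  have "f (shear j b s (z + ax a)) = f (shear j b s z)" for z a
  proof -
    have "shear j b s (z + ax a) = shear j b s z + ax a"
      using assms by (simp add: shear_def Cp_def periodic_def)
    then show ?thesis using assms by (simp add: Cp_def periodic_def)
  qed
  moreover have "continuous_on UNIV (\<lambda>z. f (shear j b s z))"
  proof (rule continuous_on_compose2[of UNIV f])
    show "continuous_on UNIV (shear j b s)"
      unfolding shear_def[abs_def] using assms by (auto simp: Cp_def intro!: continuous_intros)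
  qed (use assms in \<open>auto simp: Cp_def\<close>)
  ultimately show ?thesis by (simp add: Cp_def periodic_def)
qed

text \<open>Since \<open>b\<close> does not vary along \<open>j\<close>, the shear is a translation
  on each line in that direction, and averaging along \<open>j\<close> first removes it. No Jacobian
  is involved.\<close>

lemma M_shear:
  assumes "Cp f" "Cp b" "j = DX \<or> j = DY" and b: "\<And>z r. b (z + r *\<^sub>R ax j) = b z"
  shows "M (\<lambda>z. f (shear j b s z)) = M f"
proof -
  have "Au j (\<lambda>z. f (shear j b s z)) z = Au j f z" for z
  proof -
    have "Au j (\<lambda>z. f (shear j b s z)) z = Au j f (z + (s * b z) *\<^sub>R ax j)"
      unfolding Av_def shear_def using b by (simp add: algebra_simps)
    then show ?thesis using Au_shift[OF assms(1)] by simp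
  qed
  then have eq: "Au j (\<lambda>z. f (shear j b s z)) = Au j f" by auto
  show ?thesis
  proof (cases "j = DY")
    case True
    then show ?thesis using eq by (simp add: M_def)
  next
    case False
    then have "j = DX" using assms(3) by simp
    then show ?thesis using eq M_swap[OF assms(1)] M_swap[OF Cp_shear[OF assms(1,2), of j s]] by simp
  qed
qed

text \<open>After exchanging the averages, the Gaussian one acts on a function that is constant
  along spatial directions.\<close>

lemma M_gauss:
  assumes "Cp f" "a = DX \<or> a = DY"
  shows "M (Ga c a f) = M f"
proof
  fix z
  have "M (Ga c a f) z = Ga c a (M f) z"
    unfolding M_def using assms
    by (simp add: Av_commute[OF prm_unif prm_gauss] Cp_Av)
  also have "\<dots> = (\<integral>\<xi>. M f z \<partial>gauss)"
    unfolding Av_def by (simp add: M_shift[OF assms])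
  also have "\<dots> = M f z" using Av_const[OF prm_gauss, of c a "M f z" z] by (simp add: Av_def)
  finally show "M (Ga c a f) z = M f z" .
qed

lemma D_M: "Sm f \<Longrightarrow> D w (M f) = M (D w f)"
  unfolding M_def by (simp add: D_Av Sm_Av)

lemma M_D_zero:
  assumes "Sm f" "M f = (\<lambda>z. 0)"
  shows "M (D w f) = (\<lambda>z. 0)"
  using D_M[OF assms(1), of w] assms(2) by simp

text \<open>The one-dimensional inequality is used in direction \<open>DY\<close> and then in
  direction \<open>DX\<close> for the partial mean \<open>?g\<close>, whose derivative is controlled
  by Jensen.\<close>

lemma poincare:
  assumes "Sm f" "M f z = 0"
  shows "M (\<lambda>z. (f z)\<^sup>2) z \<le> M (\<lambda>z. (pd DX f z)\<^sup>2) z + M (\<lambda>z. (pd DY f z)\<^sup>2) z"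
proof -
  have C: "Cp f" "\<And>a. Cp (pd a f)" using assms by (auto intro!: Sm_Cp Sm_pd)
  let ?g = "Au DY f"
  have g: "Sm ?g" using assms by (intro Sm_Av) auto
  have "M (\<lambda>z. (f z)\<^sup>2) z \<le> Au DX (\<lambda>y. (?g y)\<^sup>2 + Au DY (\<lambda>z. (pd DY f z)\<^sup>2) y) z"
    unfolding M_def using assms C g Sm_Cp[OF g]
    by (intro Av_mono poincare_1 Cp_add Cp_Av Cp_power prm_unif) auto
  also have "\<dots> = Au DX (\<lambda>y. (?g y)\<^sup>2) z + M (\<lambda>z. (pd DY f z)\<^sup>2) z"
    unfolding M_def using C Sm_Cp[OF g] by (intro Av_add Cp_Av Cp_power prm_unif) auto
  also have "Au DX (\<lambda>y. (?g y)\<^sup>2) z \<le> (Au DX ?g z)\<^sup>2 + Au DX (\<lambda>y. (pd DX ?g y)\<^sup>2) z"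
    by (rule poincare_1[OF g])
  also have "Au DX ?g z = 0" using assms by (simp add: M_def)
  also have "pd DX ?g = Au DY (pd DX f)" using assms by (intro pd_Av) auto
  also have "Au DX (\<lambda>y. (Au DY (pd DX f) y)\<^sup>2) z \<le> M (\<lambda>z. (pd DX f z)\<^sup>2) z"
    unfolding M_def using C by (intro Av_mono Av_square Cp_Av Cp_power prm_unif) auto
  finally show ?thesis by simp
qed

text \<open>The one-dimensional bound in each spatial direction needs only four words, of which the
  longest is the mixed one. Time stays fixed, so the bound holds at every time separately; the sum
  over all words of length at most two is the form that fits \<open>En\<close>.\<close>

lemma sobolev:
  assumes "Sm f"
  shows "(f z)\<^sup>2 \<le> 4 * M (\<lambda>y. \<Sum>w\<in>words 2. (D w f y)\<^sup>2) z"
proof -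
  note S = assms Sm_pd[OF assms, of DY] Sm_pd[OF assms, of DX] Sm_pd[OF Sm_pd[OF assms, of DY], of DX]
  note C = S[THEN Sm_Cp]
  let ?e = "\<lambda>y. ((f y)\<^sup>2 + (pd DX f y)\<^sup>2) + ((pd DY f y)\<^sup>2 + (pd DX (pd DY f) y)\<^sup>2)"
  have Ce: "Cp ?e" using C by (intro Cp_add Cp_power)
  have "(f z)\<^sup>2 \<le> 2 * Au DY (\<lambda>z. (f z)\<^sup>2 + (pd DY f z)\<^sup>2) z" by (rule sobolev_1[OF assms])
  also have "\<dots> \<le> 2 * Au DY (\<lambda>y. 2 * Au DX ?e y) z"
  proof (intro mult_left_mono Av_mono prm_unif)
    fix y
    have "Au DX ?e y = Au DX (\<lambda>y. (f y)\<^sup>2 + (pd DX f y)\<^sup>2) y + Au DX (\<lambda>y. (pd DY f y)\<^sup>2 + (pd DX (pd DY f) y)\<^sup>2) y"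
      using C by (intro Av_add prm_unif Cp_add Cp_power)
    then show "(f y)\<^sup>2 + (pd DY f y)\<^sup>2 \<le> 2 * Au DX ?e y"
      using sobolev_1[OF S(1), of y DX] sobolev_1[OF S(2), of y DX] by linarith
  qed (use C Ce in \<open>auto intro!: Cp_add Cp_power Cp_cmult Cp_Av\<close>)
  also have "\<dots> = 4 * M ?e z" using Ce by (simp add: Av_cmult M_swap)
  also have "\<dots> \<le> 4 * M (\<lambda>y. \<Sum>w\<in>words 2. (D w f y)\<^sup>2) z"
  proof (intro mult_left_mono M_mono Ce Cp_sum Cp_power Sm_Cp Sm_D assms)
    fix y
    have "?e y = (\<Sum>w\<in>{[], [DX], [DY], [DX, DY]}. (D w f y)\<^sup>2)" by simp
    also have "\<dots> \<le> (\<Sum>w\<in>words 2. (D w f y)\<^sup>2)" by (rule sum_mono2) auto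
    finally show "?e y \<le> (\<Sum>w\<in>words 2. (D w f y)\<^sup>2)" .
  qed simp
  finally show ?thesis .
qed

section \<open>Gaussian integration by parts, Bessel's inequality and moments\<close>

lemma gauss_integrable:
  assumes "continuous_on UNIV (g :: real \<Rightarrow> real)" "\<And>x. \<bar>g x\<bar> \<le> B"
  shows "integrable lborel (\<lambda>x. std_normal_density x * (x ^ k * g x))"
proof (rule Bochner_Integration.integrable_bound)
  show "integrable lborel (\<lambda>x. B * (std_normal_density x * \<bar>x\<bar> ^ k))"
    using integrable_std_normal_moment_abs[of k] by simp
  have "g \<in> borel_measurable borel" using assms(1) by (rule borel_measurable_continuous_onI)
  then show "(\<lambda>x. std_normal_density x * (x ^ k * g x)) \<in> borel_measurable lborel" by simp
  show "AE x in lborel. norm (std_normal_density x * (x ^ k * g x)) \<le> norm (B * (std_normal_density x * \<bar>x\<bar> ^ k))"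
  proof (rule AE_I2)
    fix x :: real
    have "B \<ge> 0" using assms(2)[of x] by linarith
    have "\<bar>std_normal_density x * (x ^ k * g x)\<bar> = (std_normal_density x * \<bar>x\<bar> ^ k) * \<bar>g x\<bar>"
      by (simp add: abs_mult power_abs)
    also have "\<dots> \<le> (std_normal_density x * \<bar>x\<bar> ^ k) * B" using assms(2) by (intro mult_left_mono) auto
    finally show "norm (std_normal_density x * (x ^ k * g x)) \<le> norm (B * (std_normal_density x * \<bar>x\<bar> ^ k))"
      using \<open>B \<ge> 0\<close> by (simp add: abs_mult mult_ac power_abs)
  qed
qed

text \<open>Integration by parts: the density has derivative
  \<open>- x * std_normal_density x\<close>, and the boundary terms vanish because \<open>g\<close>
  is bounded.\<close>

lemma stein:
  fixes g g' :: "real \<Rightarrow> real"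
  assumes d: "\<And>x. (g has_real_derivative g' x) (at x)" and c: "continuous_on UNIV g'"
    and B: "\<And>x. \<bar>g x\<bar> \<le> B" and B': "\<And>x. \<bar>g' x\<bar> \<le> B'"
  shows "(\<integral>x. std_normal_density x * g' x \<partial>lborel) = (\<integral>x. std_normal_density x * (x * g x) \<partial>lborel)"
proof -
  let ?r = std_normal_density
  have cg: "continuous_on UNIV g" using d DERIV_isCont continuous_at_imp_continuous_on by blast
  have dr: "(?r has_real_derivative - x * ?r x) (at x)" for x
    unfolding std_normal_density_def by (auto intro!: derivative_eq_intros simp: field_simps)
  have i1: "integrable lborel (\<lambda>x. ?r x * g' x)" using gauss_integrable[OF c B', of 0] by simp
  have i2: "integrable lborel (\<lambda>x. ?r x * (x * g x))" using gauss_integrable[OF cg B, of 1] by simp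
  have lim: "((\<lambda>x. ?r x * g x) \<longlongrightarrow> 0) F" if "(?r \<longlongrightarrow> 0) F" for F
  proof (rule Lim_null_comparison)
    show "((\<lambda>x. ?r x * B) \<longlongrightarrow> 0) F" using tendsto_mult_left_zero[OF that] .
    show "\<forall>\<^sub>F x in F. norm (?r x * g x) \<le> ?r x * B"
      using B by (intro always_eventually allI) (simp add: abs_mult mult_left_mono)
  qed
  have l1: "(?r \<longlongrightarrow> 0) at_top" "(?r \<longlongrightarrow> 0) at_bot" unfolding std_normal_density_def by real_asymp+
  have "(LBINT x=-\<infinity>..\<infinity>. ?r x * g' x - ?r x * (x * g x)) = 0 - 0"
  proof (rule interval_integral_FTC_integrable[where F = "\<lambda>x. ?r x * g x"])
    show "((\<lambda>x. ?r x * g x) has_vector_derivative ?r x * g' x - ?r x * (x * g x)) (at x)" for x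
      unfolding has_real_derivative_iff_has_vector_derivative[symmetric]
      by (rule DERIV_cong[OF DERIV_mult[OF dr d]]) (simp add: algebra_simps)
    have "continuous_on UNIV ?r" using dr DERIV_isCont continuous_at_imp_continuous_on by blast
    then have "continuous_on UNIV (\<lambda>x. ?r x * g' x - ?r x * (x * g x))"
      using c cg by (intro continuous_intros)
    then show "isCont (\<lambda>x. ?r x * g' x - ?r x * (x * g x)) x" for x
      by (simp add: continuous_on_eq_continuous_at)
    show "set_integrable lborel (einterval (- \<infinity>) \<infinity>) (\<lambda>x. ?r x * g' x - ?r x * (x * g x))"
      using i1 i2 by (simp add: set_integrable_def)
  qed (use lim l1 in \<open>simp_all add: ereal_tendsto_simps\<close>)
  then have "(\<integral>x. ?r x * g' x - ?r x * (x * g x) \<partial>lborel) = 0"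
    by (simp add: interval_lebesgue_integral_def set_lebesgue_integral_def)
  then show ?thesis using i1 i2 by simp
qed

text \<open>Bessel's inequality for the orthonormal functions \<open>1\<close> and \<open>\<xi>\<close> in the Gaussian \<open>L\<^sup>2\<close> space.\<close>

lemma gauss_bessel:
  fixes g :: "real \<Rightarrow> real"
  assumes c: "continuous_on UNIV g" and B: "\<And>x. \<bar>g x\<bar> \<le> B"
  shows "(\<integral>x. std_normal_density x * g x \<partial>lborel)\<^sup>2 + (\<integral>x. std_normal_density x * (x * g x) \<partial>lborel)\<^sup>2
     \<le> (\<integral>x. std_normal_density x * (g x)\<^sup>2 \<partial>lborel)"
proof -
  let ?r = std_normal_density
  define a where "a = (\<integral>x. ?r x * g x \<partial>lborel)"
  define b where "b = (\<integral>x. ?r x * (x * g x) \<partial>lborel)"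
  have B2: "\<bar>(g x)\<^sup>2\<bar> \<le> B\<^sup>2" for x using power_mono[OF B, of x 2] by simp
  have h1: "has_bochner_integral lborel (\<lambda>x. ?r x * (g x)\<^sup>2) (\<integral>x. ?r x * (g x)\<^sup>2 \<partial>lborel)"
    using gauss_integrable[of "\<lambda>x. (g x)\<^sup>2" "B\<^sup>2" 0, OF _ B2] c
    by (intro has_bochner_integral_integrable) (simp add: continuous_on_power)
  have h2: "has_bochner_integral lborel (\<lambda>x. ?r x * g x) a"
    unfolding a_def using gauss_integrable[OF c B, of 0] by (intro has_bochner_integral_integrable) simp
  have h3: "has_bochner_integral lborel (\<lambda>x. ?r x * (x * g x)) b"
    unfolding b_def using gauss_integrable[OF c B, of 1] by (intro has_bochner_integral_integrable) simp
  have h4: "has_bochner_integral lborel ?r 1" using std_normal_moment_even[of 0] by simp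
  have h5: "has_bochner_integral lborel (\<lambda>x. ?r x * x) 0" using std_normal_moment_odd[of 0] by simp
  have h6: "has_bochner_integral lborel (\<lambda>x. ?r x * x\<^sup>2) 1" using std_normal_moment_even[of 1] by simp
  have "has_bochner_integral lborel (\<lambda>x. ?r x * (g x)\<^sup>2 - (2 * a) * (?r x * g x) - (2 * b) * (?r x * (x * g x))
      + a\<^sup>2 * ?r x + b\<^sup>2 * (?r x * x\<^sup>2) + (2 * a * b) * (?r x * x))
     ((\<integral>x. ?r x * (g x)\<^sup>2 \<partial>lborel) - (2 * a) * a - (2 * b) * b + a\<^sup>2 * 1 + b\<^sup>2 * 1 + (2 * a * b) * 0)"
    by (intro has_bochner_integral_add has_bochner_integral_diff has_bochner_integral_mult_right h1 h2 h3 h4 h5 h6)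
  moreover have "(\<lambda>x. ?r x * (g x)\<^sup>2 - (2 * a) * (?r x * g x) - (2 * b) * (?r x * (x * g x))
      + a\<^sup>2 * ?r x + b\<^sup>2 * (?r x * x\<^sup>2) + (2 * a * b) * (?r x * x)) = (\<lambda>x. ?r x * (g x - a - b * x)\<^sup>2)"
    by (rule ext) (simp add: power2_eq_square algebra_simps)
  ultimately have "(\<integral>x. ?r x * (g x - a - b * x)\<^sup>2 \<partial>lborel) = (\<integral>x. ?r x * (g x)\<^sup>2 \<partial>lborel) - a\<^sup>2 - b\<^sup>2"
    by (simp add: has_bochner_integral_integral_eq power2_eq_square)
  moreover have "0 \<le> (\<integral>x. ?r x * (g x - a - b * x)\<^sup>2 \<partial>lborel)" by (intro Bochner_Integration.integral_nonneg) simp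
  ultimately show ?thesis by (simp add: a_def b_def)
qed

lemma Ga_eq:
  assumes "Cp f"
  shows "Ga c a f z = (\<integral>\<xi>. std_normal_density \<xi> * f (z + (c * \<xi>) *\<^sub>R ax a) \<partial>lborel)"
  unfolding Av_def using assms
  by (intro integral_gauss borel_measurable_continuous_onI continuous_line) (simp add: Cp_def)

text \<open>For the profile of \<open>f\<close> on the line, the coefficient of \<open>\<xi>\<close>
  in Bessel's inequality is, by \<open>stein\<close>, \<open>c\<close> times the derivative of the
  average. The gradient after averaging is thus paid for by \<open>f\<close> itself and not by its
  gradient.\<close>

lemma reverse_poincare:
  assumes "Sm f"
  shows "(Ga c a f z)\<^sup>2 + c\<^sup>2 * (pd a (Ga c a f) z)\<^sup>2 \<le> Ga c a (\<lambda>z. (f z)\<^sup>2) z"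
proof -
  have C: "Cp f" "Cp (pd a f)" using assms by (auto intro: Sm_Cp Sm_pd)
  obtain B where B: "\<And>z. \<bar>f z\<bar> \<le> B" using Cp_bounded[OF C(1)] by metis
  obtain B' where B': "\<And>z. \<bar>pd a f z\<bar> \<le> B'" using Cp_bounded[OF C(2)] by metis
  let ?g = "\<lambda>\<xi>. f (z + (c * \<xi>) *\<^sub>R ax a)"
  let ?g' = "\<lambda>\<xi>. c * pd a f (z + (c * \<xi>) *\<^sub>R ax a)"
  have d: "(?g has_real_derivative ?g' \<xi>) (at \<xi>)" for \<xi>
  proof -
    have "((\<lambda>\<xi>. c * \<xi>) has_real_derivative c) (at \<xi>)" by (auto intro!: derivative_eq_intros)
    from DERIV_chain2[OF pd_line[OF smooth_differentiable[OF Sm_smooth[OF assms]]] this]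
    show ?thesis by (simp add: mult.commute)
  qed
  have cg: "continuous_on UNIV ?g" "continuous_on UNIV ?g'"
    using C by (auto intro!: continuous_line continuous_on_mult_left simp: Cp_def)
  have "\<bar>?g' x\<bar> \<le> \<bar>c\<bar> * B'" for x using B' by (simp add: abs_mult mult_left_mono)
  from stein[OF d cg(2) B this]
  have "c * pd a (Ga c a f) z = (\<integral>x. std_normal_density x * (x * ?g x) \<partial>lborel)"
    using assms C by (simp add: pd_Av Ga_eq mult.left_commute)
  then show ?thesis
    using gauss_bessel[OF cg(1) B] C by (simp add: Ga_eq Cp_power power_mult_distrib[symmetric])
qed

lemma dird_pow_ax:
  assumes "smooth f"
  shows "(dird (r *\<^sub>R ax a) ^^ m) f = (\<lambda>z. r ^ m * (pd a ^^ m) f z)"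
proof (induction m)
  case (Suc m)
  have s: "smooth ((pd a ^^ m) f)" using assms by (induction m) (auto intro: smooth_pd)
  have "dird (r *\<^sub>R ax a) g z = r * pd a g z" for g z
    using dird_ax[of a g] by (simp add: dird_def fun_eq_iff sum_distrib_left[symmetric] mult.assoc)
  then have "dird (r *\<^sub>R ax a) g = (\<lambda>z. r * pd a g z)" for g by (rule ext)
  then have eq: "dird (r *\<^sub>R ax a) (\<lambda>z. r ^ m * (pd a ^^ m) f z) = (\<lambda>z. r * pd a (\<lambda>z. r ^ m * (pd a ^^ m) f z) z)" .
  have "(dird (r *\<^sub>R ax a) ^^ Suc m) f = (\<lambda>z. r * pd a (\<lambda>z. r ^ m * (pd a ^^ m) f z) z)"
    unfolding funpow.simps comp_def Suc by (rule eq)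
  then show ?case by (simp add: pd_cmult[OF s] mult.assoc)
qed simp

text \<open>Odd Gaussian moments vanish, so the cubic Taylor polynomial contributes its terms of
  order zero and two only, and the fourth moment 3 bounds the remainder. With \<open>c\<close>
  proportional to \<open>sqrt s\<close> the error is of second order in \<open>s\<close>.\<close>

lemma gauss_taylor:
  assumes "Sm f" and B: "\<And>z. \<bar>pd a (pd a (pd a (pd a f))) z\<bar> \<le> B"
  shows "\<bar>Ga c a f z - f z - c\<^sup>2 / 2 * pd a (pd a f) z\<bar> \<le> c ^ 4 * B"
proof -
  let ?r = std_normal_density
  have C: "Cp f" using assms by (intro Sm_Cp)
  obtain K where K: "\<And>z. \<bar>f z\<bar> \<le> K" using Cp_bounded[OF C] by metis
  let ?g = "\<lambda>\<xi>. f (z + (c * \<xi>) *\<^sub>R ax a)"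
  have B0: "0 \<le> B" using B[of z] by linarith
  define p where "p \<xi> = f z + (c * pd a f z) * \<xi> + (c\<^sup>2 / 2 * pd a (pd a f) z) * \<xi>\<^sup>2 + (c^3 / 6 * pd a (pd a (pd a f)) z) * \<xi> ^ 3" for \<xi>
  have rem: "\<bar>?g \<xi> - p \<xi>\<bar> \<le> c ^ 4 * B / 24 * \<xi> ^ 4" for \<xi>
  proof -
    let ?h = "(c * \<xi>) *\<^sub>R ax a"
    obtain y where "f (z + ?h) = (\<Sum>m<4. (dird ?h ^^ m) f z / fact m) + (dird ?h ^^ 4) f y / fact 4"
      using dird_taylor[OF Sm_smooth[OF assms(1)], of z ?h 4] by blast
    then have "?g \<xi> - p \<xi> = (c * \<xi>) ^ 4 * pd a (pd a (pd a (pd a f))) y / 24"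
      unfolding dird_pow_ax[OF Sm_smooth[OF assms(1)]]
      by (simp add: p_def eval_nat_numeral fact_numeral algebra_simps)
    then have "\<bar>?g \<xi> - p \<xi>\<bar> = (c * \<xi>) ^ 4 / 24 * \<bar>pd a (pd a (pd a (pd a f))) y\<bar>"
      using zero_le_even_power[of 4 "c * \<xi>"] by (simp only: abs_mult abs_divide abs_of_nonneg) simp
    also have "\<dots> \<le> (c * \<xi>) ^ 4 / 24 * B" using B by (intro mult_left_mono) auto
    finally show ?thesis by (simp add: power_mult_distrib mult_ac)
  qed
  have hp: "has_bochner_integral lborel (\<lambda>x. ?r x * p x) (f z + c\<^sup>2 / 2 * pd a (pd a f) z)"
  proof -
    have h0: "has_bochner_integral lborel ?r 1" using std_normal_moment_even[of 0] by simp
    have h1: "has_bochner_integral lborel (\<lambda>x. ?r x * x) 0" using std_normal_moment_odd[of 0] by simp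
    have h2: "has_bochner_integral lborel (\<lambda>x. ?r x * x\<^sup>2) 1" using std_normal_moment_even[of 1] by simp
    have h3: "has_bochner_integral lborel (\<lambda>x. ?r x * x^3) 0" using std_normal_moment_odd[of 1] by (simp add: eval_nat_numeral)
    have "has_bochner_integral lborel (\<lambda>x. f z * ?r x + (c * pd a f z) * (?r x * x)
        + (c\<^sup>2 / 2 * pd a (pd a f) z) * (?r x * x\<^sup>2) + (c^3 / 6 * pd a (pd a (pd a f)) z) * (?r x * x^3))
       (f z * 1 + (c * pd a f z) * 0 + (c\<^sup>2 / 2 * pd a (pd a f) z) * 1 + (c^3 / 6 * pd a (pd a (pd a f)) z) * 0)"
      by (intro has_bochner_integral_add has_bochner_integral_mult_right h0 h1 h2 h3)
    moreover have "(\<lambda>x. f z * ?r x + (c * pd a f z) * (?r x * x)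
        + (c\<^sup>2 / 2 * pd a (pd a f) z) * (?r x * x\<^sup>2) + (c^3 / 6 * pd a (pd a (pd a f)) z) * (?r x * x^3)) = (\<lambda>x. ?r x * p x)"
      by (rule ext) (simp add: p_def algebra_simps)
    ultimately show ?thesis by simp
  qed
  have hg: "has_bochner_integral lborel (\<lambda>x. ?r x * ?g x) (Ga c a f z)"
    unfolding Ga_eq[OF C] using gauss_integrable[OF continuous_line[of f z c a] K, of 0] C
    by (intro has_bochner_integral_integrable) (simp add: Cp_def)
  have h4: "has_bochner_integral lborel (\<lambda>x. ?r x * x^4) 3"
    using std_normal_moment_even[of 2] by (simp add: fact_numeral)
  have hd: "has_bochner_integral lborel (\<lambda>x. ?r x * ?g x - ?r x * p x) (Ga c a f z - (f z + c\<^sup>2 / 2 * pd a (pd a f) z))"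
    by (intro has_bochner_integral_diff hg hp)
  have hb: "has_bochner_integral lborel (\<lambda>x. (c ^ 4 * B / 24) * (?r x * x^4)) ((c ^ 4 * B / 24) * 3)"
    by (intro has_bochner_integral_mult_right h4)
  have "\<bar>\<integral>x. ?r x * ?g x - ?r x * p x \<partial>lborel\<bar> \<le> (\<integral>x. (c ^ 4 * B / 24) * (?r x * x^4) \<partial>lborel)"
  proof (rule integral_abs_bound[THEN order_trans], rule integral_mono)
    show "integrable lborel (\<lambda>x. \<bar>?r x * ?g x - ?r x * p x\<bar>)"
      using hd by (intro integrable_abs) (rule integrable.intros)
    show "integrable lborel (\<lambda>x. (c ^ 4 * B / 24) * (?r x * x^4))"
      using hb by (rule integrable.intros)
    fix x
    have "\<bar>?r x * ?g x - ?r x * p x\<bar> = ?r x * \<bar>?g x - p x\<bar>"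
      by (simp add: right_diff_distrib[symmetric] abs_mult)
    also have "\<dots> \<le> ?r x * (c ^ 4 * B / 24 * x ^ 4)" by (intro mult_left_mono rem) simp
    finally show "\<bar>?r x * ?g x - ?r x * p x\<bar> \<le> (c ^ 4 * B / 24) * (?r x * x^4)" by (simp add: mult_ac)
  qed
  also have "\<dots> \<le> c ^ 4 * B" unfolding has_bochner_integral_integral_eq[OF hb] using B0 by simp
  finally show ?thesis using has_bochner_integral_integral_eq[OF hd] by (simp add: algebra_simps)
qed

text \<open>Averages and derivatives commute, so \<open>gauss_taylor\<close> applies to every
  \<open>D w f\<close>, at the cost of four orders.\<close>

lemma bnd_gauss_taylor:
  fixes c :: real
  assumes "Sm f" "bnd (n + 4) f B"
  shows "bnd n (\<lambda>z. Ga c a f z - f z - c\<^sup>2 / 2 * pd a (pd a f) z) (card (words n) * (c ^ 4 * B))"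
  unfolding bnd_def
proof
  fix z
  have "\<bar>D w (\<lambda>z. Ga c a f z - f z - c\<^sup>2 / 2 * pd a (pd a f) z) z\<bar> \<le> c ^ 4 * B" if w: "w \<in> words n" for w
  proof -
    note s = Sm_smooth[OF assms(1)]
    have g: "smooth (Ga c a f)" using assms by (intro Sm_smooth Sm_Av) auto
    have h: "smooth (\<lambda>z. c\<^sup>2 / 2 * pd a (pd a f) z)" by (intro smooth_cmult smooth_pd s)
    have "D w (\<lambda>z. Ga c a f z - f z - c\<^sup>2 / 2 * pd a (pd a f) z) z
        = Ga c a (D w f) z - D w f z - c\<^sup>2 / 2 * pd a (pd a (D w f)) z"
      unfolding D_diff[OF smooth_diff[OF g s] h] D_diff[OF g s] D_cmult[OF smooth_pd[OF smooth_pd[OF s]]]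
        D_Av[OF prm_gauss assms(1)] D_pd_commute[OF smooth_pd[OF s]] D_pd_commute[OF s] ..
    also have "\<bar>\<dots>\<bar> \<le> c ^ 4 * B"
    proof (rule gauss_taylor)
      fix y
      have "\<bar>D ([a,a,a,a] @ w) f y\<bar> \<le> J (n + 4) f y" using w by (intro D_le_J) auto
      also have "\<dots> \<le> B" using assms by (intro bndD)
      finally show "\<bar>pd a (pd a (pd a (pd a (D w f)))) y\<bar> \<le> B" by simp
    qed (intro Sm_D assms)
    finally show ?thesis .
  qed
  then show "J n (\<lambda>z. Ga c a f z - f z - c\<^sup>2 / 2 * pd a (pd a f) z) z \<le> card (words n) * (c ^ 4 * B)"
    unfolding J_def by (intro sum_bounded_above)
qed

section \<open>Shears: commutation with derivatives and consistency\<close>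

text \<open>The bound is pointwise, with the sheared point on the right, so that the error bounds
  derived from it can be averaged with \<open>M\<close>.\<close>

lemma J_shear:
  assumes b: "Sm b"
  shows "\<exists>C\<ge>0. \<forall>s\<in>{0..1}. \<forall>f. smooth f \<longrightarrow> (\<forall>z. J n (\<lambda>z. f (shear j b s z)) z \<le> C * J n f (shear j b s z))"
proof (induction n)
  case 0
  show ?case by (intro exI[of _ 1]) (auto simp: J_0)
next
  case (Suc n)
  then obtain C where C: "C \<ge> 0" "\<And>s f z. s \<in> {0..1} \<Longrightarrow> smooth f \<Longrightarrow> J n (\<lambda>z. f (shear j b s z)) z \<le> C * J n f (shear j b s z)"
    by metis
  obtain Bb where Bb: "Bb \<ge> 0" "bnd (Suc n) b Bb" using Sm_bnd[OF b] by metis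
  have sb: "smooth b" using b by (rule Sm_smooth)
  let ?K = "C + 2 ^ n * Bb * C"
  have K: "?K \<ge> 0" using C Bb by simp
  show ?case
  proof (intro exI[of _ "1 + 3 * ?K"] conjI ballI allI impI)
    fix s f z assume s: "s \<in> {0..1::real}" and f: "smooth f"
    let ?S = "shear j b s"
    have 1: "J n (pd a (\<lambda>z. f (?S z))) z \<le> ?K * J (Suc n) f (?S z)" for a
    proof -
      note sf = smooth_shear[OF smooth_pd[OF f] sb, of _ j s]
      have g: "smooth (\<lambda>z. pd a b z * pd j f (?S z))" by (intro smooth_mult smooth_pd sb sf)
      have "pd a (\<lambda>z. f (?S z)) = (\<lambda>z. pd a f (?S z) + s * (pd a b z * pd j f (?S z)))"
        using pd_shear[OF smooth_differentiable[OF f] smooth_differentiable[OF sb]] by (simp add: mult.assoc)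
      then have "J n (pd a (\<lambda>z. f (?S z))) z \<le> J n (\<lambda>z. pd a f (?S z)) z + J n (\<lambda>z. s * (pd a b z * pd j f (?S z))) z"
        using J_add[OF sf smooth_cmult[OF g]] by simp
      also have "J n (\<lambda>z. s * (pd a b z * pd j f (?S z))) z \<le> 1 * J n (\<lambda>z. pd a b z * pd j f (?S z)) z"
        unfolding J_cmult[OF g] using s by (intro mult_right_mono) auto
      also have "\<dots> \<le> 2 ^ n * J n (pd a b) z * J n (\<lambda>z. pd j f (?S z)) z"
        using J_mult[OF smooth_pd[OF sb] sf] by simp
      also have "\<dots> \<le> 2 ^ n * Bb * (C * J n (pd j f) (?S z))"
        using bnd_pd[OF Bb(2)] Bb by (intro mult_mono C s smooth_pd f) (auto simp: bnd_def)
      also have "J n (\<lambda>z. pd a f (?S z)) z \<le> C * J n (pd a f) (?S z)" by (intro C s smooth_pd f)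
      finally have "J n (pd a (\<lambda>z. f (?S z))) z \<le> C * J n (pd a f) (?S z) + 2 ^ n * Bb * (C * J n (pd j f) (?S z))"
        by simp
      also have "\<dots> \<le> C * J (Suc n) f (?S z) + 2 ^ n * Bb * (C * J (Suc n) f (?S z))"
        using C Bb by (intro add_mono mult_left_mono J_pd) auto
      finally show ?thesis by (simp add: algebra_simps)
    qed
    have "J (Suc n) (\<lambda>z. f (?S z)) z \<le> J (Suc n) f (?S z) + (\<Sum>a\<in>(UNIV::dir set). ?K * J (Suc n) f (?S z))"
      unfolding J_Suc[of n "\<lambda>z. f (?S z)"] by (intro add_mono sum_mono 1 abs_le_J)
    then show "J (Suc n) (\<lambda>z. f (?S z)) z \<le> (1 + 3 * ?K) * J (Suc n) f (?S z)"
      by (simp add: sum_dir algebra_simps del: sum_constant)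
  qed (use K in simp)
qed

text \<open>In the following bounds every error term carries at least one derivative in the direction \<open>j\<close>
  of the shear. Since \<open>j\<close> is a spatial direction whenever the shear is not a translation, the
  dissipation of the Gaussian averaging can absorb these terms.\<close>

lemma D_shear_error:
  assumes b: "Sm b"
  shows "\<exists>C\<ge>0. \<forall>s\<in>{0..1}. \<forall>f. smooth f \<longrightarrow> (\<forall>z w. length w \<le> Suc n \<longrightarrow>
     \<bar>D w (\<lambda>z. f (shear j b s z)) z - D w f (shear j b s z)\<bar> \<le> C * s * J n (pd j f) (shear j b s z))"
proof (induction n)
  case 0
  obtain Bb where Bb: "Bb \<ge> 0" "bnd 1 b Bb" using Sm_bnd[OF b] by metis
  have sb: "smooth b" using b by (rule Sm_smooth)
  show ?case
  proof (intro exI[of _ Bb] conjI ballI allI impI)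
    fix s f z and w :: "dir list" assume s: "s \<in> {0..1::real}" and f: "smooth f" and w: "length w \<le> Suc 0"
    show "\<bar>D w (\<lambda>z. f (shear j b s z)) z - D w f (shear j b s z)\<bar> \<le> Bb * s * J 0 (pd j f) (shear j b s z)"
    proof (cases w)
      case Nil
      then show ?thesis using Bb s by (auto intro!: mult_nonneg_nonneg)
    next
      case (Cons a w')
      then have [simp]: "w = [a]" using w by simp
      have "\<bar>D w (\<lambda>z. f (shear j b s z)) z - D w f (shear j b s z)\<bar> = \<bar>pd a b z\<bar> * s * \<bar>pd j f (shear j b s z)\<bar>"
        using pd_shear[OF smooth_differentiable[OF f] smooth_differentiable[OF sb]] s by (simp add: abs_mult)
      also have "\<dots> \<le> Bb * s * \<bar>pd j f (shear j b s z)\<bar>"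
        using s order_trans[OF abs_le_J bndD[OF bnd_pd[of 0]]] Bb by (intro mult_right_mono) auto
      finally show ?thesis by (simp add: J_0)
    qed
  qed (use Bb in simp)
next
  case (Suc n)
  then obtain C where C: "C \<ge> 0" "\<And>s f z w. s \<in> {0..1} \<Longrightarrow> smooth f \<Longrightarrow> length w \<le> Suc n \<Longrightarrow>
     \<bar>D w (\<lambda>z. f (shear j b s z)) z - D w f (shear j b s z)\<bar> \<le> C * s * J n (pd j f) (shear j b s z)"
    by metis
  obtain C' where C': "C' \<ge> 0" "\<And>s f z. s \<in> {0..1} \<Longrightarrow> smooth f \<Longrightarrow> J (Suc n) (\<lambda>z. f (shear j b s z)) z \<le> C' * J (Suc n) f (shear j b s z)"
    using J_shear[OF b, of "Suc n" j] by metis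
  obtain Bb where Bb: "Bb \<ge> 0" "bnd (Suc (Suc n)) b Bb" using Sm_bnd[OF b] by metis
  have sb: "smooth b" using b by (rule Sm_smooth)
  let ?K = "C + 2 ^ Suc n * Bb * C'"
  show ?case
  proof (intro exI[of _ ?K] conjI ballI allI impI)
    fix s f z and w :: "dir list" assume s: "s \<in> {0..1::real}" and f: "smooth f" and w: "length w \<le> Suc (Suc n)"
    let ?S = "shear j b s"
    show "\<bar>D w (\<lambda>z. f (?S z)) z - D w f (?S z)\<bar> \<le> ?K * s * J (Suc n) (pd j f) (?S z)"
    proof (cases w rule: rev_exhaust)
      case Nil
      then show ?thesis using Bb C C' s by (auto intro!: mult_nonneg_nonneg)
    next
      case (snoc w' a)
      then have w': "length w' \<le> Suc n" using w by simp
      note sf = smooth_shear[OF smooth_pd[OF f] sb, of _ j s]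
      have g: "smooth (\<lambda>z. pd a b z * pd j f (?S z))" by (intro smooth_mult smooth_pd sb sf)
      have pa: "pd a (\<lambda>z. f (?S z)) = (\<lambda>z. pd a f (?S z) + s * (pd a b z * pd j f (?S z)))"
        using pd_shear[OF smooth_differentiable[OF f] smooth_differentiable[OF sb]] by (simp add: mult.assoc)
      have "D w (\<lambda>z. f (?S z)) z - D w f (?S z)
          = (D w' (\<lambda>z. pd a f (?S z)) z - D w' (pd a f) (?S z)) + s * D w' (\<lambda>z. pd a b z * pd j f (?S z)) z"
        unfolding snoc D_snoc pa using D_add[OF sf smooth_cmult[OF g]] D_cmult[OF g] by simp
      then have "\<bar>D w (\<lambda>z. f (?S z)) z - D w f (?S z)\<bar>
          \<le> \<bar>D w' (\<lambda>z. pd a f (?S z)) z - D w' (pd a f) (?S z)\<bar> + s * \<bar>D w' (\<lambda>z. pd a b z * pd j f (?S z)) z\<bar>"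
        using s abs_triangle_ineq[of "D w' (\<lambda>z. pd a f (?S z)) z - D w' (pd a f) (?S z)"
            "s * D w' (\<lambda>z. pd a b z * pd j f (?S z)) z"] by (simp add: abs_mult)
      \<comment> \<open>The induction hypothesis for \<open>pd a f\<close> yields
        \<open>pd j (pd a f)\<close>. Commuting the two puts \<open>pd j\<close> innermost, and
        \<open>pd a\<close> is counted by the next jet order.\<close>
      also have "\<bar>D w' (\<lambda>z. pd a f (?S z)) z - D w' (pd a f) (?S z)\<bar> \<le> C * s * J (Suc n) (pd j f) (?S z)"
      proof -
        have "\<bar>D w' (\<lambda>z. pd a f (?S z)) z - D w' (pd a f) (?S z)\<bar> \<le> C * s * J n (pd a (pd j f)) (?S z)"
          using C(2)[OF s smooth_pd[OF f, of a] w', of z] pd_commute[OF f, of j a] by simp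
        also have "\<dots> \<le> C * s * J (Suc n) (pd j f) (?S z)"
          using C s by (intro mult_left_mono J_pd) auto
        finally show ?thesis .
      qed
      also have "\<bar>D w' (\<lambda>z. pd a b z * pd j f (?S z)) z\<bar> \<le> J (Suc n) (\<lambda>z. pd a b z * pd j f (?S z)) z"
        using w' by (rule D_le_J)
      also have "\<dots> \<le> 2 ^ Suc n * J (Suc n) (pd a b) z * J (Suc n) (\<lambda>z. pd j f (?S z)) z"
        by (intro J_mult smooth_pd sb sf)
      also have "\<dots> \<le> 2 ^ Suc n * Bb * (C' * J (Suc n) (pd j f) (?S z))"
        using bnd_pd[OF Bb(2)] Bb by (intro mult_mono C' s smooth_pd f) (auto simp: bnd_def)
      finally have "\<bar>D w (\<lambda>z. f (?S z)) z - D w f (?S z)\<bar>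
          \<le> C * s * J (Suc n) (pd j f) (?S z) + s * (2 ^ Suc n * Bb * (C' * J (Suc n) (pd j f) (?S z)))"
        using s by (simp add: mult_left_mono)
      then show ?thesis by (simp add: algebra_simps)
    qed
  qed (use C C' Bb in simp)
qed

text \<open>Jets of the spatial gradient only: \<open>J n f\<close> also contains pure time
  derivatives, which the Gaussian averages do not dissipate.\<close>

definition R :: "nat \<Rightarrow> (pt \<Rightarrow> real) \<Rightarrow> pt \<Rightarrow> real" where
  "R n f z = J n (pd DX f) z + J n (pd DY f) z"

lemma R_nonneg: "0 \<le> R n f z"
  by (simp add: R_def)

lemma R_shear:
  assumes b: "Sm b" and j: "j = DX \<or> j = DY"
  shows "\<exists>C\<ge>0. \<forall>s\<in>{0..1}. \<forall>f. smooth f \<longrightarrow> (\<forall>z. R n (\<lambda>z. f (shear j b s z)) z \<le> C * R n f (shear j b s z))"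
proof -
  obtain C where C: "C \<ge> 0" "\<And>s f z. s \<in> {0..1} \<Longrightarrow> smooth f \<Longrightarrow> J n (\<lambda>z. f (shear j b s z)) z \<le> C * J n f (shear j b s z)"
    using J_shear[OF b, of n j] by metis
  obtain Bb where Bb: "Bb \<ge> 0" "bnd (Suc n) b Bb" using Sm_bnd[OF b] by metis
  have sb: "smooth b" using b by (rule Sm_smooth)
  let ?K = "2 ^ n * Bb * C"
  show ?thesis
  proof (intro exI[of _ "C + 2 * ?K"] conjI ballI allI impI)
    fix s f z assume s: "s \<in> {0..1::real}" and f: "smooth f"
    let ?S = "shear j b s"
    have 1: "J n (pd a (\<lambda>z. f (?S z))) z \<le> C * J n (pd a f) (?S z) + ?K * R n f (?S z)" for a
    proof -
      note sf = smooth_shear[OF smooth_pd[OF f] sb, of _ j s]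
      have g: "smooth (\<lambda>z. pd a b z * pd j f (?S z))" by (intro smooth_mult smooth_pd sb sf)
      have "pd a (\<lambda>z. f (?S z)) = (\<lambda>z. pd a f (?S z) + s * (pd a b z * pd j f (?S z)))"
        using pd_shear[OF smooth_differentiable[OF f] smooth_differentiable[OF sb]] by (simp add: mult.assoc)
      then have "J n (pd a (\<lambda>z. f (?S z))) z \<le> J n (\<lambda>z. pd a f (?S z)) z + J n (\<lambda>z. s * (pd a b z * pd j f (?S z))) z"
        using J_add[OF sf smooth_cmult[OF g]] by simp
      also have "J n (\<lambda>z. s * (pd a b z * pd j f (?S z))) z \<le> 1 * J n (\<lambda>z. pd a b z * pd j f (?S z)) z"
        unfolding J_cmult[OF g] using s by (intro mult_right_mono) auto
      also have "\<dots> \<le> 2 ^ n * J n (pd a b) z * J n (\<lambda>z. pd j f (?S z)) z"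
        using J_mult[OF smooth_pd[OF sb] sf] by simp
      also have "\<dots> \<le> 2 ^ n * Bb * (C * J n (pd j f) (?S z))"
        using bnd_pd[OF Bb(2)] Bb by (intro mult_mono C s smooth_pd f) (auto simp: bnd_def)
      also have "\<dots> \<le> 2 ^ n * Bb * (C * R n f (?S z))"
        using j Bb C by (intro mult_left_mono) (auto simp: R_def)
      also have "J n (\<lambda>z. pd a f (?S z)) z \<le> C * J n (pd a f) (?S z)" by (intro C s smooth_pd f)
      finally show ?thesis by (simp add: mult.assoc)
    qed
    show "R n (\<lambda>z. f (?S z)) z \<le> (C + 2 * ?K) * R n f (?S z)"
      using 1[of DX] 1[of DY] unfolding R_def by (simp add: algebra_simps)
  qed (use C Bb in simp)
qed

text \<open>Families of maps whose Koopman operators commute with derivatives up to errors that are of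
  first order in \<open>s\<close> and contain a spatial derivative.\<close>

definition adm_bound :: "(real \<Rightarrow> pt \<Rightarrow> pt) \<Rightarrow> nat \<Rightarrow> real \<Rightarrow> bool" where
  "adm_bound S n C \<longleftrightarrow> 0 \<le> C \<and> (\<forall>s\<in>{0..1}. \<forall>f. Sm f \<longrightarrow> (\<forall>z.
       (\<forall>w. length w \<le> Suc n \<longrightarrow> \<bar>D w (\<lambda>z. f (S s z)) z - D w f (S s z)\<bar> \<le> C * s * R n f (S s z)) \<and>
       R n (\<lambda>z. f (S s z)) z \<le> C * R n f (S s z)))"

definition adm :: "(real \<Rightarrow> pt \<Rightarrow> pt) \<Rightarrow> bool" where
  "adm S \<longleftrightarrow> (\<forall>s f. Sm f \<longrightarrow> Sm (\<lambda>z. f (S s z))) \<and> (\<forall>s f. Cp f \<longrightarrow> Cp (\<lambda>z. f (S s z))) \<and>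
    (\<forall>n. \<exists>C. adm_bound S n C)"

lemma adm_boundD:
  assumes "adm_bound S n C"
  shows "0 \<le> C"
    and "s \<in> {0..1} \<Longrightarrow> Sm f \<Longrightarrow> length w \<le> Suc n \<Longrightarrow> \<bar>D w (\<lambda>z. f (S s z)) z - D w f (S s z)\<bar> \<le> C * s * R n f (S s z)"
    and "s \<in> {0..1} \<Longrightarrow> Sm f \<Longrightarrow> R n (\<lambda>z. f (S s z)) z \<le> C * R n f (S s z)"
  using assms unfolding adm_bound_def by blast+

lemma admD:
  assumes "adm S"
  shows "Sm f \<Longrightarrow> Sm (\<lambda>z. f (S s z))" "Cp f \<Longrightarrow> Cp (\<lambda>z. f (S s z))" "\<exists>C. adm_bound S n C"
  using assms unfolding adm_def by blast+

lemma adm_shear: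
  assumes b: "Sm b" and j: "j = DX \<or> j = DY"
  shows "adm (shear j b)"
  unfolding adm_def
proof (intro conjI allI impI)
  fix n
  obtain C where C: "C \<ge> 0" "\<And>s f z w. s \<in> {0..1} \<Longrightarrow> smooth f \<Longrightarrow> length w \<le> Suc n \<Longrightarrow>
     \<bar>D w (\<lambda>z. f (shear j b s z)) z - D w f (shear j b s z)\<bar> \<le> C * s * J n (pd j f) (shear j b s z)"
    using D_shear_error[OF b, of n j] by metis
  obtain C' where C': "C' \<ge> 0" "\<And>s f z. s \<in> {0..1} \<Longrightarrow> smooth f \<Longrightarrow> R n (\<lambda>z. f (shear j b s z)) z \<le> C' * R n f (shear j b s z)"
    using R_shear[OF b j, of n] by metis
  show "\<exists>C. adm_bound (shear j b) n C"
    unfolding adm_bound_def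
  proof (intro exI[of _ "C + C'"] conjI ballI allI impI)
    fix s f z and w :: "dir list" assume s: "s \<in> {0..1::real}" and f: "Sm f" and w: "length w \<le> Suc n"
    have "\<bar>D w (\<lambda>z. f (shear j b s z)) z - D w f (shear j b s z)\<bar> \<le> C * s * J n (pd j f) (shear j b s z)"
      by (intro C s Sm_smooth f w)
    also have "\<dots> \<le> (C + C') * s * R n f (shear j b s z)"
      using C C' s j by (intro mult_mono) (auto simp: R_def)
    finally show "\<bar>D w (\<lambda>z. f (shear j b s z)) z - D w f (shear j b s z)\<bar> \<le> (C + C') * s * R n f (shear j b s z)" .
  next
    fix s f z assume s: "s \<in> {0..1::real}" and f: "Sm f"
    have "R n (\<lambda>z. f (shear j b s z)) z \<le> C' * R n f (shear j b s z)" by (intro C' s Sm_smooth f)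
    also have "\<dots> \<le> (C + C') * R n f (shear j b s z)" using C by (intro mult_right_mono) (auto simp: R_nonneg)
    finally show "R n (\<lambda>z. f (shear j b s z)) z \<le> (C + C') * R n f (shear j b s z)" .
  qed (use C C' in simp)
qed (use b in \<open>auto intro: Sm_shear Cp_shear Sm_Cp\<close>)

lemma D_translate:
  assumes "smooth f"
  shows "D w (\<lambda>z. f (shear j (\<lambda>_. k) s z)) = (\<lambda>z. D w f (shear j (\<lambda>_. k) s z))"
proof (induction w)
  case (Cons a w)
  have "pd a (\<lambda>z. D w f (shear j (\<lambda>_. k) s z)) = (\<lambda>z. pd a (D w f) (shear j (\<lambda>_. k) s z))"
    using assms by (subst pd_shear) (auto intro!: smooth_differentiable smooth_D)
  with Cons show ?case by simp
qed simp

lemma J_translate: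
  assumes "smooth f"
  shows "J n (\<lambda>z. f (shear j (\<lambda>_. k) s z)) z = J n f (shear j (\<lambda>_. k) s z)"
  by (simp add: J_def D_translate[OF assms])

text \<open>Here \<open>j\<close> may be \<open>DT\<close>: a translation commutes exactly with
  every \<open>D w\<close>, so there is no error that would have to contain a spatial derivative.
  This covers the half steps in time.\<close>

lemma adm_translate: "adm (shear j (\<lambda>_. k))"
  unfolding adm_def adm_bound_def
proof (intro conjI allI impI exI[of _ 1] ballI)
  fix s f z n assume f: "Sm f"
  have "pd a (\<lambda>z. f (shear j (\<lambda>_. k) s z)) = (\<lambda>z. pd a f (shear j (\<lambda>_. k) s z))" for a
    using D_translate[OF Sm_smooth[OF f], of "[a]"] by simp
  then show "R n (\<lambda>z. f (shear j (\<lambda>_. k) s z)) z \<le> 1 * R n f (shear j (\<lambda>_. k) s z)"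
    using f by (simp add: R_def J_translate Sm_smooth smooth_pd)
next
  fix s f z n and w :: "dir list" assume f: "Sm f" and s: "s \<in> {0..1::real}"
  show "\<bar>D w (\<lambda>z. f (shear j (\<lambda>_. k) s z)) z - D w f (shear j (\<lambda>_. k) s z)\<bar> \<le> 1 * s * R n f (shear j (\<lambda>_. k) s z)"
    unfolding D_translate[OF Sm_smooth[OF f]] using s R_nonneg by simp
next
  fix s f assume f: "Sm f"
  show "Sm (\<lambda>z. f (shear j (\<lambda>_. k) s z))" by (rule Sm_shear[OF f Sm_const])
next
  fix s f assume f: "Cp f"
  show "Cp (\<lambda>z. f (shear j (\<lambda>_. k) s z))" by (rule Cp_shear[OF f Cp_const])
qed simp

text \<open>The error of \<open>S\<close> involves \<open>R\<close> of \<open>f\<close> composed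
  with \<open>S'\<close>, which must be brought back to \<open>R n f\<close>. For this reason
  \<open>adm_bound\<close> contains a bound on \<open>R\<close> in addition to the error
  bound.\<close>

lemma adm_comp:
  assumes S: "adm S" and S': "adm S'"
  shows "adm (\<lambda>s z. S' s (S s z))"
  unfolding adm_def
proof (intro conjI allI impI)
  fix n
  from admD(3)[OF S] obtain C where C: "adm_bound S n C" ..
  from admD(3)[OF S'] obtain C' where C': "adm_bound S' n C'" ..
  note C = adm_boundD[OF C] and C' = adm_boundD[OF C']
  show "\<exists>C. adm_bound (\<lambda>s z. S' s (S s z)) n C"
    unfolding adm_bound_def
  proof (intro exI[of _ "C * C' + C'"] conjI ballI allI impI)
    fix s f z and w :: "dir list" assume s: "s \<in> {0..1::real}" and f: "Sm f" and w: "length w \<le> Suc n"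
    have f': "Sm (\<lambda>z. f (S' s z))" using f by (rule admD(1)[OF S'])
    have "\<bar>D w (\<lambda>z. f (S' s (S s z))) z - D w f (S' s (S s z))\<bar>
       \<le> \<bar>D w (\<lambda>z. f (S' s (S s z))) z - D w (\<lambda>z. f (S' s z)) (S s z)\<bar> + \<bar>D w (\<lambda>z. f (S' s z)) (S s z) - D w f (S' s (S s z))\<bar>"
      by linarith
    also have "\<dots> \<le> C * s * R n (\<lambda>z. f (S' s z)) (S s z) + C' * s * R n f (S' s (S s z))"
      by (intro add_mono C(2)[OF s f' w] C'(2)[OF s f w])
    also have "\<dots> \<le> C * s * (C' * R n f (S' s (S s z))) + C' * s * R n f (S' s (S s z))"
      using C(1) s by (intro add_mono mult_left_mono C'(3) f order_refl) auto
    finally show "\<bar>D w (\<lambda>z. f (S' s (S s z))) z - D w f (S' s (S s z))\<bar> \<le> (C * C' + C') * s * R n f (S' s (S s z))"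
      by (simp add: algebra_simps)
  next
    fix s f z assume s: "s \<in> {0..1::real}" and f: "Sm f"
    have f': "Sm (\<lambda>z. f (S' s z))" using f by (rule admD(1)[OF S'])
    have "R n (\<lambda>z. f (S' s (S s z))) z \<le> C * R n (\<lambda>z. f (S' s z)) (S s z)" by (rule C(3)[OF s f'])
    also have "\<dots> \<le> C * (C' * R n f (S' s (S s z)))" by (intro mult_left_mono C' C s f)
    also have "\<dots> \<le> (C * C' + C') * R n f (S' s (S s z))"
      using C' R_nonneg by (simp add: algebra_simps)
    finally show "R n (\<lambda>z. f (S' s (S s z))) z \<le> (C * C' + C') * R n f (S' s (S s z))" .
  qed (use C C' in simp)
next
  fix s f assume "Sm f"
  then show "Sm (\<lambda>z. f (S' s (S s z)))" by (intro admD(1)[OF S] admD(1)[OF S'])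
next
  fix s f assume "Cp f"
  then show "Cp (\<lambda>z. f (S' s (S s z)))" by (intro admD(2)[OF S] admD(2)[OF S'])
qed

text \<open>\<open>consistent k P A\<close>: the operators \<open>P s\<close> are \<open>1 + s A + O(s\<^sup>2)\<close> with a loss of \<open>k\<close> derivatives.\<close>

definition consistent_bound :: "nat \<Rightarrow> (real \<Rightarrow> (pt \<Rightarrow> real) \<Rightarrow> pt \<Rightarrow> real) \<Rightarrow> ((pt \<Rightarrow> real) \<Rightarrow> pt \<Rightarrow> real) \<Rightarrow> nat \<Rightarrow> real \<Rightarrow> bool" where
  "consistent_bound k P A n C \<longleftrightarrow> 0 \<le> C \<and> (\<forall>s\<in>{0..1}. \<forall>f B. Sm f \<longrightarrow> bnd (n + k) f B \<longrightarrow>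
       bnd n (P s f) (C * B) \<and> bnd n (A f) (C * B) \<and> bnd n (\<lambda>z. P s f z - f z - s * A f z) (C * s\<^sup>2 * B))"

text \<open>Linearity and the size bounds on \<open>P\<close> and \<open>A\<close> are included so
  that the notion is closed under composition, where \<open>P s\<close> is applied to the expansion
  of \<open>Q s f\<close> term by term.\<close>

definition consistent :: "nat \<Rightarrow> (real \<Rightarrow> (pt \<Rightarrow> real) \<Rightarrow> pt \<Rightarrow> real) \<Rightarrow> ((pt \<Rightarrow> real) \<Rightarrow> pt \<Rightarrow> real) \<Rightarrow> bool" where
  "consistent k P A \<longleftrightarrow>
    (\<forall>f. Sm f \<longrightarrow> Sm (A f) \<and> (\<forall>s. Sm (P s f))) \<and>
    (\<forall>s f g. Sm f \<longrightarrow> Sm g \<longrightarrow> P s (\<lambda>z. f z + g z) = (\<lambda>z. P s f z + P s g z)) \<and>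
    (\<forall>s c f. Sm f \<longrightarrow> P s (\<lambda>z. c * f z) = (\<lambda>z. c * P s f z)) \<and>
    (\<forall>n. \<exists>C. consistent_bound k P A n C)"

lemma consistent_boundD:
  assumes "consistent_bound k P A n C"
  shows "0 \<le> C"
    and "s \<in> {0..1} \<Longrightarrow> Sm f \<Longrightarrow> bnd (n + k) f B \<Longrightarrow> bnd n (P s f) (C * B)"
    and "s \<in> {0..1} \<Longrightarrow> Sm f \<Longrightarrow> bnd (n + k) f B \<Longrightarrow> bnd n (A f) (C * B)"
    and "s \<in> {0..1} \<Longrightarrow> Sm f \<Longrightarrow> bnd (n + k) f B \<Longrightarrow> bnd n (\<lambda>z. P s f z - f z - s * A f z) (C * s\<^sup>2 * B)"
proof -
  have *: "\<forall>s\<in>{0..1}. \<forall>f B. Sm f \<longrightarrow> bnd (n + k) f B \<longrightarrow>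
       bnd n (P s f) (C * B) \<and> bnd n (A f) (C * B) \<and> bnd n (\<lambda>z. P s f z - f z - s * A f z) (C * s\<^sup>2 * B)"
    and "0 \<le> C" using assms unfolding consistent_bound_def by auto
  show "0 \<le> C" by fact
  assume a: "s \<in> {0..1}" "Sm f" "bnd (n + k) f B"
  note ** = *[rule_format, OF a]
  show "bnd n (P s f) (C * B)" "bnd n (A f) (C * B)" "bnd n (\<lambda>z. P s f z - f z - s * A f z) (C * s\<^sup>2 * B)"
    using ** by auto
qed

lemma consistentD:
  assumes "consistent k P A"
  shows "Sm f \<Longrightarrow> Sm (A f)" "Sm f \<Longrightarrow> Sm (P s f)"
    "Sm f \<Longrightarrow> Sm g \<Longrightarrow> P s (\<lambda>z. f z + g z) = (\<lambda>z. P s f z + P s g z)"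
    "Sm f \<Longrightarrow> P s (\<lambda>z. c * f z) = (\<lambda>z. c * P s f z)"
    "\<exists>C. consistent_bound k P A n C"
  using assms unfolding consistent_def by auto

section \<open>Consistency of shears, Gaussian averages and their products\<close>

lemma bnd_Suc:
  assumes "\<And>z. \<bar>g z\<bar> \<le> A" "\<And>a. bnd n (pd a g) B"
  shows "bnd (Suc n) g (A + 3 * B)"
  unfolding bnd_def
proof
  fix z
  have "J (Suc n) g z \<le> A + (\<Sum>a\<in>(UNIV::dir set). B)"
    unfolding J_Suc using assms by (intro add_mono sum_mono) (auto simp: bnd_def)
  then show "J (Suc n) g z \<le> A + 3 * B" by (simp add: sum_dir del: sum_constant)
qed

lemma bnd_shear:
  assumes b: "Sm b"
  shows "\<exists>C\<ge>0. \<forall>s\<in>{0..1}. \<forall>f B. Sm f \<longrightarrow> bnd n f B \<longrightarrow> bnd n (\<lambda>z. f (shear j b s z)) (C * B)"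
proof -
  obtain C where C: "C \<ge> 0" "\<And>s f z. s \<in> {0..1} \<Longrightarrow> smooth f \<Longrightarrow> J n (\<lambda>z. f (shear j b s z)) z \<le> C * J n f (shear j b s z)"
    using J_shear[OF b, of n j] by metis
  show ?thesis
    unfolding bnd_def
  proof (intro exI[of _ C] conjI ballI allI impI C(1))
    fix s f B z assume "s \<in> {0..1::real}" "Sm f" "\<forall>z. J n f z \<le> B"
    then show "J n (\<lambda>z. f (shear j b s z)) z \<le> C * B"
      by (intro order_trans[OF C(2)] mult_left_mono C(1)) (auto intro: Sm_smooth)
  qed
qed

lemma shear_point_bounds:
  assumes "smooth f" "bnd 2 f B" "s \<ge> 0" "\<bar>b z\<bar> \<le> K"
  shows "\<bar>f (shear j b s z) - f z\<bar> \<le> K * s * B"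
    and "\<bar>f (shear j b s z) - f z - s * (b z * pd j f z)\<bar> \<le> K\<^sup>2 * s\<^sup>2 * B"
proof -
  have K: "K \<ge> 0" using assms(4) by linarith
  have n1: "norm (ax j) = 1" by (cases j) (auto simp: norm_Pair)
  let ?h = "(s * b z) *\<^sub>R ax j"
  have nh: "norm ?h \<le> s * K" using assms n1 by (simp add: abs_mult mult_left_mono)
  obtain y where y: "f (z + ?h) = (\<Sum>m<1. (dird ?h ^^ m) f z / fact m) + (dird ?h ^^ 1) f y / fact 1"
    using dird_taylor[OF assms(1), of z ?h 1] by blast
  have "\<bar>pd j f y\<bar> \<le> J 2 f y" using D_le_J[of "[j]" 2 f y] by simp
  then have py: "\<bar>pd j f y\<bar> \<le> B" using bndD[OF assms(2), of y] by linarith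
  have "f (shear j b s z) - f z = (s * b z) * pd j f y"
    using y dird_pow_ax[OF assms(1), where r = "s * b z" and a = j and m = 1] by (simp add: shear_def)
  then have "\<bar>f (shear j b s z) - f z\<bar> = s * \<bar>b z\<bar> * \<bar>pd j f y\<bar>" using assms(3) by (simp add: abs_mult)
  also have "\<dots> \<le> s * K * B" using assms py K by (intro mult_mono) auto
  finally show "\<bar>f (shear j b s z) - f z\<bar> \<le> K * s * B" by (simp add: mult_ac)
  have "dird ?h f z = s * (b z * pd j f z)"
    using dird_pow_ax[OF assms(1), where r = "s * b z" and a = j and m = 1] by (simp add: mult.assoc)
  then have "\<bar>f (shear j b s z) - f z - s * (b z * pd j f z)\<bar> \<le> B * (norm ?h)\<^sup>2"
    using quadratic_remainder[OF assms(1,2), of z ?h] by (simp add: shear_def)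
  also have "\<dots> \<le> B * (s * K)\<^sup>2"
    using nh bnd_nonneg[OF assms(2)] by (intro mult_left_mono power_mono) auto
  finally show "\<bar>f (shear j b s z) - f z - s * (b z * pd j f z)\<bar> \<le> K\<^sup>2 * s\<^sup>2 * B"
    by (simp add: power_mult_distrib mult_ac)
qed

lemma bnd_shear_diff:
  assumes b: "Sm b"
  shows "\<exists>C\<ge>0. \<forall>s\<in>{0..1}. \<forall>f B. Sm f \<longrightarrow> bnd (n + 2) f B \<longrightarrow> bnd n (\<lambda>z. f (shear j b s z) - f z) (C * s * B)"
proof (induction n)
  case 0
  obtain K where K: "K \<ge> 0" "\<And>z. \<bar>b z\<bar> \<le> K" using Cp_bounded[OF Sm_Cp[OF b]] by metis
  show ?case
  proof (intro exI[of _ K] conjI K ballI allI impI)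
    fix s f B assume s: "s \<in> {0..1::real}" and f: "Sm f" and "bnd (0 + 2) f B"
    then have "bnd 2 f B" by (auto intro: bnd_mono)
    with s show "bnd 0 (\<lambda>z. f (shear j b s z) - f z) (K * s * B)"
      using shear_point_bounds(1)[OF Sm_smooth[OF f], of B s b _ K j] K(2) by (simp add: bnd_def[of 0] J_0)
  qed
next
  case (Suc n)
  then obtain C where C: "C \<ge> 0" "\<And>s f B. s \<in> {0..1} \<Longrightarrow> Sm f \<Longrightarrow> bnd (n + 2) f B \<Longrightarrow> bnd n (\<lambda>z. f (shear j b s z) - f z) (C * s * B)"
    by metis
  obtain C' where C': "C' \<ge> 0" "\<And>s f B. s \<in> {0..1} \<Longrightarrow> Sm f \<Longrightarrow> bnd n f B \<Longrightarrow> bnd n (\<lambda>z. f (shear j b s z)) (C' * B)"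
    using bnd_shear[OF b, of n j] by metis
  obtain K where K: "K \<ge> 0" "\<And>z. \<bar>b z\<bar> \<le> K" using Cp_bounded[OF Sm_Cp[OF b]] by metis
  obtain Bb where Bb: "Bb \<ge> 0" "bnd (Suc n) b Bb" using Sm_bnd[OF b] by metis
  let ?E = "C + 2 ^ n * Bb * C'"
  show ?case
  proof (intro exI[of _ "K + 3 * ?E"] conjI ballI allI impI)
    fix s f B assume s: "s \<in> {0..1::real}" and f: "Sm f" and B: "bnd (Suc n + 2) f B"
    let ?S = "shear j b s"
    have B0: "B \<ge> 0" using B by (rule bnd_nonneg)
    have sm: "smooth f" "smooth b" "\<And>a. Sm (pd a f)" "\<And>a. smooth (\<lambda>z. pd a f (?S z))"
      using f b by (auto intro: Sm_smooth Sm_pd smooth_shear)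
    have pa: "pd a (\<lambda>z. f (?S z) - f z) = (\<lambda>z. (pd a f (?S z) - pd a f z) + s * (pd a b z * pd j f (?S z)))" for a
      using pd_diff[OF smooth_shear[OF sm(1,2)] sm(1)] pd_shear[OF smooth_differentiable[OF sm(1)] smooth_differentiable[OF sm(2)]]
      by (simp add: algebra_simps)
    have "bnd n (pd a (\<lambda>z. f (?S z) - f z)) (C * s * B + \<bar>s\<bar> * (2 ^ n * Bb * (C' * B)))" for a
      unfolding pa
    proof (intro bnd_add bnd_cmult bnd_mult C s sm C' smooth_diff smooth_cmult smooth_mult smooth_pd bnd_pd)
      show "bnd (Suc (n + 2)) f B" using B by simp
      show "bnd (Suc n) f B" using B by (rule bnd_mono) auto
      show "bnd (Suc n) b Bb" by (rule Bb)
    qed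
    then have "bnd (Suc n) (\<lambda>z. f (?S z) - f z) (K * s * B + 3 * (C * s * B + \<bar>s\<bar> * (2 ^ n * Bb * (C' * B))))"
      using s by (intro bnd_Suc shear_point_bounds(1) K sm bnd_mono[OF B]) auto
    then show "bnd (Suc n) (\<lambda>z. f (?S z) - f z) ((K + 3 * ?E) * s * B)"
      using s by (simp add: algebra_simps)
  qed (use K C C' Bb in simp)
qed

text \<open>Differentiating the remainder reproduces the remainder of \<open>pd a f\<close>, plus
  \<open>s\<close> times a product with the plain difference of \<open>pd j f\<close>;
  \<open>bnd_shear_diff\<close> supplies the second factor \<open>s\<close>.\<close>

lemma bnd_shear_taylor:
  assumes b: "Sm b"
  shows "\<exists>C\<ge>0. \<forall>s\<in>{0..1}. \<forall>f B. Sm f \<longrightarrow> bnd (n + 3) f B \<longrightarrow>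
     bnd n (\<lambda>z. f (shear j b s z) - f z - s * (b z * pd j f z)) (C * s\<^sup>2 * B)"
proof (induction n)
  case 0
  obtain K where K: "K \<ge> 0" "\<And>z. \<bar>b z\<bar> \<le> K" using Cp_bounded[OF Sm_Cp[OF b]] by metis
  show ?case
  proof (intro exI[of _ "K\<^sup>2"] conjI ballI allI impI)
    fix s f B assume s: "s \<in> {0..1::real}" and f: "Sm f" and "bnd (0 + 3) f B"
    then have "bnd 2 f B" by (auto intro: bnd_mono)
    with s show "bnd 0 (\<lambda>z. f (shear j b s z) - f z - s * (b z * pd j f z)) (K\<^sup>2 * s\<^sup>2 * B)"
      using shear_point_bounds(2)[OF Sm_smooth[OF f], of B s b _ K j] K(2) by (simp add: bnd_def[of 0] J_0)
  qed simp
next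
  case (Suc n)
  then obtain C where C0: "C \<ge> 0" and C1: "\<forall>s\<in>{0..1}. \<forall>f B. Sm f \<longrightarrow> bnd (n + 3) f B \<longrightarrow>
     bnd n (\<lambda>z. f (shear j b s z) - f z - s * (b z * pd j f z)) (C * s\<^sup>2 * B)"
    by blast
  note C = C0 C1[rule_format]
  obtain C' where C': "C' \<ge> 0" "\<And>s f B. s \<in> {0..1} \<Longrightarrow> Sm f \<Longrightarrow> bnd (n + 2) f B \<Longrightarrow> bnd n (\<lambda>z. f (shear j b s z) - f z) (C' * s * B)"
    using bnd_shear_diff[OF b, of n j] by metis
  obtain K where K: "K \<ge> 0" "\<And>z. \<bar>b z\<bar> \<le> K" using Cp_bounded[OF Sm_Cp[OF b]] by metis
  obtain Bb where Bb: "Bb \<ge> 0" "bnd (Suc n) b Bb" using Sm_bnd[OF b] by metis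
  let ?E = "C + 2 ^ n * Bb * C'"
  show ?case
  proof (intro exI[of _ "K\<^sup>2 + 3 * ?E"] conjI ballI allI impI)
    fix s f B assume s: "s \<in> {0..1::real}" and f: "Sm f" and B: "bnd (Suc n + 3) f B"
    let ?S = "shear j b s"
    have sm: "smooth f" "smooth b" "\<And>a. Sm (pd a f)" "\<And>a. smooth (pd a f)" "\<And>a. smooth (pd a b)" "\<And>a. smooth (\<lambda>z. pd a f (?S z))"
      "smooth (\<lambda>z. f (?S z))" "\<And>a. smooth (pd a (pd j f))"
      using f b by (auto intro: Sm_smooth Sm_pd smooth_shear smooth_pd)
    have pa: "pd a (\<lambda>z. f (?S z) - f z - s * (b z * pd j f z))
        = (\<lambda>z. (pd a f (?S z) - pd a f z - s * (b z * pd j (pd a f) z)) + s * (pd a b z * (pd j f (?S z) - pd j f z)))" for a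
    proof -
      have 1: "smooth (\<lambda>z. s * (b z * pd j f z))" "smooth (\<lambda>z. b z * pd j f z)"
        by (intro smooth_cmult smooth_mult sm)+
      have "pd a (\<lambda>z. f (?S z) - f z - s * (b z * pd j f z))
         = (\<lambda>z. pd a (\<lambda>z. f (?S z)) z - pd a f z - s * pd a (\<lambda>z. b z * pd j f z) z)"
        using pd_diff[OF smooth_diff[OF sm(7,1)] 1(1)] pd_diff[OF sm(7,1)] pd_cmult[OF 1(2)] by simp
      moreover have "pd a (\<lambda>z. b z * pd j f z) = (\<lambda>z. pd a b z * pd j f z + b z * pd a (pd j f) z)"
        by (intro pd_mult smooth_differentiable sm)
      moreover have "pd a (\<lambda>z. f (?S z)) = (\<lambda>z. pd a f (?S z) + s * pd a b z * pd j f (?S z))"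
        by (intro pd_shear smooth_differentiable sm)
      ultimately show ?thesis unfolding pd_commute[OF sm(1), of a j] by (simp add: algebra_simps)
    qed
    have 2: "smooth (\<lambda>z. pd a f (?S z) - pd a f z - s * (b z * pd j (pd a f) z))" for a
      unfolding pd_commute[OF sm(1), of j a] by (intro smooth_diff smooth_cmult smooth_mult sm)
    have 3: "smooth (\<lambda>z. pd j f (?S z) - pd j f z)" by (intro smooth_diff sm)
    have "bnd n (pd a (\<lambda>z. f (?S z) - f z - s * (b z * pd j f z))) (C * s\<^sup>2 * B + \<bar>s\<bar> * (2 ^ n * Bb * (C' * s * B)))" for a
      unfolding pa
    proof (intro bnd_add[OF 2 smooth_cmult[OF smooth_mult[OF sm(5) 3]]] bnd_cmult[OF smooth_mult[OF sm(5) 3]]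
        bnd_mult[OF sm(5) 3] C s sm C' bnd_pd)
      show "bnd (Suc (n + 3)) f B" using B by simp
      show "bnd (Suc (n + 2)) f B" using B by (rule bnd_mono) auto
      show "bnd (Suc n) b Bb" by (rule Bb)
    qed
    then have "bnd (Suc n) (\<lambda>z. f (?S z) - f z - s * (b z * pd j f z))
       (K\<^sup>2 * s\<^sup>2 * B + 3 * (C * s\<^sup>2 * B + \<bar>s\<bar> * (2 ^ n * Bb * (C' * s * B))))"
      using s by (intro bnd_Suc shear_point_bounds(2) K sm bnd_mono[OF B]) auto
    then show "bnd (Suc n) (\<lambda>z. f (?S z) - f z - s * (b z * pd j f z)) ((K\<^sup>2 + 3 * ?E) * s\<^sup>2 * B)"
      using s by (simp add: algebra_simps power2_eq_square)
  qed (use K C C' Bb in simp)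
qed

lemma consistent_shear:
  assumes b: "Sm b"
  shows "consistent 3 (\<lambda>s f z. f (shear j b s z)) (\<lambda>f z. b z * pd j f z)"
  unfolding consistent_def
proof (intro conjI allI impI)
  fix n
  obtain C where C0: "C \<ge> 0" and C1: "\<forall>s\<in>{0..1}. \<forall>f B. Sm f \<longrightarrow> bnd (n + 3) f B \<longrightarrow>
     bnd n (\<lambda>z. f (shear j b s z) - f z - s * (b z * pd j f z)) (C * s\<^sup>2 * B)"
    using bnd_shear_taylor[OF b, of n j] by blast
  note C = C0 C1[rule_format]
  obtain C' where C': "C' \<ge> 0" "\<And>s f B. s \<in> {0..1} \<Longrightarrow> Sm f \<Longrightarrow> bnd n f B \<Longrightarrow> bnd n (\<lambda>z. f (shear j b s z)) (C' * B)"
    using bnd_shear[OF b, of n j] by metis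
  obtain Bb where Bb: "Bb \<ge> 0" "bnd n b Bb" using Sm_bnd[OF b] by metis
  let ?C = "C + C' + 2 ^ n * Bb"
  show "\<exists>C. consistent_bound 3 (\<lambda>s f z. f (shear j b s z)) (\<lambda>f z. b z * pd j f z) n C"
    unfolding consistent_bound_def
  proof (intro exI[of _ ?C] conjI ballI allI impI)
    fix s f B assume s: "s \<in> {0..1::real}" and f: "Sm f" and B: "bnd (n + 3) f B"
    have B0: "B \<ge> 0" using B by (rule bnd_nonneg)
    have B': "bnd n f B" "bnd (Suc n) f B" using B by (auto intro: bnd_mono)
    have m: "C * (s\<^sup>2 * B) \<le> ?C * (s\<^sup>2 * B)" "C' * B \<le> ?C * B" "2 ^ n * Bb * B \<le> ?C * B"
      using B0 C C' Bb by (auto intro!: mult_right_mono)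
    show "bnd n (\<lambda>z. f (shear j b s z)) (?C * B)"
      by (rule bnd_mono[OF C'(2)[OF s f B'(1)] order_refl m(2)])
    show "bnd n (\<lambda>z. b z * pd j f z) (?C * B)"
      by (rule bnd_mono[OF bnd_mult[OF Sm_smooth[OF b] smooth_pd[OF Sm_smooth[OF f]] Bb(2) bnd_pd[OF B'(2)]] order_refl m(3)])
    show "bnd n (\<lambda>z. f (shear j b s z) - f z - s * (b z * pd j f z)) (?C * s\<^sup>2 * B)"
      using bnd_mono[OF C(2)[OF s f B] order_refl, of "?C * s\<^sup>2 * B"] m(1) by (simp add: mult.assoc)
  qed (use C C' Bb in simp)
qed (use b in \<open>auto intro: Sm_shear Sm_pd\<close>)

lemma consistent_gauss:
  "consistent 4 (\<lambda>s. Ga (\<sigma> * sqrt s) a) (\<lambda>f z. \<sigma>\<^sup>2 / 2 * pd a (pd a f) z)"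
  unfolding consistent_def
proof (intro conjI allI impI)
  fix n
  let ?C = "1 + \<sigma>\<^sup>2 / 2 + card (words n) * \<sigma> ^ 4"
  show "\<exists>C. consistent_bound 4 (\<lambda>s. Ga (\<sigma> * sqrt s) a) (\<lambda>f z. \<sigma>\<^sup>2 / 2 * pd a (pd a f) z) n C"
    unfolding consistent_bound_def
  proof (intro exI[of _ ?C] conjI ballI allI impI)
    fix s f B assume s: "s \<in> {0..1::real}" and f: "Sm f" and B: "bnd (n + 4) f B"
    have B0: "B \<ge> 0" using B by (rule bnd_nonneg)
    have B': "bnd n f B" "bnd (Suc (Suc n)) f B" using B by (auto intro: bnd_mono)
    have C1: "1 \<le> ?C" "\<sigma>\<^sup>2 / 2 \<le> ?C" "card (words n) * \<sigma> ^ 4 \<le> ?C" by auto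
    have "\<bar>\<sigma>\<^sup>2 / 2\<bar> \<le> ?C" "0 \<le> s\<^sup>2 * B" using C1 B0 by auto
    then have m: "1 * B \<le> ?C * B" "\<bar>\<sigma>\<^sup>2 / 2\<bar> * B \<le> ?C * B" "card (words n) * \<sigma> ^ 4 * (s\<^sup>2 * B) \<le> ?C * (s\<^sup>2 * B)"
      using B0 C1 by (blast intro: mult_right_mono)+
    show "bnd n (Ga (\<sigma> * sqrt s) a f) (?C * B)"
      using bnd_mono[OF bnd_Av[OF prm_gauss f B'(1)] order_refl] m(1) by simp
    show "bnd n (\<lambda>z. \<sigma>\<^sup>2 / 2 * pd a (pd a f) z) (?C * B)"
      by (rule bnd_mono[OF bnd_cmult[OF smooth_pd[OF smooth_pd[OF Sm_smooth[OF f]]] bnd_pd[OF bnd_pd[OF B'(2)]]] order_refl m(2)])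
    have c: "(\<sigma> * sqrt s)\<^sup>2 = s * \<sigma>\<^sup>2" using s by (simp add: power_mult_distrib)
    then have "((\<sigma> * sqrt s)\<^sup>2)\<^sup>2 = (s * \<sigma>\<^sup>2)\<^sup>2" by simp
    then have "(\<sigma> * sqrt s) ^ 4 = s\<^sup>2 * \<sigma> ^ 4" by (simp add: power_mult_distrib power_mult[symmetric])
    with c show "bnd n (\<lambda>z. Ga (\<sigma> * sqrt s) a f z - f z - s * (\<sigma>\<^sup>2 / 2 * pd a (pd a f) z)) (?C * s\<^sup>2 * B)"
      using bnd_mono[OF bnd_gauss_taylor[OF f B, of "\<sigma> * sqrt s" a] order_refl, of "?C * s\<^sup>2 * B"] m(3)
      by (simp add: mult_ac)
  qed simp
next
  fix f assume f: "Sm f"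
  show "Sm (\<lambda>z. \<sigma>\<^sup>2 / 2 * pd a (pd a f) z)" by (intro Sm_cmult Sm_pd f)
  show "Sm (Ga (\<sigma> * sqrt s) a f)" for s by (intro Sm_Av prm_gauss f)
qed (auto simp: Av_add Sm_Cp Av_cmult fun_eq_iff)

text \<open>The losses of derivatives add because \<open>Q\<close> has to be controlled in the
  higher norm that \<open>P\<close> consumes.\<close>

lemma consistent_comp:
  assumes P: "consistent k P A" and Q: "consistent l Q B"
  shows "consistent (k + l) (\<lambda>s f. P s (Q s f)) (\<lambda>f z. A f z + B f z)"
proof -
  note PS = consistentD(2,1)[OF P] and QS = consistentD(2,1)[OF Q]
  note Pl = consistentD(3,4)[OF P] and Ql = consistentD(3,4)[OF Q]
  show ?thesis
    unfolding consistent_def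
  proof (intro conjI allI impI)
    fix n
    from consistentD(5)[OF P] obtain C where C: "consistent_bound k P A n C" ..
    from consistentD(5)[OF Q] obtain C' where C': "consistent_bound l Q B (n + k) C'" ..
    note C = consistent_boundD[OF C] and C' = consistent_boundD[OF C']
    let ?C = "2 * C * C' + C + C' + C * C'"
    show "\<exists>C. consistent_bound (k + l) (\<lambda>s f. P s (Q s f)) (\<lambda>f z. A f z + B f z) n C"
      unfolding consistent_bound_def
    proof (intro exI[of _ ?C] conjI)
      show "\<forall>s\<in>{0..1}. \<forall>f b. Sm f \<longrightarrow> bnd (n + (k + l)) f b \<longrightarrow>
       bnd n (P s (Q s f)) (?C * b) \<and> bnd n (\<lambda>z. A f z + B f z) (?C * b) \<and>
       bnd n (\<lambda>z. P s (Q s f) z - f z - s * (A f z + B f z)) (?C * s\<^sup>2 * b)"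
      proof (intro ballI allI impI)
        fix s f b assume s: "s \<in> {0..1::real}" and f: "Sm f" and b: "bnd (n + (k + l)) f b"
        have b0: "b \<ge> 0" using b by (rule bnd_nonneg)
        have b': "bnd (n + k + l) f b" "bnd (n + k) f b" using b by (auto intro: bnd_mono simp: add.assoc)
        note c' = C'(2-4)[OF s f b'(1)]
        note c = C(2-4)[OF s f b'(2)]
        let ?q = "\<lambda>z. Q s f z - f z - s * B f z" and ?p = "\<lambda>z. P s f z - f z - s * A f z"
        let ?r = "\<lambda>z. P s (B f) z - B f z - s * A (B f) z"
        have q: "Sm ?q" "Sm ?p" "Sm ?r" using f by (auto intro!: PS QS)
        have cq: "bnd n (P s ?q) (C * (C' * s\<^sup>2 * b))" by (rule C(2)[OF s q(1) c'(3)])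
        have cB: "bnd n (P s (B f)) (C * (C' * b))" "bnd n (A (B f)) (C * (C' * b))" "bnd n ?r (C * s\<^sup>2 * (C' * b))"
          by (rule C(2-4)[OF s QS(2)[OF f] c'(2)])+
        have 1: "bnd n (P s (Q s f)) (?C * b)"
        proof (rule bnd_mono)
          show "bnd n (P s (Q s f)) (C * (C' * b))" by (rule C(2)[OF s QS(1)[OF f] c'(1)])
          show "C * (C' * b) \<le> ?C * b" using C(1) C'(1) b0 by (simp add: algebra_simps)
        qed simp
        have Bn: "bnd n (B f) (C' * b)" using bnd_mono[OF c'(2), of n] by simp
        have 2: "bnd n (\<lambda>z. A f z + B f z) (?C * b)"
        proof (rule bnd_mono)
          show "bnd n (\<lambda>z. A f z + B f z) (C * b + C' * b)"
            using c Bn by (intro bnd_add Sm_smooth PS QS f) auto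
          show "C * b + C' * b \<le> ?C * b" using C(1) C'(1) b0 by (simp add: algebra_simps)
        qed simp
        \<comment> \<open>\<open>Q s f\<close> is split into its first order part and the remainder
          \<open>?q\<close>, and \<open>P s\<close> is applied to each piece. The cross term with
          \<open>A (B f)\<close> carries two factors \<open>s\<close>, and \<open>s * ?r\<close> is
          of third order.\<close>
        have eq: "(\<lambda>z. P s (Q s f) z - f z - s * (A f z + B f z))
           = (\<lambda>z. (?p z + P s ?q z) + (s * (s * A (B f) z) + s * ?r z))"
        proof -
          have "Q s f = (\<lambda>z. (f z + s * B f z) + ?q z)" by auto
          then have "P s (Q s f) = P s (\<lambda>z. (f z + s * B f z) + ?q z)" by metis
          also have "\<dots> = (\<lambda>z. P s (\<lambda>z. f z + s * B f z) z + P s ?q z)"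
            by (intro Pl(1) Sm_add Sm_cmult QS f q)
          also have "P s (\<lambda>z. f z + s * B f z) = (\<lambda>z. P s f z + P s (\<lambda>z. s * B f z) z)"
            by (intro Pl(1) Sm_add Sm_cmult QS f q)
          also have "P s (\<lambda>z. s * B f z) = (\<lambda>z. s * P s (B f) z)"
            by (intro Pl(2) QS f)
          finally show ?thesis by (simp add: algebra_simps)
        qed
        have 3: "bnd n (\<lambda>z. P s (Q s f) z - f z - s * (A f z + B f z)) (?C * s\<^sup>2 * b)"
        proof (rule bnd_mono)
          note sA = Sm_smooth[OF PS(2)[OF QS(2)[OF f]]]
          show "bnd n (\<lambda>z. P s (Q s f) z - f z - s * (A f z + B f z))
             ((C * s\<^sup>2 * b + C * (C' * s\<^sup>2 * b)) + (\<bar>s\<bar> * (\<bar>s\<bar> * (C * (C' * b))) + \<bar>s\<bar> * (C * s\<^sup>2 * (C' * b))))"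
            unfolding eq
            using c cB cq q by (intro bnd_add bnd_cmult sA smooth_add smooth_cmult Sm_smooth PS) auto
          have "s * (C * s\<^sup>2 * (C' * b)) \<le> 1 * (C * s\<^sup>2 * (C' * b))"
            using s C(1) C'(1) b0 by (intro mult_right_mono) auto
          moreover have "0 \<le> C' * (b * (s * s))" using C'(1) b0 by simp
          ultimately show "((C * s\<^sup>2 * b + C * (C' * s\<^sup>2 * b)) + (\<bar>s\<bar> * (\<bar>s\<bar> * (C * (C' * b))) + \<bar>s\<bar> * (C * s\<^sup>2 * (C' * b)))) \<le> ?C * s\<^sup>2 * b"
            using s by (simp add: algebra_simps power2_eq_square)
        qed simp
        show "bnd n (P s (Q s f)) (?C * b) \<and> bnd n (\<lambda>z. A f z + B f z) (?C * b) \<and>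
           bnd n (\<lambda>z. P s (Q s f) z - f z - s * (A f z + B f z)) (?C * s\<^sup>2 * b)"
          using 1 2 3 by blast
      qed
    qed (use C C' in simp)
  qed (use PS QS Pl Ql in \<open>simp_all add: Sm_add\<close>)
qed

section \<open>Decay of the weighted energy\<close>

lemma R_square:
  assumes "smooth f"
  shows "(R n f z)\<^sup>2 \<le> 2 * card (words n) * (\<Sum>u\<in>words n. (pd DX (D u f) z)\<^sup>2 + (pd DY (D u f) z)\<^sup>2)"
proof -
  have "R n f z = (\<Sum>u\<in>words n. \<bar>pd DX (D u f) z\<bar> + \<bar>pd DY (D u f) z\<bar>)"
    by (simp add: R_def J_def sum.distrib D_pd_commute[OF assms])
  then have "(R n f z)\<^sup>2 \<le> (\<Sum>u\<in>words n. (\<bar>pd DX (D u f) z\<bar> + \<bar>pd DY (D u f) z\<bar>)\<^sup>2) * card (words n)"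
    using sum_squared_le_sum_of_squares[of "\<lambda>u. \<bar>pd DX (D u f) z\<bar> + \<bar>pd DY (D u f) z\<bar>" "words n"] by simp
  also have "\<dots> \<le> (\<Sum>u\<in>words n. 2 * ((pd DX (D u f) z)\<^sup>2 + (pd DY (D u f) z)\<^sup>2)) * card (words n)"
  proof (intro mult_right_mono sum_mono)
    fix u
    have "(x + y)\<^sup>2 \<le> 2 * (x\<^sup>2 + y\<^sup>2)" for x y :: real
      using sum_squares_bound[of x y] by (simp add: power2_sum)
    from this[of "\<bar>pd DX (D u f) z\<bar>" "\<bar>pd DY (D u f) z\<bar>"]
    show "(\<bar>pd DX (D u f) z\<bar> + \<bar>pd DY (D u f) z\<bar>)\<^sup>2 \<le> 2 * ((pd DX (D u f) z)\<^sup>2 + (pd DY (D u f) z)\<^sup>2)" by simp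
  qed simp
  finally show ?thesis unfolding sum_distrib_left[symmetric] by (simp add: mult_ac)
qed

text \<open>Young's inequality. It is used with \<open>p\<close> proportional to \<open>s\<close>
  and \<open>e\<close> of order \<open>s\<close>: the factor of the main term then differs from 1 by
  order \<open>s\<close>, and the error term is of order \<open>s\<close> too.\<close>

lemma perturbed_square:
  fixes x a e p :: real
  assumes "\<bar>x - a\<bar> \<le> e" "p > 0"
  shows "x\<^sup>2 \<le> (1 + p) * a\<^sup>2 + (1 + 1 / p) * e\<^sup>2"
proof -
  define d where "d = x - a"
  have "0 \<le> (p * a - d)\<^sup>2 / p" using assms by simp
  also have "(p * a - d)\<^sup>2 / p = p * a\<^sup>2 - 2 * a * d + d\<^sup>2 / p"
    using assms by (simp add: field_simps power2_eq_square)
  finally have 1: "2 * a * d \<le> p * a\<^sup>2 + d\<^sup>2 / p" by simp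
  have "x\<^sup>2 = (a + d)\<^sup>2" by (simp add: d_def)
  also have "\<dots> = a\<^sup>2 + 2 * a * d + d\<^sup>2" by (simp add: power2_sum)
  also have "\<dots> \<le> (1 + p) * a\<^sup>2 + (1 + 1 / p) * d\<^sup>2" using 1 by (simp add: distrib_right)
  also have "d\<^sup>2 \<le> e\<^sup>2" using assms by (simp add: d_def abs_le_square_iff[symmetric])
  finally show ?thesis using assms by (simp add: mult_left_mono)
qed

text \<open>Evaluated at the time of \<open>z\<close> and not integrated over time: one step relates
  the energies at times that differ by \<open>s\<close>, and pointwise bounds are recovered by
  Sobolev's inequality in space alone.\<close>

definition En :: "real \<Rightarrow> nat \<Rightarrow> (pt \<Rightarrow> real) \<Rightarrow> pt \<Rightarrow> real" where
  "En \<eta> m f z = (\<Sum>w\<in>words m. \<eta> ^ length w * M (\<lambda>y. (D w f y)\<^sup>2) z)"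

definition Nn :: "dir list \<Rightarrow> (pt \<Rightarrow> real) \<Rightarrow> pt \<Rightarrow> real" where
  "Nn u f z = M (\<lambda>y. (pd DX (D u f) y)\<^sup>2) z + M (\<lambda>y. (pd DY (D u f) y)\<^sup>2) z"

lemma Nn_nonneg: "0 \<le> Nn u f z"
  unfolding Nn_def by (intro add_nonneg_nonneg M_nonneg) auto

lemma En_le:
  fixes B \<eta> :: real
  assumes "Sm f" "bnd m f B" "0 \<le> \<eta>" "\<eta> \<le> 1"
  shows "En \<eta> m f z \<le> card (words m) * B\<^sup>2"
  unfolding En_def
proof (rule sum_bounded_above)
  fix w assume w: "w \<in> words m"
  have "M (\<lambda>y. (D w f y)\<^sup>2) z \<le> M (\<lambda>y. B\<^sup>2) z"
  proof (intro M_mono Cp_power Cp_const Sm_Cp Sm_D assms)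
    fix y
    have "\<bar>D w f y\<bar> \<le> B" using D_le_J[of w m f y] bndD[OF assms(2), of y] w by simp
    then show "(D w f y)\<^sup>2 \<le> B\<^sup>2" using power_mono[of "\<bar>D w f y\<bar>" B 2] by simp
  qed
  then have "\<eta> ^ length w * M (\<lambda>y. (D w f y)\<^sup>2) z \<le> 1 * B\<^sup>2"
    using assms by (intro mult_mono power_le_one) (auto intro: M_nonneg)
  then show "\<eta> ^ length w * M (\<lambda>y. (D w f y)\<^sup>2) z \<le> B\<^sup>2" by simp
qed

text \<open>Sobolev's inequality for \<open>D u f\<close> costs two further letters. The words
  obtained by appending \<open>u\<close> are distinct, have length at most \<open>n + 2\<close>, and
  none has a weight below \<open>\<eta> ^ (n + 2)\<close>.\<close>

lemma J_le_En:
  fixes E \<eta> :: real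
  assumes "Sm f" "0 < \<eta>" "\<eta> \<le> 1" "En \<eta> (n + 2) f z \<le> E"
  shows "J n f z \<le> card (words n) * sqrt (4 * E / \<eta> ^ (n + 2))"
  unfolding J_def
proof (rule sum_bounded_above)
  fix u assume u: "u \<in> words n"
  have C: "Cp (\<lambda>y. (D w f y)\<^sup>2)" for w using assms by (intro Cp_power Sm_Cp Sm_D)
  have "(D u f z)\<^sup>2 \<le> 4 * M (\<lambda>y. \<Sum>w\<in>words 2. (D w (D u f) y)\<^sup>2) z"
    using assms by (intro sobolev Sm_D)
  also have "M (\<lambda>y. \<Sum>w\<in>words 2. (D w (D u f) y)\<^sup>2) z = (\<Sum>w\<in>words 2. M (\<lambda>y. (D (w @ u) f y)\<^sup>2) z)"
    using C[of "_ @ u"] by (subst M_sum) auto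
  also have "\<dots> = (\<Sum>v\<in>(\<lambda>w. w @ u) ` words 2. M (\<lambda>y. (D v f y)\<^sup>2) z)"
    by (subst sum.reindex) (auto simp: inj_on_def)
  also have "\<dots> \<le> (\<Sum>v\<in>words (n + 2). M (\<lambda>y. (D v f y)\<^sup>2) z)"
    using u by (intro sum_mono2) (auto intro: M_nonneg)
  also have "\<dots> \<le> (\<Sum>v\<in>words (n + 2). \<eta> ^ length v * M (\<lambda>y. (D v f y)\<^sup>2) z / \<eta> ^ (n + 2))"
  proof (rule sum_mono)
    fix v assume "v \<in> words (n + 2)"
    then have "\<eta> ^ (n + 2) \<le> \<eta> ^ length v" using assms by (intro power_decreasing) auto
    then have "M (\<lambda>y. (D v f y)\<^sup>2) z * \<eta> ^ (n + 2) \<le> M (\<lambda>y. (D v f y)\<^sup>2) z * \<eta> ^ length v"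
      by (intro mult_left_mono M_nonneg) auto
    then show "M (\<lambda>y. (D v f y)\<^sup>2) z \<le> \<eta> ^ length v * M (\<lambda>y. (D v f y)\<^sup>2) z / \<eta> ^ (n + 2)"
      using assms by (simp add: pos_le_divide_eq mult_ac)
  qed
  also have "\<dots> = En \<eta> (n + 2) f z / \<eta> ^ (n + 2)" by (simp add: En_def sum_divide_distrib)
  also have "\<dots> \<le> E / \<eta> ^ (n + 2)" using assms by (intro divide_right_mono) auto
  finally have "(D u f z)\<^sup>2 \<le> 4 * E / \<eta> ^ (n + 2)" by simp
  then show "\<bar>D u f z\<bar> \<le> sqrt (4 * E / \<eta> ^ (n + 2))" by (rule real_le_rsqrt[of "\<bar>D u f z\<bar>", simplified])
qed

lemma M_translate: "M (\<lambda>z. f (shear DT (\<lambda>_. k) s z)) z = M f (shear DT (\<lambda>_. k) s z)"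
  by (simp add: M_def Av_def shear_def add_ac)

section \<open>The one-step operator, its dissipation and its stability\<close>

locale scheme =
  fixes b1 b2 :: "pt \<Rightarrow> real" and \<sigma> :: real
  assumes b1: "Sm b1" and b2: "Sm b2"
    and b1x: "\<And>z r. b1 (z + r *\<^sub>R ax DX) = b1 z"
    and b2y: "\<And>z r. b2 (z + r *\<^sub>R ax DY) = b2 z"
    and sigma: "\<sigma> > 0"
begin

text \<open>The innermost shear acts first. So both drifts are evaluated at the midpoint in time,
  and \<open>b2\<close> sees the first coordinate already updated.\<close>

definition Sx :: "real \<Rightarrow> pt \<Rightarrow> pt" where
  "Sx s z = shear DT (\<lambda>_. 1/2) s (shear DY b2 s (shear DX b1 s (shear DT (\<lambda>_. 1/2) s z)))"

definition G :: "real \<Rightarrow> (pt \<Rightarrow> real) \<Rightarrow> pt \<Rightarrow> real" where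
  "G s f = Ga (\<sigma> * sqrt s) DX (Ga (\<sigma> * sqrt s) DY f)"

definition I :: "real \<Rightarrow> (pt \<Rightarrow> real) \<Rightarrow> pt \<Rightarrow> real" where
  "I s f z = G s f (Sx s z)"

definition L :: "(pt \<Rightarrow> real) \<Rightarrow> pt \<Rightarrow> real" where
  "L f z = pd DT f z + b1 z * pd DX f z + b2 z * pd DY f z + \<sigma>\<^sup>2 / 2 * (pd DX (pd DX f) z + pd DY (pd DY f) z)"

lemma adm_Sx: "adm Sx"
proof -
  have "adm (shear DX b1)" "adm (shear DY b2)" using b1 b2 by (auto intro: adm_shear)
  then show ?thesis
    using adm_comp[OF adm_comp[OF adm_comp[OF adm_translate[of DT "1/2"]]] adm_translate[of DT "1/2"], of "shear DX b1" "shear DY b2"]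
    unfolding Sx_def[abs_def] by simp
qed

text \<open>The two drift shears drop out of the spatial mean; the half steps remain and add up to
  one time step.\<close>

lemma M_Sx:
  assumes "Cp f"
  shows "M (\<lambda>z. f (Sx s z)) z = M f (z + s *\<^sub>R ax DT)"
proof -
  let ?T = "shear DT (\<lambda>_. 1/2) s"
  have 1: "Cp (\<lambda>z. f (?T z))" by (rule Cp_shear[OF assms Cp_const])
  have 2: "Cp (\<lambda>z. f (?T (shear DY b2 s z)))" by (rule Cp_shear[OF 1 Sm_Cp[OF b2]])
  have "M (\<lambda>z. f (Sx s z)) z = M (\<lambda>z. f (?T (shear DY b2 s (shear DX b1 s z)))) (?T z)"
    unfolding Sx_def by (rule M_translate)
  also have "M (\<lambda>z. f (?T (shear DY b2 s (shear DX b1 s z)))) = M (\<lambda>z. f (?T (shear DY b2 s z)))"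
    using M_shear[OF 2 Sm_Cp[OF b1] _ b1x] by simp
  also have "\<dots> = M (\<lambda>z. f (?T z))" using M_shear[OF 1 Sm_Cp[OF b2] _ b2y] by simp
  also have "M (\<lambda>z. f (?T z)) (?T z) = M f (?T (?T z))" by (rule M_translate)
  also have "?T (?T z) = z + s *\<^sub>R ax DT" by (simp add: shear_def)
  finally show ?thesis .
qed

lemma Sm_G: "Sm f \<Longrightarrow> Sm (G s f)"
  unfolding G_def by (intro Sm_Av prm_gauss)

lemma Cp_G: "Cp f \<Longrightarrow> Cp (G s f)"
  unfolding G_def by (intro Cp_Av prm_gauss)

lemma D_G: "Sm f \<Longrightarrow> D w (G s f) = G s (D w f)"
  unfolding G_def by (simp add: D_Av Sm_Av)

lemma M_G: "Cp f \<Longrightarrow> M (G s f) = M f"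
  unfolding G_def by (simp add: M_gauss Cp_Av)

lemma Sm_I: "Sm f \<Longrightarrow> Sm (I s f)"
  unfolding I_def[abs_def] by (intro admD(1)[OF adm_Sx] Sm_G)

lemma Sm_I_pow: "Sm f \<Longrightarrow> Sm ((I s ^^ n) f)"
  by (induction n) (auto intro: Sm_I)

lemma M_I: "Cp f \<Longrightarrow> M (I s f) z = M f (z + s *\<^sub>R ax DT)"
  unfolding I_def[abs_def] by (simp add: M_Sx Cp_G M_G)

lemma M_I_zero: "Cp f \<Longrightarrow> M f = (\<lambda>z. 0) \<Longrightarrow> M (I s f) = (\<lambda>z. 0)"
  by (rule ext) (simp add: M_I)

lemma M_I_pow_zero: "Sm f \<Longrightarrow> M f = (\<lambda>z. 0) \<Longrightarrow> M ((I s ^^ n) f) = (\<lambda>z. 0)"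
  by (induction n) (auto intro!: M_I_zero Sm_Cp Sm_I_pow)

text \<open>The \<open>DX\<close> gradient is gained directly by the outer average. The
  \<open>DY\<close> gradient is gained by the inner one and survives the outer by Jensen, since
  derivatives and averages commute.\<close>

lemma dissipation:
  assumes f: "Sm f" and s: "s \<ge> 0"
  shows "M (\<lambda>z. (G s f z)\<^sup>2) z + \<sigma>\<^sup>2 * s * (M (\<lambda>z. (pd DX (G s f) z)\<^sup>2) z + M (\<lambda>z. (pd DY (G s f) z)\<^sup>2) z)
     \<le> M (\<lambda>z. (f z)\<^sup>2) z"
proof -
  define c where "c = \<sigma> * sqrt s"
  have c: "c\<^sup>2 = \<sigma>\<^sup>2 * s" using s by (simp add: c_def power_mult_distrib)
  define g where "g = Ga c DY f"
  define h where "h = Ga c DX g"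
  have Sm: "Sm g" "Sm h" "Sm (pd DY g)" "Sm (pd DX h)" "Sm (pd DY h)"
    using f by (auto simp: g_def h_def intro!: Sm_Av Sm_pd)
  have Cp: "Cp f" "Cp g" "Cp h" "Cp (pd DY g)" "Cp (pd DX h)" "Cp (pd DY h)"
    using f Sm by (auto intro: Sm_Cp)
  have "M (\<lambda>z. (h z)\<^sup>2) z + c\<^sup>2 * M (\<lambda>z. (pd DX h z)\<^sup>2) z = M (\<lambda>z. (h z)\<^sup>2 + c\<^sup>2 * (pd DX h z)\<^sup>2) z"
    using Cp by (subst M_add) (auto simp: M_cmult)
  also have "\<dots> \<le> M (Ga c DX (\<lambda>z. (g z)\<^sup>2)) z"
    unfolding h_def using Cp Sm by (intro M_mono reverse_poincare Cp_add Cp_power Cp_cmult Cp_Av prm_gauss) (auto simp: h_def)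
  also have "\<dots> = M (\<lambda>z. (g z)\<^sup>2) z" using Cp by (subst M_gauss) auto
  finally have 1: "M (\<lambda>z. (h z)\<^sup>2) z + c\<^sup>2 * M (\<lambda>z. (pd DX h z)\<^sup>2) z \<le> M (\<lambda>z. (g z)\<^sup>2) z" .
  have "M (\<lambda>z. (g z)\<^sup>2) z + c\<^sup>2 * M (\<lambda>z. (pd DY g z)\<^sup>2) z = M (\<lambda>z. (g z)\<^sup>2 + c\<^sup>2 * (pd DY g z)\<^sup>2) z"
    using Cp by (subst M_add) (auto simp: M_cmult)
  also have "\<dots> \<le> M (Ga c DY (\<lambda>z. (f z)\<^sup>2)) z"
    unfolding g_def using Cp Sm f by (intro M_mono reverse_poincare Cp_add Cp_power Cp_cmult Cp_Av prm_gauss) (auto simp: g_def)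
  also have "\<dots> = M (\<lambda>z. (f z)\<^sup>2) z" using Cp by (subst M_gauss) auto
  finally have 2: "M (\<lambda>z. (g z)\<^sup>2) z + c\<^sup>2 * M (\<lambda>z. (pd DY g z)\<^sup>2) z \<le> M (\<lambda>z. (f z)\<^sup>2) z" .
  have "pd DY h = Ga c DX (pd DY g)" unfolding h_def using Sm by (intro pd_Av) auto
  then have "M (\<lambda>z. (pd DY h z)\<^sup>2) z \<le> M (Ga c DX (\<lambda>z. (pd DY g z)\<^sup>2)) z"
    using Cp by (auto intro!: M_mono Av_square Cp_Av)
  also have "\<dots> = M (\<lambda>z. (pd DY g z)\<^sup>2) z" using Cp by (subst M_gauss) auto
  finally have 3: "M (\<lambda>z. (pd DY h z)\<^sup>2) z \<le> M (\<lambda>z. (pd DY g z)\<^sup>2) z" .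
  have "c\<^sup>2 * M (\<lambda>z. (pd DY h z)\<^sup>2) z \<le> c\<^sup>2 * M (\<lambda>z. (pd DY g z)\<^sup>2) z" using 3 by (intro mult_left_mono) auto
  moreover have "G s f = h" by (simp add: G_def h_def g_def c_def)
  ultimately show ?thesis using 1 2 by (simp add: c distrib_left)
qed

text \<open>Only strictly shorter words occur in the sum, because the error of \<open>D w\<close>
  contains a spatial derivative that takes up one letter. This gap of one letter later buys a factor
  \<open>\<eta>\<close>.\<close>

lemma word_energy:
  assumes \<delta>: "\<delta> > 0"
  shows "\<exists>K\<ge>0. \<forall>s\<in>{0<..1}. \<forall>f. Sm f \<longrightarrow> (\<forall>w\<in>words m. \<forall>z.
    (D w (\<lambda>z. f (Sx s z)) z)\<^sup>2 \<le> (1 + \<delta> * s) * (D w f (Sx s z))\<^sup>2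
      + s * K * (\<Sum>u\<in>{u\<in>words m. length u < length w}. (pd DX (D u f) (Sx s z))\<^sup>2 + (pd DY (D u f) (Sx s z))\<^sup>2))"
proof -
  obtain Cf where Cf: "\<And>n. adm_bound Sx n (Cf n)" using admD(3)[OF adm_Sx] by metis
  define C where "C = (\<Sum>n<m. Cf n)"
  have Cle: "Cf n \<le> C" if "n < m" for n
    unfolding C_def using that adm_boundD(1)[OF Cf] by (intro member_le_sum) auto
  have C0: "C \<ge> 0" unfolding C_def by (intro sum_nonneg adm_boundD(1)[OF Cf])
  define K where "K = (1 + 1 / \<delta>) * C\<^sup>2 * (2 * card (words m))"
  have K0: "K \<ge> 0" using \<delta> by (simp add: K_def)
  show ?thesis
  proof (intro exI[of _ K] conjI K0 ballI allI impI)
    fix s f w z assume s: "s \<in> {0<..1::real}" and f: "Sm f" and w: "w \<in> words m"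
    let ?z = "Sx s z"
    let ?q = "\<lambda>u. (pd DX (D u f) ?z)\<^sup>2 + (pd DY (D u f) ?z)\<^sup>2"
    show "(D w (\<lambda>z. f (Sx s z)) z)\<^sup>2 \<le> (1 + \<delta> * s) * (D w f ?z)\<^sup>2 + s * K * (\<Sum>u\<in>{u\<in>words m. length u < length w}. ?q u)"
    proof (cases "length w")
      case 0
      then have "1 * (f ?z)\<^sup>2 \<le> (1 + \<delta> * s) * (f ?z)\<^sup>2" using s \<delta> by (intro mult_right_mono) auto
      then show ?thesis using 0 by simp
    next
      case (Suc n)
      then have n: "n < m" using w by simp
      have eq: "{u\<in>words m. length u < length w} = words n" using Suc n by auto
      have "\<bar>D w (\<lambda>z. f (Sx s z)) z - D w f ?z\<bar> \<le> Cf n * s * R n f ?z"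
        using s Suc by (intro adm_boundD(2)[OF Cf] f) auto
      also have "\<dots> \<le> C * s * R n f ?z" using Cle[OF n] s by (intro mult_right_mono R_nonneg) auto
      \<comment> \<open>Young's parameter is \<open>\<delta> * s\<close>: its reciprocal meets the
        square of the error, which is of second order in \<open>s\<close>, and one power of
        \<open>s\<close> is left.\<close>
      finally have "(D w (\<lambda>z. f (Sx s z)) z)\<^sup>2 \<le> (1 + \<delta> * s) * (D w f ?z)\<^sup>2 + (1 + 1 / (\<delta> * s)) * (C * s * R n f ?z)\<^sup>2"
        using s \<delta> by (intro perturbed_square) auto
      also have "(1 + 1 / (\<delta> * s)) * (C * s * R n f ?z)\<^sup>2 = (s + 1 / \<delta>) * s * C\<^sup>2 * (R n f ?z)\<^sup>2"
        using s \<delta> by (simp add: field_simps power2_eq_square)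
      also have "\<dots> \<le> (1 + 1 / \<delta>) * s * C\<^sup>2 * (2 * card (words m) * (\<Sum>u\<in>words n. ?q u))"
      proof (intro mult_mono)
        have "(R n f ?z)\<^sup>2 \<le> 2 * card (words n) * (\<Sum>u\<in>words n. ?q u)" by (rule R_square[OF Sm_smooth[OF f]])
        also have "\<dots> \<le> 2 * card (words m) * (\<Sum>u\<in>words n. ?q u)"
          using n by (intro mult_right_mono sum_nonneg) (auto intro!: card_mono)
        finally show "(R n f ?z)\<^sup>2 \<le> 2 * card (words m) * (\<Sum>u\<in>words n. ?q u)" .
      qed (use s \<delta> in auto)
      finally show ?thesis unfolding eq by (simp add: K_def mult_ac)
    qed
  qed
qed

text \<open>With \<open>\<delta> = \<sigma>\<^sup>2 / 4\<close> this is the solution of \<open>rate + 2 \<delta> + 2 \<delta> rate = \<sigma>\<^sup>2\<close>, the balance of decay and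
  dissipation in the energy estimate.\<close>

definition rate :: real where
  "rate = \<sigma>\<^sup>2 / (2 + \<sigma>\<^sup>2)"

lemma rate_pos: "rate > 0"
  using sigma by (simp add: rate_def add_pos_pos)

text \<open>The weight \<open>\<eta>\<close> may depend on \<open>m\<close> and on the drifts but
  not on \<open>s\<close>. The dissipation is spent on three things: the factor
  \<open>1 + \<delta> * s\<close> in front of the energy, the errors from shorter words, and the
  decay itself.\<close>

lemma energy_step:
  "\<exists>\<eta>. 0 < \<eta> \<and> \<eta> \<le> 1 \<and> (\<forall>s\<in>{0<..1}. \<forall>f. Sm f \<longrightarrow> M f = (\<lambda>z. 0) \<longrightarrow>
     (\<forall>z. (1 + rate * s) * En \<eta> m (I s f) z \<le> En \<eta> m f (z + s *\<^sub>R ax DT)))"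
proof -
  define \<delta> where "\<delta> = \<sigma>\<^sup>2 / 4"
  have \<delta>: "\<delta> > 0" using sigma by (simp add: \<delta>_def)
  obtain K where K: "K \<ge> 0" and Kw: "\<forall>s\<in>{0<..1}. \<forall>f. Sm f \<longrightarrow> (\<forall>w\<in>words m. \<forall>z.
    (D w (\<lambda>z. f (Sx s z)) z)\<^sup>2 \<le> (1 + \<delta> * s) * (D w f (Sx s z))\<^sup>2
      + s * K * (\<Sum>u\<in>{u\<in>words m. length u < length w}. (pd DX (D u f) (Sx s z))\<^sup>2 + (pd DY (D u f) (Sx s z))\<^sup>2))"
    using word_energy[OF \<delta>, of m] by blast
  define W where "W = real (card (words m))"
  have W0: "W \<ge> 0" by (simp add: W_def)
  \<comment> \<open>Makes the coefficient \<open>K * W * \<eta>\<close> of all errors together at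
    most \<open>\<delta>\<close>; the added 1 keeps the denominator positive.\<close>
  define \<eta> where "\<eta> = min 1 (\<delta> / (K * W + 1))"
  have KW: "K * W + 1 > 0" using K W0 by (simp add: add_nonneg_pos)
  have \<eta>: "0 < \<eta>" "\<eta> \<le> 1" using \<delta> KW by (auto simp: \<eta>_def)
  have \<eta>K: "K * W * \<eta> \<le> \<delta>"
  proof -
    have "K * W * \<eta> \<le> (K * W + 1) * \<eta>" using \<eta> by simp
    also have "\<dots> \<le> (K * W + 1) * (\<delta> / (K * W + 1))" using KW by (intro mult_left_mono) (auto simp: \<eta>_def)
    finally show ?thesis using KW by simp
  qed
  show ?thesis
  proof (intro exI[of _ \<eta>] conjI \<eta> ballI allI impI)
    fix s f z assume s: "s \<in> {0<..1::real}" and f: "Sm f" and f0: "M f = (\<lambda>z. 0)"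
    define z' where "z' = z + s *\<^sub>R ax DT"
    define \<psi> where "\<psi> = G s f"
    have \<psi>: "Sm \<psi>" unfolding \<psi>_def by (rule Sm_G[OF f])
    have M0: "M \<psi> = (\<lambda>z. 0)" unfolding \<psi>_def using M_G[OF Sm_Cp[OF f]] f0 by simp
    have If: "I s f = (\<lambda>z. \<psi> (Sx s z))" by (simp add: I_def \<psi>_def fun_eq_iff)
    define e where "e w = M (\<lambda>y. (D w \<psi> y)\<^sup>2) z'" for w
    define N where "N w = Nn w \<psi> z'" for w
    have N0: "N w \<ge> 0" for w unfolding N_def by (rule Nn_nonneg)
    have C: "Cp (\<lambda>y. (D w \<psi> y)\<^sup>2)" "Cp (\<lambda>y. (pd a (D w \<psi>) y)\<^sup>2)" for w a
      by (intro Cp_power Sm_Cp Sm_D Sm_pd \<psi>)+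
    have poin: "e w \<le> N w" for w
      unfolding e_def N_def Nn_def
      by (rule poincare[OF Sm_D[OF \<psi>]]) (simp add: M_D_zero[OF \<psi> M0])
    have diss: "e w + \<sigma>\<^sup>2 * s * N w \<le> M (\<lambda>y. (D w f y)\<^sup>2) z'" for w
      using dissipation[OF Sm_D[OF f, of w], of s z'] s D_G[OF f, of w s]
      by (simp add: e_def N_def Nn_def \<psi>_def)
    have step: "M (\<lambda>y. (D w (I s f) y)\<^sup>2) z \<le> (1 + \<delta> * s) * e w + s * K * (\<Sum>u\<in>{u\<in>words m. length u < length w}. N u)"
      if w: "w \<in> words m" for w
    proof -
      let ?U = "{u\<in>words m. length u < length w}"
      let ?F = "\<lambda>y. (1 + \<delta> * s) * (D w \<psi> y)\<^sup>2 + s * K * (\<Sum>u\<in>?U. (pd DX (D u \<psi>) y)\<^sup>2 + (pd DY (D u \<psi>) y)\<^sup>2)"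
      have CF: "Cp ?F" by (intro Cp_add Cp_cmult Cp_sum C)
      have "M (\<lambda>y. (D w (I s f) y)\<^sup>2) z \<le> M (\<lambda>y. ?F (Sx s y)) z"
      proof (rule M_mono)
        show "Cp (\<lambda>y. (D w (I s f) y)\<^sup>2)" by (intro Cp_power Sm_Cp Sm_D Sm_I f)
        show "Cp (\<lambda>y. ?F (Sx s y))" by (rule admD(2)[OF adm_Sx CF])
        show "(D w (I s f) y)\<^sup>2 \<le> ?F (Sx s y)" for y
          unfolding If using Kw s \<psi> w by blast
      qed
      also have "\<dots> = M ?F z'" unfolding z'_def by (rule M_Sx[OF CF])
      also have "\<dots> = M (\<lambda>y. (1 + \<delta> * s) * (D w \<psi> y)\<^sup>2) z' + M (\<lambda>y. s * K * (\<Sum>u\<in>?U. (pd DX (D u \<psi>) y)\<^sup>2 + (pd DY (D u \<psi>) y)\<^sup>2)) z'"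
        by (intro M_add Cp_cmult Cp_sum Cp_add C)
      also have "\<dots> = (1 + \<delta> * s) * e w + s * K * M (\<lambda>y. \<Sum>u\<in>?U. (pd DX (D u \<psi>) y)\<^sup>2 + (pd DY (D u \<psi>) y)\<^sup>2) z'"
        unfolding M_cmult e_def ..
      also have "M (\<lambda>y. \<Sum>u\<in>?U. (pd DX (D u \<psi>) y)\<^sup>2 + (pd DY (D u \<psi>) y)\<^sup>2) z' = (\<Sum>u\<in>?U. N u)"
        unfolding N_def Nn_def using C(2) by (subst M_sum) (auto simp: M_add Cp_add)
      finally show ?thesis .
    qed
    have "En \<eta> m (I s f) z \<le> (\<Sum>w\<in>words m. \<eta> ^ length w * ((1 + \<delta> * s) * e w + s * K * (\<Sum>u\<in>{u\<in>words m. length u < length w}. N u)))"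
      unfolding En_def using \<eta> by (intro sum_mono mult_left_mono step) auto
    also have "\<dots> \<le> (\<Sum>w\<in>words m. \<eta> ^ length w * (e w + \<delta> * s * N w) + s * K * \<eta> * (\<Sum>u\<in>words m. \<eta> ^ length u * N u))"
    proof (rule sum_mono)
      fix w assume w: "w \<in> words m"
      have "\<delta> * s * e w \<le> \<delta> * s * N w" using \<delta> s poin by (intro mult_left_mono) auto
      then have 1: "\<eta> ^ length w * ((1 + \<delta> * s) * e w) \<le> \<eta> ^ length w * (e w + \<delta> * s * N w)"
        using \<eta> by (intro mult_left_mono) (auto simp: algebra_simps)
      \<comment> \<open>Each \<open>u\<close> is strictly shorter than \<open>w\<close>, so the
        weight of \<open>w\<close> is at most \<open>\<eta>\<close> times the weight of
        \<open>u\<close>.\<close>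
      have "\<eta> ^ length w * (\<Sum>u\<in>{u\<in>words m. length u < length w}. N u) = (\<Sum>u\<in>{u\<in>words m. length u < length w}. \<eta> ^ length w * N u)"
        by (rule sum_distrib_left)
      also have "\<dots> \<le> (\<Sum>u\<in>{u\<in>words m. length u < length w}. \<eta> ^ Suc (length u) * N u)"
        using \<eta> N0 by (intro sum_mono mult_right_mono power_decreasing) auto
      also have "\<dots> \<le> (\<Sum>u\<in>words m. \<eta> ^ Suc (length u) * N u)"
        using \<eta> N0 by (intro sum_mono2) auto
      also have "\<dots> = \<eta> * (\<Sum>u\<in>words m. \<eta> ^ length u * N u)"
        by (simp add: sum_distrib_left mult.assoc)
      finally have "s * K * (\<eta> ^ length w * (\<Sum>u\<in>{u\<in>words m. length u < length w}. N u)) \<le> s * K * (\<eta> * (\<Sum>u\<in>words m. \<eta> ^ length u * N u))"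
        using s K by (intro mult_left_mono) auto
      with 1 show "\<eta> ^ length w * ((1 + \<delta> * s) * e w + s * K * (\<Sum>u\<in>{u\<in>words m. length u < length w}. N u))
          \<le> \<eta> ^ length w * (e w + \<delta> * s * N w) + s * K * \<eta> * (\<Sum>u\<in>words m. \<eta> ^ length u * N u)"
        by (simp add: distrib_left mult_ac)
    qed
    also have "\<dots> = (\<Sum>w\<in>words m. \<eta> ^ length w * (e w + \<delta> * s * N w)) + s * (K * W * \<eta>) * (\<Sum>u\<in>words m. \<eta> ^ length u * N u)"
      by (simp add: sum.distrib W_def)
    also have "\<dots> \<le> (\<Sum>w\<in>words m. \<eta> ^ length w * (e w + \<delta> * s * N w)) + s * \<delta> * (\<Sum>u\<in>words m. \<eta> ^ length u * N u)"
      using s \<eta>K N0 \<eta> by (intro add_left_mono mult_right_mono mult_left_mono sum_nonneg) auto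
    also have "\<dots> = (\<Sum>w\<in>words m. \<eta> ^ length w * (e w + 2 * \<delta> * s * N w))"
      by (simp add: sum_distrib_left sum.distrib[symmetric] algebra_simps)
    finally have "(1 + rate * s) * En \<eta> m (I s f) z \<le> (1 + rate * s) * (\<Sum>w\<in>words m. \<eta> ^ length w * (e w + 2 * \<delta> * s * N w))"
      using rate_pos s by (intro mult_left_mono) auto
    also have "\<dots> = (\<Sum>w\<in>words m. \<eta> ^ length w * ((1 + rate * s) * (e w + 2 * \<delta> * s * N w)))"
      by (simp add: sum_distrib_left mult_ac)
    also have "\<dots> \<le> (\<Sum>w\<in>words m. \<eta> ^ length w * M (\<lambda>y. (D w f y)\<^sup>2) z')"
    proof (intro sum_mono mult_left_mono)
      fix w
      have r: "rate + 2 * \<delta> + rate * (2 * \<delta>) = \<sigma>\<^sup>2"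
      proof -
        have "2 + \<sigma>\<^sup>2 \<noteq> 0" by (smt (verit) zero_le_power2)
        then have "rate * (2 + \<sigma>\<^sup>2) = \<sigma>\<^sup>2" by (simp add: rate_def)
        then show ?thesis by (simp add: \<delta>_def algebra_simps)
      qed
      \<comment> \<open>Poincare's inequality turns \<open>rate * e w\<close> into dissipation, and
        \<open>s \<le> 1\<close> absorbs the term quadratic in \<open>s\<close>. The coefficients
        then add up to exactly \<open>\<sigma>\<^sup>2\<close>.\<close>
      have "(1 + rate * s) * (e w + 2 * \<delta> * s * N w) = e w + s * (rate * e w + 2 * \<delta> * N w + s * (rate * (2 * \<delta>) * N w))"
        by (simp add: algebra_simps)
      also have "\<dots> \<le> e w + s * (rate * N w + 2 * \<delta> * N w + 1 * (rate * (2 * \<delta>) * N w))"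
        using s rate_pos poin \<delta> N0 by (intro add_left_mono mult_left_mono add_mono mult_right_mono) auto
      also have "rate * N w + 2 * \<delta> * N w + 1 * (rate * (2 * \<delta>) * N w) = \<sigma>\<^sup>2 * N w"
        unfolding r[symmetric] by (simp add: algebra_simps)
      also have "e w + s * (\<sigma>\<^sup>2 * N w) \<le> M (\<lambda>y. (D w f y)\<^sup>2) z'" using diss[of w] by (simp add: mult_ac)
      finally show "(1 + rate * s) * (e w + 2 * \<delta> * s * N w) \<le> M (\<lambda>y. (D w f y)\<^sup>2) z'" .
    qed (use \<eta> in auto)
    also have "\<dots> = En \<eta> m f z'" by (simp add: En_def)
    finally show "(1 + rate * s) * En \<eta> m (I s f) z \<le> En \<eta> m f (z + s *\<^sub>R ax DT)" by (simp add: z'_def)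
  qed
qed

text \<open>The square root appears because energies are quadratic in \<open>f\<close> while
  \<open>bnd\<close> is linear.\<close>

definition q :: "real \<Rightarrow> real" where
  "q s = 1 / sqrt (1 + rate * s)"

text \<open>The last bound, obtained by rationalising, says that the geometric series is of order
  \<open>1 / s\<close>; the factor \<open>s\<close> in the discrete solution compensates it.\<close>

lemma q_bounds:
  assumes "s \<in> {0<..1}"
  shows "0 < q s" "q s < 1" "1 / (1 - q s) \<le> 2 * (1 + rate) / rate / s"
proof -
  define y where "y = sqrt (1 + rate * s)"
  have x: "rate * s > 0" "rate * s \<le> rate" using assms rate_pos by auto
  then have y: "y > 1" "y\<^sup>2 = 1 + rate * s" by (auto simp: y_def)
  have qy: "q s = 1 / y" by (simp add: q_def y_def)
  show "0 < q s" "q s < 1" using y by (auto simp: qy)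
  have "1 - q s = (y - 1) / y" using y by (simp add: qy field_simps)
  also have "\<dots> = (y\<^sup>2 - 1) / (y * (y + 1))"
  proof -
    have "y\<^sup>2 - 1 = (y - 1) * (y + 1)" by (simp add: power2_eq_square algebra_simps)
    then show ?thesis using y(1) by simp
  qed
  also have "\<dots> = rate * s / (y * (y + 1))" using y by simp
  finally have "1 / (1 - q s) = y * (y + 1) / (rate * s)" by simp
  also have "\<dots> \<le> 2 * (1 + rate) / (rate * s)"
  proof (rule divide_right_mono)
    have "y * (y + 1) \<le> y * (2 * y)" using y by (intro mult_left_mono) auto
    also have "\<dots> = 2 * (1 + rate * s)" using y by (simp add: power2_eq_square)
    finally show "y * (y + 1) \<le> 2 * (1 + rate)" using x by simp
  qed (use x in simp)
  finally show "1 / (1 - q s) \<le> 2 * (1 + rate) / rate / s" by simp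
qed

text \<open>The loss of two derivatives occurs once and not in every step: the iteration stays in
  one energy, and suprema are recovered only at the end.\<close>

lemma stability:
  "\<exists>C\<ge>0. \<forall>s\<in>{0<..1}. \<forall>f B n. Sm f \<longrightarrow> M f = (\<lambda>z. 0) \<longrightarrow> bnd (m + 2) f B \<longrightarrow>
     bnd m ((I s ^^ n) f) (C * B * q s ^ n)"
proof -
  obtain \<eta> where \<eta>: "0 < \<eta>" "\<eta> \<le> 1" and step: "\<forall>s\<in>{0<..1}. \<forall>f. Sm f \<longrightarrow> M f = (\<lambda>z. 0) \<longrightarrow>
     (\<forall>z. (1 + rate * s) * En \<eta> (m + 2) (I s f) z \<le> En \<eta> (m + 2) f (z + s *\<^sub>R ax DT))"
    using energy_step[of "m + 2"] by blast
  define C where "C = card (words m) * sqrt (4 * card (words (m + 2)) / \<eta> ^ (m + 2))"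
  show ?thesis
  proof (intro exI[of _ C] conjI ballI allI impI)
    show "C \<ge> 0" using \<eta> by (simp add: C_def)
    fix s f B n assume s: "s \<in> {0<..1::real}" and f: "Sm f" and f0: "M f = (\<lambda>z. 0)" and B: "bnd (m + 2) f B"
    have B0: "B \<ge> 0" using B by (rule bnd_nonneg)
    define E where "E = card (words (m + 2)) * B\<^sup>2"
    have p: "1 + rate * s > 0" using s rate_pos by (simp add: add_pos_pos)
    have En: "En \<eta> (m + 2) ((I s ^^ n) f) z \<le> E / (1 + rate * s) ^ n" for z n
    proof (induction n arbitrary: z)
      case 0
      then show ?case using En_le[OF f B] \<eta> by (simp add: E_def)
    next
      case (Suc n)
      have "(1 + rate * s) * En \<eta> (m + 2) (I s ((I s ^^ n) f)) z \<le> En \<eta> (m + 2) ((I s ^^ n) f) (z + s *\<^sub>R ax DT)"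
        using step[rule_format, OF s Sm_I_pow[OF f] M_I_pow_zero[OF f f0]] .
      also have "\<dots> \<le> E / (1 + rate * s) ^ n" by (rule Suc.IH)
      finally have "En \<eta> (m + 2) (I s ((I s ^^ n) f)) z \<le> E / (1 + rate * s) ^ n / (1 + rate * s)"
        using p by (subst pos_le_divide_eq) (auto simp: mult.commute)
      then show ?case by (simp add: mult.commute)
    qed
    show "bnd m ((I s ^^ n) f) (C * B * q s ^ n)"
      unfolding bnd_def
    proof
      fix z
      have "J m ((I s ^^ n) f) z \<le> card (words m) * sqrt (4 * (E / (1 + rate * s) ^ n) / \<eta> ^ (m + 2))"
        by (rule J_le_En[OF Sm_I_pow[OF f] \<eta> En])
      also have "4 * (E / (1 + rate * s) ^ n) / \<eta> ^ (m + 2) = (4 * card (words (m + 2)) / \<eta> ^ (m + 2)) * B\<^sup>2 * (1 / (1 + rate * s)) ^ n"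
        by (simp add: E_def power_one_over field_simps)
      also have "sqrt \<dots> = sqrt (4 * card (words (m + 2)) / \<eta> ^ (m + 2)) * B * q s ^ n"
        using B0 p by (simp add: real_sqrt_mult real_sqrt_power q_def real_sqrt_divide)
      finally show "J m ((I s ^^ n) f) z \<le> C * B * q s ^ n" by (simp add: C_def mult_ac)
    qed
  qed
qed

text \<open>The loss \<open>k\<close> can stay hidden, since the estimate will be applied to
  functions that are bounded in every order.\<close>

lemma consistent_I: "\<exists>k. consistent k I L"
proof -
  have T: "consistent 3 (\<lambda>s f z. f (shear DT (\<lambda>_. 1/2) s z)) (\<lambda>f z. 1/2 * pd DT f z)"
    by (rule consistent_shear) auto
  note c1 = consistent_gauss[of \<sigma> DX] and c2 = consistent_gauss[of \<sigma> DY]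
    and c3 = consistent_shear[OF b1, of DX] and c4 = consistent_shear[OF b2, of DY]
  note c = consistent_comp[OF T consistent_comp[OF c3 consistent_comp[OF c4 consistent_comp[OF T consistent_comp[OF c1 c2]]]]]
  have 1: "(\<lambda>f z. 1/2 * pd DT f z + (b1 z * pd DX f z + (b2 z * pd DY f z + (1/2 * pd DT f z +
      (\<sigma>\<^sup>2 / 2 * pd DX (pd DX f) z + \<sigma>\<^sup>2 / 2 * pd DY (pd DY f) z))))) = L"
    by (intro ext) (simp add: L_def algebra_simps)
  have 2: "(\<lambda>s f z. Ga (\<sigma> * sqrt s) DX (Ga (\<sigma> * sqrt s) DY f) (shear DT (\<lambda>_. 1/2) s (shear DY b2 s (shear DX b1 s (shear DT (\<lambda>_. 1/2) s z))))) = I"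
    by (intro ext) (simp add: I_def G_def Sx_def)
  show ?thesis using c unfolding 1 2 by blast
qed

end

section \<open>The discrete solutions and their limit\<close>

lemma bnd_limit:
  assumes "\<And>w z. (\<lambda>n. D w (F n) z) \<longlonglongrightarrow> D w f z" "\<And>n. bnd m (F n) (B n)" "B \<longlonglongrightarrow> b"
  shows "bnd m f b"
  unfolding bnd_def
proof
  fix z
  have "(\<lambda>n. J m (F n) z) \<longlonglongrightarrow> J m f z"
    unfolding J_def by (intro tendsto_sum tendsto_rabs assms)
  then show "J m f z \<le> b"
    by (rule LIMSEQ_le[OF _ assms(3)]) (use assms(2) in \<open>auto simp: bnd_def\<close>)
qed

lemma M_bound:
  assumes "Cp f" "\<And>z. \<bar>f z\<bar> \<le> B"
  shows "\<bar>M f z\<bar> \<le> B"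
  unfolding M_def using assms by (intro Av_bound Cp_Av prm_unif)

lemma M_limit_zero:
  assumes "\<And>n. Cp (F n)" "\<And>n. M (F n) = (\<lambda>z. 0)" "Cp f" "uniform_limit UNIV F f sequentially"
  shows "M f = (\<lambda>z. 0)"
proof
  fix z
  have "\<bar>M f z\<bar> \<le> 0 + e" if e: "e > 0" for e
  proof -
    have "\<forall>\<^sub>F n in sequentially. \<forall>x\<in>UNIV. dist (F n x) (f x) < e" by (rule uniform_limitD[OF assms(4) e])
    then obtain n where n: "\<And>x. dist (F n x) (f x) < e" unfolding eventually_sequentially by auto
    have "\<bar>M (\<lambda>z. f z - F n z) z\<bar> \<le> e"
    proof (rule M_bound)
      show "\<bar>f y - F n y\<bar> \<le> e" for y using n[of y] by (simp add: dist_real_def)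
    qed (intro Cp_diff assms)
    then show ?thesis using M_diff[OF assms(3) assms(1)[of n]] assms(2)[of n] by simp
  qed
  then have "\<bar>M f z\<bar> \<le> 0" by (rule field_le_epsilon)
  then show "M f z = 0" by simp
qed

lemma periodic_limit:
  assumes "\<And>n. periodic (F n)" "\<And>z. (\<lambda>n. F n z) \<longlonglongrightarrow> f z"
  shows "periodic f"
  unfolding periodic_def
proof (intro allI)
  fix z a
  have "(\<lambda>n. F n (z + ax a)) = (\<lambda>n. F n z)" using assms(1) by (auto simp: periodic_def)
  with assms(2)[of "z + ax a"] assms(2)[of z] show "f (z + ax a) = f z"
    using LIMSEQ_unique by metis
qed

locale mean_zero_scheme = scheme +
  assumes b1m: "M b1 = (\<lambda>z. 0)"
begin

text \<open>The source at the midpoint in time, written with the same half step as in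
  \<open>Sx\<close>.\<close>

definition h :: "real \<Rightarrow> pt \<Rightarrow> real" where
  "h s z = b1 (shear DT (\<lambda>_. 1/2) s z)"

definition ps :: "real \<Rightarrow> nat \<Rightarrow> pt \<Rightarrow> real" where
  "ps s n z = (\<Sum>i<n. s * (I s ^^ i) (h s) z)"

definition vh :: "real \<Rightarrow> pt \<Rightarrow> real" where
  "vh s z = (\<Sum>i. s * (I s ^^ i) (h s) z)"

lemma Sm_h: "Sm (h s)"
  unfolding h_def[abs_def] by (rule Sm_shear[OF b1 Sm_const])

lemma M_h: "M (h s) = (\<lambda>z. 0)"
  unfolding h_def[abs_def] by (rule ext) (simp add: M_translate b1m)

lemma bnd_h: "bnd m b1 B \<Longrightarrow> bnd m (h s) B"
  unfolding bnd_def h_def[abs_def] by (simp add: J_translate Sm_smooth[OF b1])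

lemma bnd_h_diff: "\<exists>C\<ge>0. \<forall>s\<in>{0<..1}. bnd m (\<lambda>z. h s z - b1 z) (C * s)"
proof -
  have "\<exists>C\<ge>0. \<forall>s\<in>{0..1}. \<forall>f B. Sm f \<longrightarrow> bnd (m + 2) f B \<longrightarrow> bnd m (\<lambda>z. f (shear DT (\<lambda>_. 1/2) s z) - f z) (C * s * B)"
    by (rule bnd_shear_diff) auto
  then obtain C where C: "C \<ge> 0" "\<forall>s\<in>{0..1}. \<forall>f B. Sm f \<longrightarrow> bnd (m + 2) f B \<longrightarrow> bnd m (\<lambda>z. f (shear DT (\<lambda>_. 1/2) s z) - f z) (C * s * B)"
    by blast
  obtain B where B: "B \<ge> 0" "bnd (m + 2) b1 B" using Sm_bnd[OF b1] by metis
  show ?thesis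
  proof (intro exI[of _ "C * B"] conjI ballI)
    fix s :: real assume "s \<in> {0<..1}"
    then have "bnd m (\<lambda>z. b1 (shear DT (\<lambda>_. 1/2) s z) - b1 z) (C * s * B)" using C(2) b1 B(2) by auto
    then show "bnd m (\<lambda>z. h s z - b1 z) (C * B * s)" by (simp add: h_def mult_ac)
  qed (use C B in simp)
qed

lemma I_add: "Sm f \<Longrightarrow> Sm g \<Longrightarrow> I s (\<lambda>z. f z + g z) = (\<lambda>z. I s f z + I s g z)"
  and I_cmult: "Sm f \<Longrightarrow> I s (\<lambda>z. c * f z) = (\<lambda>z. c * I s f z)"
proof -
  from consistent_I obtain k where k: "consistent k I L" ..
  show "Sm f \<Longrightarrow> Sm g \<Longrightarrow> I s (\<lambda>z. f z + g z) = (\<lambda>z. I s f z + I s g z)" by (rule consistentD(3)[OF k])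
  show "Sm f \<Longrightarrow> I s (\<lambda>z. c * f z) = (\<lambda>z. c * I s f z)" by (rule consistentD(4)[OF k])
qed

lemma I_diff: "Sm f \<Longrightarrow> Sm g \<Longrightarrow> I s (\<lambda>z. f z - g z) = (\<lambda>z. I s f z - I s g z)"
  using I_add[of f "\<lambda>z. -1 * g z" s] I_cmult[of g s "-1"] Sm_cmult[of g "-1"] by simp

lemma I_pow_diff: "Sm f \<Longrightarrow> Sm g \<Longrightarrow> (I s ^^ n) (\<lambda>z. f z - g z) = (\<lambda>z. (I s ^^ n) f z - (I s ^^ n) g z)"
  by (induction n) (auto simp: I_diff Sm_I_pow)

lemma I_pow_cmult: "Sm f \<Longrightarrow> (I s ^^ n) (\<lambda>z. c * f z) = (\<lambda>z. c * (I s ^^ n) f z)"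
  by (induction n) (auto simp: I_cmult Sm_I_pow)

lemma I_bound:
  assumes "Cp f" "\<And>z. \<bar>f z\<bar> \<le> B"
  shows "\<bar>I s f z\<bar> \<le> B"
  unfolding I_def G_def using assms by (intro Av_bound Cp_Av prm_gauss)

lemma Sm_ps: "Sm (ps s n)"
  unfolding ps_def[abs_def] by (intro Sm_sum Sm_cmult Sm_I_pow Sm_h)

lemma M_ps: "M (ps s n) = (\<lambda>z. 0)"
proof
  fix z
  have "M (ps s n) z = (\<Sum>i<n. M (\<lambda>z. s * (I s ^^ i) (h s) z) z)"
    unfolding ps_def[abs_def] by (intro M_sum Cp_cmult Sm_Cp Sm_I_pow Sm_h)
  then show "M (ps s n) z = 0" by (simp add: M_cmult M_I_pow_zero[OF Sm_h M_h])
qed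

lemma D_ps: "D w (ps s n) = (\<lambda>z. \<Sum>i<n. s * D w ((I s ^^ i) (h s)) z)"
proof -
  have sm: "smooth ((I s ^^ i) (h s))" for i by (intro Sm_smooth Sm_I_pow Sm_h)
  have "D w (ps s n) = (\<lambda>z. \<Sum>i<n. D w (\<lambda>z. s * (I s ^^ i) (h s) z) z)"
    unfolding ps_def[abs_def] by (intro D_sum smooth_cmult sm)
  then show ?thesis by (simp add: D_cmult[OF sm])
qed

text \<open>\<open>stability\<close> provides a geometric majorant for each derivative
  separately.\<close>

lemma ps_limit:
  assumes s: "s \<in> {0<..1}"
  shows "uniform_limit UNIV (\<lambda>n. D w (ps s n)) (\<lambda>z. \<Sum>i. s * D w ((I s ^^ i) (h s)) z) sequentially"
proof -
  from stability[of "length w"] obtain C where C: "C \<ge> 0" and st: "\<forall>s\<in>{0<..1}. \<forall>f B n. Sm f \<longrightarrow> M f = (\<lambda>z. 0) \<longrightarrow> bnd (length w + 2) f B \<longrightarrow>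
     bnd (length w) ((I s ^^ n) f) (C * B * q s ^ n)" by blast
  obtain B where B: "B \<ge> 0" "bnd (length w + 2) (h s) B" using Sm_bnd[OF Sm_h] by metis
  show ?thesis
    unfolding D_ps
  proof (rule Weierstrass_m_test)
    show "norm (s * D w ((I s ^^ i) (h s)) z) \<le> s * (C * B * q s ^ i)" for i z
    proof -
      have "bnd (length w) ((I s ^^ i) (h s)) (C * B * q s ^ i)" using st s Sm_h M_h B by blast
      then have "\<bar>D w ((I s ^^ i) (h s)) z\<bar> \<le> C * B * q s ^ i"
        using D_le_J[of w "length w" "(I s ^^ i) (h s)" z] bndD order_trans by blast
      then show ?thesis using s by (simp add: abs_mult mult_left_mono)
    qed
    show "summable (\<lambda>i. s * (C * B * q s ^ i))"
      using q_bounds[OF s] by (intro summable_mult summable_geometric) auto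
  qed
qed

lemma vh_smooth:
  assumes s: "s \<in> {0<..1}"
  shows "Sm (vh s)" "uniform_limit UNIV (\<lambda>n. D w (ps s n)) (D w (vh s)) sequentially" "M (vh s) = (\<lambda>z. 0)"
proof -
  let ?g = "\<lambda>w z. \<Sum>i. s * D w ((I s ^^ i) (h s)) z"
  have vh: "vh s = ?g []" by (simp add: vh_def fun_eq_iff)
  note l = smooth_limit[of "ps s" ?g, OF Sm_smooth[OF Sm_ps] ps_limit[OF s]]
  have D: "D w (vh s) = ?g w" for w unfolding vh by (rule l(2))
  show u: "uniform_limit UNIV (\<lambda>n. D w (ps s n)) (D w (vh s)) sequentially" for w
    unfolding D by (rule ps_limit[OF s])
  have "periodic (vh s)"
  proof (rule periodic_limit)
    show "periodic (ps s n)" for n using Sm_ps by (simp add: Sm_def)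
    show "(\<lambda>n. ps s n z) \<longlonglongrightarrow> vh s z" for z using tendsto_uniform_limitI[OF u[of "[]"], of z] by simp
  qed
  then show Sm: "Sm (vh s)" using l(1) by (simp add: Sm_def vh)
  show "M (vh s) = (\<lambda>z. 0)"
    by (rule M_limit_zero[OF Sm_Cp[OF Sm_ps] M_ps Sm_Cp[OF Sm]]) (use u[of "[]"] in simp)
qed

lemma vh_limit: "s \<in> {0<..1} \<Longrightarrow> (\<lambda>n. D w (ps s n) z) \<longlonglongrightarrow> D w (vh s) z"
  using tendsto_uniform_limitI[OF vh_smooth(2)] by simp

text \<open>Partial sums of the Neumann series: on mean zero functions the inverse of
  \<open>1 - I s\<close> is of size \<open>1 / s\<close>, so a residual of size
  \<open>s * \<epsilon>\<close> causes an error of size \<open>\<epsilon>\<close>.\<close>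

lemma sum_stability:
  "\<exists>C\<ge>0. \<forall>s\<in>{0<..1}. \<forall>f B n. Sm f \<longrightarrow> M f = (\<lambda>z. 0) \<longrightarrow> bnd (m + 2) f B \<longrightarrow>
     bnd m (\<lambda>z. \<Sum>i<n. (I s ^^ i) f z) (C * B / s)"
proof -
  from stability[of m] obtain C where C: "C \<ge> 0" and st: "\<forall>s\<in>{0<..1}. \<forall>f B n. Sm f \<longrightarrow> M f = (\<lambda>z. 0) \<longrightarrow> bnd (m + 2) f B \<longrightarrow>
     bnd m ((I s ^^ n) f) (C * B * q s ^ n)" by blast
  let ?K = "2 * (1 + rate) / rate"
  show ?thesis
  proof (intro exI[of _ "C * ?K"] conjI ballI allI impI)
    show "0 \<le> C * ?K" using C rate_pos by simp
    fix s f B n assume s: "s \<in> {0<..1::real}" and f: "Sm f" "M f = (\<lambda>z. 0)" and B: "bnd (m + 2) f B"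
    have "bnd m (\<lambda>z. \<Sum>i<n. (I s ^^ i) f z) (\<Sum>i<n. C * B * q s ^ i)"
    proof (rule bnd_sum)
      show "bnd m ((I s ^^ i) f) (C * B * q s ^ i)" for i using st s f B by blast
    qed (auto intro: Sm_smooth Sm_I_pow f)
    moreover have "(\<Sum>i<n. C * B * q s ^ i) \<le> C * ?K * B / s"
    proof -
      have q: "0 < q s" "q s < 1" "1 / (1 - q s) \<le> ?K / s" using q_bounds[OF s] by auto
      have "(\<Sum>i<n. q s ^ i) \<le> (\<Sum>i. q s ^ i)"
        using q by (intro sum_le_suminf summable_geometric) auto
      also have "\<dots> = 1 / (1 - q s)" using q by (intro suminf_geometric) auto
      finally have "C * B * (\<Sum>i<n. q s ^ i) \<le> C * B * (?K / s)"
        using q C bnd_nonneg[OF B] by (intro mult_left_mono) auto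
      then show ?thesis by (simp add: sum_distrib_left mult_ac)
    qed
    ultimately show "bnd m (\<lambda>z. \<Sum>i<n. (I s ^^ i) f z) (C * ?K * B / s)" by (auto intro: bnd_mono)
  qed
qed

text \<open>The factor \<open>s\<close> in front of the series cancels the \<open>1 / s\<close> of
  \<open>sum_stability\<close>, which makes the bound independent of the step size.\<close>

lemma bnd_vh: "\<exists>B\<ge>0. \<forall>s\<in>{0<..1}. bnd m (vh s) B"
proof -
  from sum_stability[of m] obtain C where C: "C \<ge> 0" and st: "\<forall>s\<in>{0<..1}. \<forall>f B n. Sm f \<longrightarrow> M f = (\<lambda>z. 0) \<longrightarrow> bnd (m + 2) f B \<longrightarrow>
     bnd m (\<lambda>z. \<Sum>i<n. (I s ^^ i) f z) (C * B / s)" by blast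
  obtain B where B: "B \<ge> 0" "bnd (m + 2) b1 B" using Sm_bnd[OF b1] by metis
  show ?thesis
  proof (intro exI[of _ "C * B"] conjI ballI)
    fix s :: real assume s: "s \<in> {0<..1}"
    have "bnd m (ps s n) (C * B)" for n
    proof -
      have 1: "bnd m (\<lambda>z. \<Sum>i<n. (I s ^^ i) (h s) z) (C * B / s)" using st s Sm_h M_h bnd_h[OF B(2)] by blast
      have 2: "smooth (\<lambda>z. \<Sum>i<n. (I s ^^ i) (h s) z)" by (intro smooth_sum Sm_smooth Sm_I_pow Sm_h)
      have "bnd m (\<lambda>z. s * (\<Sum>i<n. (I s ^^ i) (h s) z)) (\<bar>s\<bar> * (C * B / s))" by (rule bnd_cmult[OF 2 1])
      then show ?thesis using s by (simp add: ps_def[abs_def] sum_distrib_left)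
    qed
    then show "bnd m (vh s) (C * B)" by (rule bnd_limit[OF vh_limit[OF s]]) auto
  qed (use C B in simp)
qed

text \<open>\<open>I s\<close> may be applied to the limit of the partial sums because it is a
  contraction in the supremum norm.\<close>

lemma vh_fixpoint:
  assumes s: "s \<in> {0<..1}"
  shows "I s (vh s) z = vh s z - s * h s z"
proof -
  have u: "uniform_limit UNIV (ps s) (vh s) sequentially" using vh_smooth(2)[OF s, of "[]"] by simp
  have "(\<lambda>n. I s (ps s n) z) \<longlonglongrightarrow> I s (vh s) z"
  proof (rule LIMSEQ_I)
    fix r :: real assume r: "r > 0"
    then have "\<forall>\<^sub>F n in sequentially. \<forall>x\<in>UNIV. dist (ps s n x) (vh s x) < r / 2" by (intro uniform_limitD[OF u]) simp
    then obtain N where N: "\<And>n x. n \<ge> N \<Longrightarrow> dist (ps s n x) (vh s x) < r / 2" unfolding eventually_sequentially by auto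
    have "norm (I s (ps s n) z - I s (vh s) z) < r" if n: "n \<ge> N" for n
    proof -
      have "\<bar>I s (\<lambda>z. ps s n z - vh s z) z\<bar> \<le> r / 2"
      proof (rule I_bound)
        show "Cp (\<lambda>z. ps s n z - vh s z)" by (intro Cp_diff Sm_Cp Sm_ps vh_smooth s)
        show "\<bar>ps s n y - vh s y\<bar> \<le> r / 2" for y using N[OF n, of y] by (simp add: dist_real_def)
      qed
      then show ?thesis using I_diff[OF Sm_ps vh_smooth(1)[OF s]] r by simp
    qed
    then show "\<exists>N. \<forall>n\<ge>N. norm (I s (ps s n) z - I s (vh s) z) < r" by blast
  qed
  \<comment> \<open>Applying \<open>I s\<close> shifts the index of the summands, so only the first
    summand is missing.\<close>
  moreover have "I s (ps s n) z = ps s (Suc n) z - s * h s z" for n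
  proof (induction n)
    case 0
    have "I s (\<lambda>z. 0 * h s z) = (\<lambda>z. 0 * I s (h s) z)" by (rule I_cmult[OF Sm_h])
    then show ?case by (simp add: ps_def[abs_def] fun_eq_iff)
  next
    case (Suc n)
    have 1: "Sm (\<lambda>z. s * (I s ^^ n) (h s) z)" by (intro Sm_cmult Sm_I_pow Sm_h)
    have "ps s (Suc n) = (\<lambda>z. ps s n z + s * (I s ^^ n) (h s) z)" by (simp add: ps_def[abs_def])
    then have "I s (ps s (Suc n)) z = I s (ps s n) z + s * I s ((I s ^^ n) (h s)) z"
      using I_add[OF Sm_ps 1] I_cmult[OF Sm_I_pow[OF Sm_h]] by simp
    moreover have "ps s (Suc (Suc n)) z = ps s (Suc n) z + s * I s ((I s ^^ n) (h s)) z" by (simp add: ps_def)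
    ultimately show ?case using Suc by simp
  qed
  moreover have "(\<lambda>n. ps s (Suc n) z - s * h s z) \<longlonglongrightarrow> vh s z - s * h s z"
    using LIMSEQ_Suc[OF vh_limit[OF s, of "[]" z]] by (intro tendsto_diff tendsto_const) simp
  ultimately show ?thesis using LIMSEQ_unique by simp
qed

lemma Sm_L: "Sm f \<Longrightarrow> Sm (L f)"
proof -
  from consistent_I obtain k where k: "consistent k I L" ..
  show "Sm f \<Longrightarrow> Sm (L f)" by (rule consistentD(1)[OF k])
qed

text \<open>The fixed point equation replaces \<open>I s (vh s) - vh s\<close> by
  \<open>- s * h s\<close>, so dividing the consistency estimate by \<open>s\<close> leaves order
  \<open>s\<close>. The uniform bounds on \<open>vh s\<close> in every order pay for the lost
  derivatives.\<close>

lemma L_vh: "\<exists>C\<ge>0. \<forall>s\<in>{0<..1}. bnd m (\<lambda>z. L (vh s) z + h s z) (C * s)"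
proof -
  from consistent_I obtain k where k: "consistent k I L" ..
  from consistentD(5)[OF k] obtain C where C: "consistent_bound k I L m C" ..
  obtain B where B: "B \<ge> 0" "\<forall>s\<in>{0<..1}. bnd (m + k) (vh s) B" using bnd_vh by blast
  show ?thesis
  proof (intro exI[of _ "C * B"] conjI ballI)
    show "0 \<le> C * B" using B consistent_boundD(1)[OF C] by simp
    fix s :: real assume s: "s \<in> {0<..1}"
    have "bnd m (\<lambda>z. I s (vh s) z - vh s z - s * L (vh s) z) (C * s\<^sup>2 * B)"
      using s B by (intro consistent_boundD(4)[OF C] vh_smooth) auto
    then have "bnd m (\<lambda>z. - (1 / s) * (I s (vh s) z - vh s z - s * L (vh s) z)) (\<bar>- (1 / s)\<bar> * (C * s\<^sup>2 * B))"
      by (intro bnd_cmult smooth_diff smooth_cmult Sm_smooth Sm_I Sm_L vh_smooth s)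
    moreover have "(\<lambda>z. - (1 / s) * (I s (vh s) z - vh s z - s * L (vh s) z)) = (\<lambda>z. L (vh s) z + h s z)"
      using s by (auto simp: vh_fixpoint[OF s] field_simps)
    moreover have "\<bar>- (1 / s)\<bar> * (C * s\<^sup>2 * B) = C * B * s" using s by (simp add: power2_eq_square)
    ultimately show "bnd m (\<lambda>z. L (vh s) z + h s z) (C * B * s)" by simp
  qed
qed

text \<open>The summand is built from the residual of \<open>u\<close> in the discrete problem. For
  mean zero \<open>u\<close> the right side tends to \<open>u - vh s\<close>, so the sum represents
  the distance of \<open>u\<close> from the discrete solution.\<close>

lemma sum_telescope:
  assumes s: "s \<in> {0<..1}" and u: "Sm u"
  shows "(\<Sum>i<n. (I s ^^ i) (\<lambda>z. (u z - I s u z) - s * h s z) z) = u z - (I s ^^ n) u z - ps s n z"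
proof (induction n)
  case 0
  then show ?case by (simp add: ps_def)
next
  case (Suc n)
  have "(I s ^^ n) (\<lambda>z. (u z - I s u z) - s * h s z) z = (I s ^^ n) u z - (I s ^^ n) (I s u) z - s * (I s ^^ n) (h s) z"
    using I_pow_diff[OF Sm_diff[OF u Sm_I[OF u]] Sm_cmult[OF Sm_h]] I_pow_diff[OF u Sm_I[OF u]] I_pow_cmult[OF Sm_h]
    by simp
  moreover have "(I s ^^ n) (I s u) = (I s ^^ Suc n) u" by (simp add: funpow_swap1)
  ultimately show ?case using Suc by (simp add: ps_def)
qed

text \<open>\<open>vh s\<close> is inserted into the discrete problem with step \<open>t\<close>.
  Its residual is of order \<open>t * (s + t)\<close>, and \<open>sum_stability\<close> for the step
  \<open>t\<close> removes the factor \<open>t\<close>.\<close>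

lemma vh_cauchy:
  "\<exists>C\<ge>0. \<forall>s\<in>{0<..1}. \<forall>t\<in>{0<..1}. bnd m (\<lambda>z. vh s z - vh t z) (C * (s + t))"
proof -
  from consistent_I obtain k where k: "consistent k I L" ..
  from consistentD(5)[OF k] obtain C1 where C1: "consistent_bound k I L (m + 2) C1" ..
  obtain B where B: "B \<ge> 0" "\<forall>s\<in>{0<..1}. bnd (m + 2 + k) (vh s) B" using bnd_vh by blast
  obtain C2 where C2: "C2 \<ge> 0" "\<forall>s\<in>{0<..1}. bnd (m + 2) (\<lambda>z. L (vh s) z + h s z) (C2 * s)" using L_vh by blast
  obtain C3 where C3: "C3 \<ge> 0" "\<forall>s\<in>{0<..1}. bnd (m + 2) (\<lambda>z. h s z - b1 z) (C3 * s)" using bnd_h_diff by blast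
  from sum_stability[of m] obtain C4 where C4: "C4 \<ge> 0" and st: "\<forall>s\<in>{0<..1}. \<forall>f B n. Sm f \<longrightarrow> M f = (\<lambda>z. 0) \<longrightarrow> bnd (m + 2) f B \<longrightarrow>
     bnd m (\<lambda>z. \<Sum>i<n. (I s ^^ i) f z) (C4 * B / s)" by blast
  have C10: "C1 \<ge> 0" by (rule consistent_boundD(1)[OF C1])
  let ?K = "C1 * B + C2 + C3"
  show ?thesis
  proof (intro exI[of _ "C4 * ?K"] conjI ballI)
    show "0 \<le> C4 * ?K" using C10 B C2 C3 C4 by simp
    fix s t :: real assume s: "s \<in> {0<..1}" and t: "t \<in> {0<..1}"
    let ?u = "vh s"
    let ?r = "\<lambda>z. (?u z - I t ?u z) - t * h t z"
    note u = vh_smooth(1)[OF s]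
    have Cu: "Cp ?u" "Cp (I t ?u)" "Cp (h t)" using u Sm_h by (auto intro: Sm_Cp Sm_I)
    have r: "Sm ?r" by (intro Sm_diff u Sm_I Sm_cmult Sm_h)
    have Mr: "M ?r = (\<lambda>z. 0)"
    proof
      fix z
      have "M ?r z = M (\<lambda>z. ?u z - I t ?u z) z - M (\<lambda>z. t * h t z) z" by (intro M_diff Cp_diff Cp_cmult Cu)
      also have "\<dots> = M ?u z - M (I t ?u) z - t * M (h t) z" using Cu by (simp add: M_diff M_cmult)
      finally show "M ?r z = 0" using M_I_zero[OF Cu(1) vh_smooth(3)[OF s]] vh_smooth(3)[OF s] M_h by simp
    qed
    have smx: "smooth (\<lambda>z. I t ?u z - ?u z - t * L ?u z)" "smooth (\<lambda>z. L ?u z + h s z)"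
       "smooth (\<lambda>z. h s z - b1 z)" "smooth (\<lambda>z. h t z - b1 z)"
      by (intro smooth_diff smooth_add smooth_cmult Sm_smooth Sm_I Sm_L Sm_h u b1)+
    \<comment> \<open>The residual has three sources: the consistency error of \<open>I t\<close>,
      the defect of \<open>vh s\<close> in the continuous equation, and the different midpoints in
      \<open>h s\<close> and \<open>h t\<close>.\<close>
    have "bnd (m + 2) (\<lambda>z. (- 1 * (I t ?u z - ?u z - t * L ?u z) - t * (L ?u z + h s z)) + t * ((h s z - b1 z) - (h t z - b1 z)))
       ((\<bar>-1\<bar> * (C1 * t\<^sup>2 * B) + \<bar>t\<bar> * (C2 * s)) + \<bar>t\<bar> * (C3 * s + C3 * t))"
    proof -
      have 1: "bnd (m + 2) (\<lambda>z. I t ?u z - ?u z - t * L ?u z) (C1 * t\<^sup>2 * B)"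
        using t B s by (intro consistent_boundD(4)[OF C1] u) auto
      have 2: "bnd (m + 2) (\<lambda>z. L ?u z + h s z) (C2 * s)" using C2 s by blast
      have 3: "bnd (m + 2) (\<lambda>z. h s z - b1 z) (C3 * s)" "bnd (m + 2) (\<lambda>z. h t z - b1 z) (C3 * t)" using C3 s t by blast+
      show ?thesis
        by (rule bnd_add[OF smooth_diff[OF smooth_cmult[OF smx(1)] smooth_cmult[OF smx(2)]] smooth_cmult[OF smooth_diff[OF smx(3,4)]]
              bnd_diff[OF smooth_cmult[OF smx(1)] smooth_cmult[OF smx(2)] bnd_cmult[OF smx(1) 1] bnd_cmult[OF smx(2) 2]]
              bnd_cmult[OF smooth_diff[OF smx(3,4)] bnd_diff[OF smx(3,4) 3]]])
    qed
    moreover have "(\<lambda>z. (- 1 * (I t ?u z - ?u z - t * L ?u z) - t * (L ?u z + h s z)) + t * ((h s z - b1 z) - (h t z - b1 z))) = ?r"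
      by (auto simp: algebra_simps)
    ultimately have "bnd (m + 2) ?r ((\<bar>-1\<bar> * (C1 * t\<^sup>2 * B) + \<bar>t\<bar> * (C2 * s)) + \<bar>t\<bar> * (C3 * s + C3 * t))" by simp
    moreover have "(\<bar>-1\<bar> * (C1 * t\<^sup>2 * B) + \<bar>t\<bar> * (C2 * s)) + \<bar>t\<bar> * (C3 * s + C3 * t) \<le> ?K * (s + t) * t"
    proof -
      have "0 \<le> C1 * B * s * t + C2 * t * t" using s t C10 B C2 by (intro add_nonneg_nonneg mult_nonneg_nonneg) auto
      then show ?thesis using t by (simp add: algebra_simps power2_eq_square)
    qed
    ultimately have rb: "bnd (m + 2) ?r (?K * (s + t) * t)" by (auto intro: bnd_mono)
    have Fb: "bnd m (\<lambda>z. \<Sum>i<n. (I t ^^ i) ?r z) (C4 * ?K * (s + t))" for n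
    proof -
      have "bnd m (\<lambda>z. \<Sum>i<n. (I t ^^ i) ?r z) (C4 * (?K * (s + t) * t) / t)" using st t r Mr rb by blast
      then show ?thesis using t by (simp add: mult.assoc)
    qed
    have F: "(\<lambda>z. \<Sum>i<n. (I t ^^ i) ?r z) = (\<lambda>z. (?u z - (I t ^^ n) ?u z) - ps t n z)" for n
      by (rule ext) (rule sum_telescope[OF t u])
    \<comment> \<open>The bound on the sums is uniform in \<open>n\<close>. In the limit
      \<open>(I t ^^ n) ?u\<close> dies out by \<open>stability\<close>, and \<open>ps t n\<close>
      tends to \<open>vh t\<close>.\<close>
    show "bnd m (\<lambda>z. vh s z - vh t z) (C4 * ?K * (s + t))"
    proof (rule bnd_limit[where F = "\<lambda>n z. (?u z - (I t ^^ n) ?u z) - ps t n z" and B = "\<lambda>n. C4 * ?K * (s + t)"])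
      show "bnd m (\<lambda>z. (?u z - (I t ^^ n) ?u z) - ps t n z) (C4 * ?K * (s + t))" for n
        using Fb[of n] unfolding F .
      fix w z
      have sm: "smooth ?u" "smooth ((I t ^^ n) ?u)" "smooth (ps t n)" "smooth (vh t)" for n
        by (intro Sm_smooth u Sm_I_pow Sm_ps vh_smooth t)+
      have "(\<lambda>n. D w ((I t ^^ n) ?u) z) \<longlonglongrightarrow> 0"
      proof -
        from stability[of "length w"] obtain C6 where "C6 \<ge> 0" and st6: "\<forall>s\<in>{0<..1}. \<forall>f B n. Sm f \<longrightarrow> M f = (\<lambda>z. 0) \<longrightarrow> bnd (length w + 2) f B \<longrightarrow>
          bnd (length w) ((I s ^^ n) f) (C6 * B * q s ^ n)" by blast
        obtain B6 where B6: "B6 \<ge> 0" "bnd (length w + 2) ?u B6" using Sm_bnd[OF u] by metis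
        show ?thesis
        proof (rule Lim_null_comparison[where g = "\<lambda>n. C6 * B6 * q t ^ n"])
          show "(\<lambda>n. C6 * B6 * q t ^ n) \<longlonglongrightarrow> 0"
            using q_bounds[OF t] by (intro tendsto_mult_right_zero LIMSEQ_power_zero) auto
          show "\<forall>\<^sub>F n in sequentially. norm (D w ((I t ^^ n) ?u) z) \<le> C6 * B6 * q t ^ n"
          proof (intro always_eventually allI)
            fix n
            have "bnd (length w) ((I t ^^ n) ?u) (C6 * B6 * q t ^ n)" using st6 t u vh_smooth(3)[OF s] B6 by blast
            then show "norm (D w ((I t ^^ n) ?u) z) \<le> C6 * B6 * q t ^ n"
              using D_le_J[of w "length w" "(I t ^^ n) ?u" z] bndD[of "length w" "(I t ^^ n) ?u" "C6 * B6 * q t ^ n" z] by simp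
          qed
        qed
      qed
      then have "(\<lambda>n. D w ?u z - D w ((I t ^^ n) ?u) z - D w (ps t n) z) \<longlonglongrightarrow> D w ?u z - 0 - D w (vh t) z"
        by (intro tendsto_diff tendsto_const vh_limit t)
      moreover have "D w (\<lambda>z. (?u z - (I t ^^ n) ?u z) - ps t n z) = (\<lambda>z. D w ?u z - D w ((I t ^^ n) ?u) z - D w (ps t n) z)" for n
        using D_diff[OF smooth_diff[OF sm(1) sm(2)] sm(3)] D_diff[OF sm(1) sm(2)] by simp
      moreover have "D w (\<lambda>z. ?u z - vh t z) = (\<lambda>z. D w ?u z - D w (vh t) z)" by (rule D_diff[OF sm(1) sm(4)])
      ultimately show "(\<lambda>n. D w (\<lambda>z. (?u z - (I t ^^ n) ?u z) - ps t n z) z) \<longlonglongrightarrow> D w (\<lambda>z. ?u z - vh t z) z" by simp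
    qed simp
  qed
qed

theorem limit_solution:
  "\<exists>V. Sm V \<and> M V = (\<lambda>z. 0) \<and> (\<forall>z. L V z = - b1 z) \<and>
     (\<forall>m. \<exists>C\<ge>0. \<forall>s\<in>{0<..1}. bnd m (\<lambda>z. V z - vh s z) (C * s))"
proof -
  \<comment> \<open>Any null sequence of admissible step sizes would serve.\<close>
  define sq where "sq n = 1 / real (Suc n)" for n
  have sq: "sq n \<in> {0<..1}" for n by (simp add: sq_def)
  have sq0: "sq \<longlonglongrightarrow> 0" unfolding sq_def using LIMSEQ_inverse_real_of_nat by (simp add: inverse_eq_divide)
  define F where "F n = vh (sq n)" for n
  have Sm_F: "Sm (F n)" and M_F: "M (F n) = (\<lambda>z. 0)" for n using vh_smooth[OF sq] by (auto simp: F_def)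
  have "\<exists>g. uniform_limit UNIV (\<lambda>n. D w (F n)) g sequentially" for w
  proof -
    obtain C where C: "C \<ge> 0" "\<forall>s\<in>{0<..1}. \<forall>t\<in>{0<..1}. bnd (length w) (\<lambda>z. vh s z - vh t z) (C * (s + t))"
      using vh_cauchy by blast
    have d: "\<bar>D w (F n) z - D w (F n') z\<bar> \<le> C * (sq n + sq n')" for n n' z
    proof -
      have "D w (F n) z - D w (F n') z = D w (\<lambda>z. F n z - F n' z) z"
        using D_diff[OF Sm_smooth[OF Sm_F] Sm_smooth[OF Sm_F]] by simp
      also have "\<bar>\<dots>\<bar> \<le> J (length w) (\<lambda>z. F n z - F n' z) z" by (rule D_le_J) simp
      also have "\<dots> \<le> C * (sq n + sq n')" using C(2) sq unfolding F_def by (intro bndD) blast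
      finally show ?thesis .
    qed
    have "uniformly_Cauchy_on UNIV (\<lambda>n. D w (F n))"
      unfolding uniformly_Cauchy_on_def
    proof (intro allI impI)
      fix e :: real assume e: "e > 0"
      then have "e / (2 * (C + 1)) > 0" using C by simp
      from order_tendstoD(2)[OF sq0 this] obtain N where N: "\<And>n. n \<ge> N \<Longrightarrow> sq n < e / (2 * (C + 1))"
        unfolding eventually_sequentially by auto
      have "dist (D w (F m) x) (D w (F n) x) < e" if "m \<ge> N" "n \<ge> N" for m n x
      proof -
        have "dist (D w (F m) x) (D w (F n) x) \<le> C * (sq m + sq n)" using d by (simp add: dist_real_def)
        also have "\<dots> \<le> (C + 1) * (sq m + sq n)" using sq[of m] sq[of n] by (intro mult_right_mono) auto
        also have "\<dots> < (C + 1) * (e / (2 * (C + 1)) + e / (2 * (C + 1)))"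
          using C N that by (intro mult_strict_left_mono add_strict_mono) auto
        also have "\<dots> = e"
        proof -
          have "k * (e / (2 * k) + e / (2 * k)) = e" if "k \<noteq> 0" for k :: real using that by simp
          from this[of "C + 1"] show ?thesis using C by simp
        qed
        finally show ?thesis .
      qed
      then show "\<exists>N. \<forall>x\<in>UNIV. \<forall>m\<ge>N. \<forall>n\<ge>N. dist (D w (F m) x) (D w (F n) x) < e" by blast
    qed
    then have "uniformly_convergent_on UNIV (\<lambda>n. D w (F n))" by (rule Cauchy_uniformly_convergent)
    then show ?thesis unfolding uniformly_convergent_on_def by blast
  qed
  then obtain g where g: "\<And>w. uniform_limit UNIV (\<lambda>n. D w (F n)) (g w) sequentially" by metis
  define V where "V = g []"
  have smV: "smooth V" and DV: "D w V = g w" for w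
    unfolding V_def using smooth_limit[of F g, OF Sm_smooth[OF Sm_F] g] by auto
  have lim: "(\<lambda>n. D w (F n) z) \<longlonglongrightarrow> D w V z" for w z
    unfolding DV using tendsto_uniform_limitI[OF g] by simp
  have lim0: "(\<lambda>n. F n z) \<longlonglongrightarrow> V z" for z using lim[of "[]"] by simp
  have SmV: "Sm V"
    unfolding Sm_def using smV periodic_limit[of F V] Sm_F lim0 by (auto simp: Sm_def)
  have MV: "M V = (\<lambda>z. 0)"
    by (rule M_limit_zero[of F, OF Sm_Cp[OF Sm_F] M_F Sm_Cp[OF SmV]]) (use g[of "[]"] in \<open>simp add: V_def\<close>)
  have LV: "L V z = - b1 z" for z
  proof -
    \<comment> \<open>\<open>L\<close> involves words of length at most two only, so it inherits the
      convergence of derivatives.\<close>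
    have "(\<lambda>n. L (F n) z) \<longlonglongrightarrow> L V z"
      unfolding L_def using lim[of "[DT]" z] lim[of "[DX]" z] lim[of "[DY]" z] lim[of "[DX,DX]" z] lim[of "[DY,DY]" z]
      by (intro tendsto_intros) auto
    moreover have "(\<lambda>n. h (sq n) z) \<longlonglongrightarrow> b1 z"
    proof -
      obtain C where C: "C \<ge> 0" "\<forall>s\<in>{0<..1}. bnd 0 (\<lambda>z. h s z - b1 z) (C * s)" using bnd_h_diff by blast
      have "(\<lambda>n. h (sq n) z - b1 z) \<longlonglongrightarrow> 0"
      proof (rule Lim_null_comparison[where g = "\<lambda>n. C * sq n"])
        show "(\<lambda>n. C * sq n) \<longlonglongrightarrow> 0" using sq0 by (intro tendsto_mult_right_zero)
        have "bnd 0 (\<lambda>z. h (sq n) z - b1 z) (C * sq n)" for n using C(2) sq[of n] by blast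
        then show "\<forall>\<^sub>F n in sequentially. norm (h (sq n) z - b1 z) \<le> C * sq n"
          by (intro always_eventually allI) (auto simp: bnd_def J_0)
      qed
      then show ?thesis by (rule LIM_zero_cancel)
    qed
    moreover have "(\<lambda>n. L (F n) z + h (sq n) z) \<longlonglongrightarrow> 0"
    proof -
      obtain C where C: "C \<ge> 0" "\<forall>s\<in>{0<..1}. bnd 0 (\<lambda>z. L (vh s) z + h s z) (C * s)" using L_vh by blast
      show ?thesis
      proof (rule Lim_null_comparison[where g = "\<lambda>n. C * sq n"])
        show "(\<lambda>n. C * sq n) \<longlonglongrightarrow> 0" using sq0 by (intro tendsto_mult_right_zero)
        have "bnd 0 (\<lambda>z. L (vh (sq n)) z + h (sq n) z) (C * sq n)" for n using C(2) sq[of n] by blast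
        then show "\<forall>\<^sub>F n in sequentially. norm (L (F n) z + h (sq n) z) \<le> C * sq n"
          by (intro always_eventually allI) (auto simp: bnd_def J_0 F_def)
      qed
    qed
    ultimately have "L V z + b1 z = 0" using tendsto_add LIMSEQ_unique by blast
    then show ?thesis by simp
  qed
  have "\<exists>C\<ge>0. \<forall>s\<in>{0<..1}. bnd m (\<lambda>z. V z - vh s z) (C * s)" for m
  proof -
    obtain C where C: "C \<ge> 0" "\<forall>s\<in>{0<..1}. \<forall>t\<in>{0<..1}. bnd m (\<lambda>z. vh s z - vh t z) (C * (s + t))"
      using vh_cauchy by blast
    \<comment> \<open>In \<open>vh_cauchy\<close> one step size is kept and the other tends to zero,
      which reduces the sum of the two to \<open>s\<close>.\<close>
    have "bnd m (\<lambda>z. V z - vh s z) (C * s)" if s: "s \<in> {0<..1}" for s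
    proof (rule bnd_limit[where F = "\<lambda>n z. F n z - vh s z" and B = "\<lambda>n. C * (sq n + s)"])
      note sv = Sm_smooth[OF vh_smooth(1)[OF s]]
      show "(\<lambda>n. D w (\<lambda>z. F n z - vh s z) z) \<longlonglongrightarrow> D w (\<lambda>z. V z - vh s z) z" for w z
        unfolding D_diff[OF Sm_smooth[OF Sm_F] sv] D_diff[OF smV sv] by (intro tendsto_diff lim tendsto_const)
      show "bnd m (\<lambda>z. F n z - vh s z) (C * (sq n + s))" for n unfolding F_def using C(2) sq s by blast
      have "(\<lambda>n. C * (sq n + s)) \<longlonglongrightarrow> C * (0 + s)" by (intro tendsto_intros sq0)
      then show "(\<lambda>n. C * (sq n + s)) \<longlonglongrightarrow> C * s" by simp
    qed
    then show ?thesis using C(1) by blast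
  qed
  then show ?thesis using SmV MV LV by blast
qed

end

section \<open>Uniqueness and the error in the Hoelder norm\<close>

text \<open>\<open>smooth2\<close> provides derivatives in the second argument only as long as none
  has been taken in the first. The others come from \<open>mixed_partials\<close>, by induction over
  \<open>k\<close>.\<close>

lemma smooth2_derivatives:
  assumes g: "smooth2 g"
  shows "((\<lambda>s. Dv k j g s b) has_real_derivative Dv (Suc k) j g a b) (at a)"
    and "((\<lambda>s. Dv k j g a s) has_real_derivative Dv k (Suc j) g a b) (at b)"
    and "continuous_on UNIV (\<lambda>p::real\<times>real. Dv k j g (fst p) (snd p))"
proof -
  have A: "((\<lambda>s. Dv k j g s b) has_real_derivative Dv (Suc k) j g a b) (at a)" for k j a b
  proof -
    have "(\<lambda>s. Dv k j g s b) differentiable (at a)" using g by (simp add: smooth2_def)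
    then have "((\<lambda>s. Dv k j g s b) has_real_derivative deriv (\<lambda>s. Dv k j g s b) a) (at a)"
      by (simp add: DERIV_deriv_iff_real_differentiable)
    then show ?thesis by (simp add: Dv_def dA_def)
  qed
  have C: "continuous_on UNIV (\<lambda>p::real\<times>real. Dv k j g (fst p) (snd p))" for k j
    using g by (simp add: smooth2_def)
  have C1: "continuous_on UNIV (Dv k j g a)" for k j a
    using continuous_on_compose2[OF C[of k j], of UNIV "\<lambda>y. (a, y)"] by (simp add: continuous_intros)
  have B: "((\<lambda>s. Dv k j g a s) has_real_derivative Dv k (Suc j) g a b) (at b)" for a b
  proof (induction k arbitrary: j a b)
    case 0
    have "(\<lambda>s. (dB ^^ j) g a s) differentiable (at b)" using g by (simp add: smooth2_def)
    then have "((\<lambda>s. (dB ^^ j) g a s) has_real_derivative deriv (\<lambda>s. (dB ^^ j) g a s) b) (at b)"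
      by (simp add: DERIV_deriv_iff_real_differentiable)
    then show ?case by (simp add: Dv_def dB_def)
  next
    case (Suc k)
    show ?case by (rule mixed_partials[OF A Suc.IH A C1 C])
  qed
  show "((\<lambda>s. Dv k j g s b) has_real_derivative Dv (Suc k) j g a b) (at a)"
    "((\<lambda>s. Dv k j g a s) has_real_derivative Dv k (Suc j) g a b) (at b)"
    "continuous_on UNIV (\<lambda>p::real\<times>real. Dv k j g (fst p) (snd p))"
    by (rule A B C)+
qed

text \<open>Continuity of the partials upgrades them to a total derivative, which \<open>pd\<close>
  is based on.\<close>

lemma smooth2_has_derivative:
  assumes g: "smooth2 g"
  shows "((\<lambda>p. Dv k j g (fst p) (snd p)) has_derivative
     (\<lambda>h. Dv (Suc k) j g a b * fst h + Dv k (Suc j) g a b * snd h)) (at (a, b))"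
proof -
  note d = smooth2_derivatives[OF g]
  have "((\<lambda>(x, y). Dv k j g x y) has_derivative
      (\<lambda>(tx, ty). Dv (Suc k) j g a b * tx + blinfun_apply (blinfun_mult_right (Dv k (Suc j) g a b)) ty)) (at (a, b) within UNIV \<times> UNIV)"
  proof (rule has_derivative_partialsI[where fy = "\<lambda>x y. blinfun_mult_right (Dv k (Suc j) g x y)"])
    show "((\<lambda>x. Dv k j g x b) has_derivative (*) (Dv (Suc k) j g a b)) (at a within UNIV)"
      using d(1)[of k j b a] by (simp add: has_field_derivative_def)
    show "((\<lambda>y. Dv k j g x y) has_derivative blinfun_apply (blinfun_mult_right (Dv k (Suc j) g x y))) (at y within UNIV)" for x y
      using d(2)[of k j x y] by (simp add: has_field_derivative_def)
    have "continuous_on UNIV (\<lambda>p. blinfun_mult_right (Dv k (Suc j) g (fst p) (snd p)))"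
      by (rule bounded_linear.continuous_on[OF bounded_linear_blinfun_mult_right d(3)])
    then show "continuous (at (a, b) within UNIV \<times> UNIV) (\<lambda>(x, y). blinfun_mult_right (Dv k (Suc j) g x y))"
      by (simp add: continuous_on_eq_continuous_at split_beta')
  qed auto
  then show ?thesis by (simp add: split_beta')
qed

text \<open>The functions \<open>?F k j\<close> are closed under \<open>pd\<close> up to linear
  combinations with constant coefficients, so a single induction covers derivatives of all
  orders.\<close>

lemma Sm_embed:
  assumes g: "smooth2 g" "periodic2 g" and p: "p = DX \<or> p = DY"
  shows "Sm (\<lambda>z. g (z \<bullet> ax DT) (z \<bullet> ax p))"
proof -
  let ?F = "\<lambda>k j z. Dv k j g (z \<bullet> ax DT) (z \<bullet> ax p)"
  have d: "(?F k j has_derivative (\<lambda>h. ?F (Suc k) j z * (h \<bullet> ax DT) + ?F k (Suc j) z * (h \<bullet> ax p))) (at z)" for k j z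
  proof -
    have "((\<lambda>z. (z \<bullet> ax DT, z \<bullet> ax p)) has_derivative (\<lambda>h. (h \<bullet> ax DT, h \<bullet> ax p))) (at z)"
      by (intro has_derivative_Pair bounded_linear_imp_has_derivative bounded_linear_inner_left)
    from has_derivative_compose[OF this smooth2_has_derivative[OF g(1), of k j]] show ?thesis by simp
  qed
  have pd: "pd a (?F k j) = (\<lambda>z. (ax a \<bullet> ax DT) * ?F (Suc k) j z + (ax a \<bullet> ax p) * ?F k (Suc j) z)" for a k j
    by (rule ext, subst pd_eqI[OF d]) (simp add: mult.commute)
  have df: "?F k j differentiable at z" for k j z using d unfolding differentiable_def by blast
  have "Ck n (?F k j)" for n k j
  proof (induction n arbitrary: k j)
    case (Suc n)
    have "Ck n (pd a (?F k j))" for a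
      unfolding pd by (intro Ck_add Ck_mult Ck_const Suc.IH)
    then show ?case using df by simp
  qed (use df in simp)
  then have "smooth (?F 0 0)" by (simp add: smooth_def)
  moreover have "?F 0 0 = (\<lambda>z. g (z \<bullet> ax DT) (z \<bullet> ax p))" by (simp add: Dv_def)
  moreover have "periodic (\<lambda>z. g (z \<bullet> ax DT) (z \<bullet> ax p))"
    unfolding periodic_def
  proof (intro allI)
    fix z a
    have per: "g (x + 1) y = g x y" "g x (y + 1) = g x y" for x y using g(2) by (auto simp: periodic2_def)
    show "g ((z + ax a) \<bullet> ax DT) ((z + ax a) \<bullet> ax p) = g (z \<bullet> ax DT) (z \<bullet> ax p)"
      using p by (cases a; cases z) (auto simp: per)
  qed
  ultimately show ?thesis by (simp add: Sm_def)
qed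

section \<open>Uniqueness by the energy identity on space-time\<close>

abbreviation Avt :: "(pt \<Rightarrow> real) \<Rightarrow> pt \<Rightarrow> real" where
  "Avt F \<equiv> Au DT (M F)"

text \<open>Periodicity cancels the boundary terms along the axis \<open>a\<close>; since averages
  commute, that average can be taken innermost.\<close>

lemma Avt_derivative:
  assumes C: "Cp F" "Cp Fa"
    and d: "\<And>z r. ((\<lambda>r. F (z + r *\<^sub>R ax a)) has_real_derivative Fa (z + r *\<^sub>R ax a)) (at r)"
  shows "Avt Fa z = 0"
proof -
  have 0: "Au a Fa = (\<lambda>z. 0)" by (rule ext) (rule Au_derivative[OF C d])
  have z0: "Au b (\<lambda>z. 0) = (\<lambda>z. 0)" for b by (rule ext) simp
  show ?thesis
  proof (cases a)
    case DT
    have "Avt Fa = M (Au DT Fa)"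
      unfolding M_def using C by (simp add: Av_commute[OF prm_unif prm_unif, of _ _ _ 1 DX] Av_commute[OF prm_unif prm_unif, of Fa 1 DT 1 DY] Cp_Av)
    then show ?thesis using 0 DT by simp
  next
    case DX
    then show ?thesis unfolding M_swap[OF C(2)] using 0 z0 by simp
  next
    case DY
    then show ?thesis unfolding M_def using 0 z0 by simp
  qed
qed

lemma Avt_zero:
  assumes "Cp P" "\<And>z. 0 \<le> P z" "Avt P z = 0"
  shows "P z = 0"
proof -
  have "M P z = 0" by (rule Au_zero[OF Cp_M[OF assms(1)] M_nonneg[OF assms(2)] assms(3)])
  then have "Au DX (Au DY P) z = 0" by (simp add: M_def)
  then have "Au DY P z = 0" using assms by (intro Au_zero[of "Au DY P" DX]) (auto intro: Cp_Av Av_nonneg)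
  then show ?thesis using assms by (intro Au_zero[of P DY])
qed

lemma Avt_add: "Cp F \<Longrightarrow> Cp H \<Longrightarrow> Avt (\<lambda>z. F z + H z) z = Avt F z + Avt H z"
proof -
  assume C: "Cp F" "Cp H"
  have "M (\<lambda>z. F z + H z) = (\<lambda>z. M F z + M H z)" by (rule ext) (rule M_add[OF C])
  then show ?thesis using C by (simp add: Av_add Cp_M)
qed

text \<open>The derivatives of \<open>\<chi>1\<close> are given along the axes only, so they enter
  as separate continuous functions and not through \<open>pd\<close>. Averaging over time as well as
  space makes the term with \<open>Wt\<close> vanish.\<close>

lemma (in scheme) homogeneous_solution:
  fixes W Wt W1 W2 W11 W22 :: "pt \<Rightarrow> real"
  assumes C: "Cp W" "Cp Wt" "Cp W1" "Cp W2" "Cp W11" "Cp W22"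
    and dt: "\<And>z r. ((\<lambda>r. W (z + r *\<^sub>R ax DT)) has_real_derivative Wt (z + r *\<^sub>R ax DT)) (at r)"
    and d1: "\<And>z r. ((\<lambda>r. W (z + r *\<^sub>R ax DX)) has_real_derivative W1 (z + r *\<^sub>R ax DX)) (at r)"
    and d2: "\<And>z r. ((\<lambda>r. W (z + r *\<^sub>R ax DY)) has_real_derivative W2 (z + r *\<^sub>R ax DY)) (at r)"
    and d11: "\<And>z r. ((\<lambda>r. W1 (z + r *\<^sub>R ax DX)) has_real_derivative W11 (z + r *\<^sub>R ax DX)) (at r)"
    and d22: "\<And>z r. ((\<lambda>r. W2 (z + r *\<^sub>R ax DY)) has_real_derivative W22 (z + r *\<^sub>R ax DY)) (at r)"
    and eq: "\<And>z. Wt z + b1 z * W1 z + b2 z * W2 z + \<sigma>\<^sup>2 / 2 * (W11 z + W22 z) = 0"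
    and mean: "M W = (\<lambda>z. 0)"
  shows "W z = 0"
proof -
  have Cb: "Cp b1" "Cp b2" using b1 b2 by (auto intro: Sm_Cp)
  let ?P = "\<lambda>z. (W1 z)\<^sup>2 + (W2 z)\<^sup>2"
  let ?F1 = "\<lambda>z. 2 * (W z * Wt z)" and ?F2 = "\<lambda>z. 2 * (b1 z * (W z * W1 z))" and ?F3 = "\<lambda>z. 2 * (b2 z * (W z * W2 z))"
    and ?F4 = "\<lambda>z. \<sigma>\<^sup>2 * (W1 z * W1 z + W z * W11 z)" and ?F5 = "\<lambda>z. \<sigma>\<^sup>2 * (W2 z * W2 z + W z * W22 z)"
  have CF: "Cp ?F1" "Cp ?F2" "Cp ?F3" "Cp ?F4" "Cp ?F5"
    by (intro Cp_add Cp_mult Cp_cmult C Cb)+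
  have CP: "Cp ?P" by (intro Cp_add Cp_power C)
  have 1: "Avt ?F1 y = 0" for y
  proof (rule Avt_derivative[where F = "\<lambda>z. W z * W z" and a = DT])
    show "((\<lambda>r. W (z + r *\<^sub>R ax DT) * W (z + r *\<^sub>R ax DT)) has_real_derivative 2 * (W (z + r *\<^sub>R ax DT) * Wt (z + r *\<^sub>R ax DT))) (at r)" for z r
      by (rule DERIV_cong[OF DERIV_mult[OF dt dt]]) simp
  qed (intro Cp_mult C CF)+
  have 2: "Avt ?F2 y = 0" for y
  proof (rule Avt_derivative[where F = "\<lambda>z. b1 z * (W z * W z)" and a = DX])
    show "((\<lambda>r. b1 (z + r *\<^sub>R ax DX) * (W (z + r *\<^sub>R ax DX) * W (z + r *\<^sub>R ax DX))) has_real_derivative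
       2 * (b1 (z + r *\<^sub>R ax DX) * (W (z + r *\<^sub>R ax DX) * W1 (z + r *\<^sub>R ax DX)))) (at r)" for z r
      unfolding b1x by (rule DERIV_cong[OF DERIV_cmult[OF DERIV_mult[OF d1 d1]]]) simp
  qed (intro Cp_mult C Cb CF)+
  have 3: "Avt ?F3 y = 0" for y
  proof (rule Avt_derivative[where F = "\<lambda>z. b2 z * (W z * W z)" and a = DY])
    show "((\<lambda>r. b2 (z + r *\<^sub>R ax DY) * (W (z + r *\<^sub>R ax DY) * W (z + r *\<^sub>R ax DY))) has_real_derivative
       2 * (b2 (z + r *\<^sub>R ax DY) * (W (z + r *\<^sub>R ax DY) * W2 (z + r *\<^sub>R ax DY)))) (at r)" for z r
      unfolding b2y by (rule DERIV_cong[OF DERIV_cmult[OF DERIV_mult[OF d2 d2]]]) simp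
  qed (intro Cp_mult C Cb CF)+
  have 4: "Avt ?F4 y = 0" for y
  proof (rule Avt_derivative[where F = "\<lambda>z. \<sigma>\<^sup>2 * (W z * W1 z)" and a = DX])
    show "((\<lambda>r. \<sigma>\<^sup>2 * (W (z + r *\<^sub>R ax DX) * W1 (z + r *\<^sub>R ax DX))) has_real_derivative
       \<sigma>\<^sup>2 * (W1 (z + r *\<^sub>R ax DX) * W1 (z + r *\<^sub>R ax DX) + W (z + r *\<^sub>R ax DX) * W11 (z + r *\<^sub>R ax DX))) (at r)" for z r
      by (rule DERIV_cong[OF DERIV_cmult[OF DERIV_mult[OF d1 d11]]]) (simp add: mult.commute)
  qed (intro Cp_mult Cp_cmult C CF)+
  have 5: "Avt ?F5 y = 0" for y
  proof (rule Avt_derivative[where F = "\<lambda>z. \<sigma>\<^sup>2 * (W z * W2 z)" and a = DY])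
    show "((\<lambda>r. \<sigma>\<^sup>2 * (W (z + r *\<^sub>R ax DY) * W2 (z + r *\<^sub>R ax DY))) has_real_derivative
       \<sigma>\<^sup>2 * (W2 (z + r *\<^sub>R ax DY) * W2 (z + r *\<^sub>R ax DY) + W (z + r *\<^sub>R ax DY) * W22 (z + r *\<^sub>R ax DY))) (at r)" for z r
      by (rule DERIV_cong[OF DERIV_cmult[OF DERIV_mult[OF d2 d22]]]) (simp add: mult.commute)
  qed (intro Cp_mult Cp_cmult C CF)+
  \<comment> \<open>The equation times \<open>2 * W\<close>. Each of \<open>?F1\<close> to
    \<open>?F5\<close> is a derivative along an axis; for \<open>?F2\<close> and \<open>?F3\<close>
    this holds because \<open>b1\<close> and \<open>b2\<close> are constant along the direction in
    which they transport.\<close>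
  have "(\<lambda>z. \<sigma>\<^sup>2 * ?P z) = (\<lambda>z. (((?F1 z + ?F2 z) + ?F3 z) + ?F4 z) + ?F5 z)"
  proof
    fix z
    have "2 * Wt z + 2 * (b1 z * W1 z) + 2 * (b2 z * W2 z) + \<sigma>\<^sup>2 * (W11 z + W22 z) = 0"
      using eq[of z] by argo
    then have "0 = W z * (2 * Wt z + 2 * (b1 z * W1 z) + 2 * (b2 z * W2 z) + \<sigma>\<^sup>2 * (W11 z + W22 z))" by simp
    then show "\<sigma>\<^sup>2 * ?P z = (((?F1 z + ?F2 z) + ?F3 z) + ?F4 z) + ?F5 z"
      by (simp add: algebra_simps power2_eq_square)
  qed
  then have "Avt (\<lambda>z. \<sigma>\<^sup>2 * ?P z) y = Avt (\<lambda>z. (((?F1 z + ?F2 z) + ?F3 z) + ?F4 z) + ?F5 z) y" for y by simp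
  also have "\<dots> y = Avt ?F1 y + Avt ?F2 y + Avt ?F3 y + Avt ?F4 y + Avt ?F5 y" for y
  proof -
    note a4 = Avt_add[OF CF(1,2)]
      and a3 = Avt_add[OF Cp_add[OF CF(1,2)] CF(3)]
      and a2 = Avt_add[OF Cp_add[OF Cp_add[OF CF(1,2)] CF(3)] CF(4)]
      and a1 = Avt_add[OF Cp_add[OF Cp_add[OF Cp_add[OF CF(1,2)] CF(3)] CF(4)] CF(5)]
    show ?thesis unfolding a1 a2 a3 a4 ..
  qed
  finally have "Avt (\<lambda>z. \<sigma>\<^sup>2 * ?P z) y = 0" for y using 1 2 3 4 5 by simp
  then have "\<sigma>\<^sup>2 * ?P y = 0" for y
    by (intro Avt_zero[of "\<lambda>z. \<sigma>\<^sup>2 * ?P z"] Cp_cmult CP) auto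
  then have P0: "?P y = 0" for y using sigma by simp
  have W0: "W1 y = 0" "W2 y = 0" for y using P0[of y] by (simp_all add: sum_power2_eq_zero_iff)
  \<comment> \<open>Without spatial gradient \<open>W\<close> is constant in space at each time,
    hence equal to its own spatial mean.\<close>
  have c1: "W (y + r *\<^sub>R ax DX) = W y" for y r
    using DERIV_isconst_all[of "\<lambda>r. W (y + r *\<^sub>R ax DX)" r 0] d1[of y] by (simp add: W0 del: ax.simps)
  have c2: "W (y + r *\<^sub>R ax DY) = W y" for y r
    using DERIV_isconst_all[of "\<lambda>r. W (y + r *\<^sub>R ax DY)" r 0] d2[of y] by (simp add: W0 del: ax.simps)
  have "Au DY W = W"
  proof
    fix y show "Au DY W y = W y" using Av_const[OF prm_unif, of 1 DY "W y" y] unfolding Av_def by (simp only: c2)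
  qed
  moreover have "Au DX W = W"
  proof
    fix y show "Au DX W y = W y" using Av_const[OF prm_unif, of 1 DX "W y" y] unfolding Av_def by (simp only: c1)
  qed
  ultimately have "M W = W" by (simp add: M_def)
  then show ?thesis using mean by metis
qed

section \<open>Passage between curried and uncurried functions, and the Hoelder norm\<close>

definition unc :: "fn3 \<Rightarrow> pt \<Rightarrow> real" where
  "unc w z = w (fst z) (fst (snd z)) (snd (snd z))"

lemma unc_apply [simp]: "unc w (t, x, y) = w t x y"
  by (simp add: unc_def)

text \<open>The description that defines \<open>deriv\<close> is invariant under shifts, so
  periodicity passes to derivatives before differentiability is considered.\<close>

lemma periodic3_deriv:
  assumes "periodic3 w"
  shows "periodic3 (pdt w)" "periodic3 (pd1 w)" "periodic3 (pd2 w)"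
proof -
  have sh: "deriv (\<lambda>s. g (s + 1)) x = deriv g (x + 1)" for g :: "real \<Rightarrow> real" and x
    unfolding deriv_def by (simp add: DERIV_shift[symmetric])
  have w: "w (t + 1) x y = w t x y" "w t (x + 1) y = w t x y" "w t x (y + 1) = w t x y" for t x y
    using assms by (auto simp: periodic3_def)
  have w': "w (t + 1) = w t" "w t (x + 1) = w t x" for t x by (intro ext; simp add: w)+
  show "periodic3 (pdt w)" "periodic3 (pd1 w)" "periodic3 (pd2 w)"
    by (auto simp: periodic3_def pdt_def pd1_def pd2_def sh[symmetric] w w')
qed

lemma periodic_unc: "periodic3 w \<Longrightarrow> periodic (unc w)"
  unfolding periodic_def
proof (intro allI)
  fix z :: pt and a assume "periodic3 w"
  then show "unc w (z + ax a) = unc w z"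
    by (cases a; cases z) (auto simp: periodic3_def)
qed

lemma tdist_small: "\<bar>a - b\<bar> < 1/2 \<Longrightarrow> tdist a b = \<bar>a - b\<bar>"
proof -
  assume "\<bar>a - b\<bar> < 1/2"
  then have "round (a - b) = 0" by (intro round_unique') simp
  then show ?thesis by (simp add: tdist_def)
qed

text \<open>\<open>C26\<close> does not list joint continuity of the derivatives; it is recovered
  from the Hoelder quotients, since \<open>tdist3\<close> is the Euclidean distance for nearby
  points.\<close>

lemma continuous_unc:
  assumes "0 < \<alpha>" "bdd_above (hoelder_quots \<alpha> g)"
  shows "continuous_on UNIV (unc g)"
proof -
  obtain H where H: "\<And>x. x \<in> hoelder_quots \<alpha> g \<Longrightarrow> x \<le> H" using assms(2) unfolding bdd_above_def by blast
  have b: "\<bar>unc g p - unc g q\<bar> \<le> \<bar>H\<bar> * dist p q powr \<alpha>" if "dist p q < 1/2" for p q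
  proof (cases "p = q")
    case False
    obtain t x y t' x' y' where pq: "p = (t, x, y)" "q = (t', x', y')" by (metis prod.exhaust)
    have "\<bar>t - t'\<bar> \<le> dist p q" "\<bar>x - x'\<bar> \<le> dist p q" "\<bar>y - y'\<bar> \<le> dist p q"
      using dist_fst_le[of p q] order_trans[OF dist_fst_le dist_snd_le[of p q]] order_trans[OF dist_snd_le dist_snd_le[of p q]]
      by (simp_all add: pq dist_real_def)
    then have td: "tdist3 p q = dist p q"
      using that by (simp add: tdist3_def pq tdist_small dist_Pair_Pair dist_real_def add.assoc)
    have "\<bar>unc g p - unc g q\<bar> / (tdist3 p q powr \<alpha>) \<in> hoelder_quots \<alpha> g"
      unfolding hoelder_quots_def unc_def 
      by (intro CollectI exI[of _ p] exI[of _ q] conjI refl) (use td False in simp)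
    then have "\<bar>unc g p - unc g q\<bar> / (dist p q powr \<alpha>) \<le> H" using H td by simp
    then have "\<bar>unc g p - unc g q\<bar> \<le> H * dist p q powr \<alpha>" using False by (simp add: field_simps)
    also have "\<dots> \<le> \<bar>H\<bar> * dist p q powr \<alpha>" by (intro mult_right_mono) auto
    finally show ?thesis .
  qed simp
  have "isCont (unc g) q" for q
    unfolding isCont_def
  proof (rule LIM_zero_cancel, rule Lim_null_comparison[where g = "\<lambda>p. \<bar>H\<bar> * dist p q powr \<alpha>"])
    have "((\<lambda>p. dist p q) \<longlongrightarrow> 0) (at q)" using tendsto_dist_iff[of "\<lambda>p. p" q "at q"] by simp
    then have "((\<lambda>p. dist p q powr \<alpha>) \<longlongrightarrow> 0) (at q)"
      by (rule tendsto_zero_powrI) (use assms in auto)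
    then show "((\<lambda>p. \<bar>H\<bar> * dist p q powr \<alpha>) \<longlongrightarrow> 0) (at q)" by (rule tendsto_mult_right_zero)
    have "\<forall>\<^sub>F p in at q. dist p q < 1/2" unfolding eventually_at by (intro exI[of _ "1/2"]) auto
    then show "\<forall>\<^sub>F p in at q. norm (unc g p - unc g q) \<le> \<bar>H\<bar> * dist p q powr \<alpha>"
      by (rule eventually_mono) (use b in auto)
  qed
  then show ?thesis by (simp add: continuous_at_imp_continuous_on)
qed

text \<open>The mean does not depend on the spatial coordinates, so it may be evaluated at
  \<open>(t, 0, 0)\<close>, where the two averages run over the unit square of
  \<open>mean_zero\<close>.\<close>

lemma M_unc:
  assumes "Cp (unc w)" "mean_zero w"
  shows "M (unc w) = (\<lambda>z. 0)"
proof
  fix z :: pt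
  obtain t x y where z: "z = (t, x, y)" by (cases z)
  have "z = ((t, 0, 0) + x *\<^sub>R ax DX) + y *\<^sub>R ax DY" by (simp add: z)
  then have "M (unc w) z = M (unc w) (t, 0, 0)" using M_shift[OF assms(1)] by metis
  also have "\<dots> = integral {0..1} (\<lambda>p. integral {0..1} (\<lambda>q. w t p q))"
    unfolding M_def using assms(1) by (simp add: Au_eq Cp_Av)
  also have "\<dots> = integral (cbox (0, 0) (1, 1)) (\<lambda>(x1::real, x2::real). w t x1 x2)"
  proof -
    have "continuous_on UNIV (\<lambda>p::real\<times>real. unc w (t, p))"
      using assms(1) unfolding Cp_def
      by (intro continuous_on_compose2[of UNIV "unc w" UNIV "\<lambda>p. (t, p)"]) (auto intro!: continuous_intros)
    then have "continuous_on (cbox (0, 0) (1, 1)) (\<lambda>p::real\<times>real. unc w (t, p))"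
      by (rule continuous_on_subset) simp
    from integral_prod_continuous[OF this] show ?thesis by (simp add: unc_def split_beta')
  qed
  also have "\<dots> = 0" using assms(2) by (simp add: mean_zero_def)
  finally show "M (unc w) z = 0" .
qed

lemma unc_line_derivative:
  assumes "\<And>t x y. (\<lambda>s. w s x y) differentiable (at t)"
  shows "((\<lambda>r. unc w (z + r *\<^sub>R ax DT)) has_real_derivative unc (pdt w) (z + r *\<^sub>R ax DT)) (at r)"
proof -
  obtain t x y where z: "z = (t, x, y)" by (cases z)
  have "((\<lambda>s. w s x y) has_real_derivative pdt w (r + t) x y) (at (r + t))"
    using assms by (simp add: pdt_def DERIV_deriv_iff_real_differentiable)
  then show ?thesis by (simp add: z DERIV_shift add.commute)
qed

lemma unc_line_derivative1:
  assumes "\<And>t x y. (\<lambda>s. w t s y) differentiable (at x)"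
  shows "((\<lambda>r. unc w (z + r *\<^sub>R ax DX)) has_real_derivative unc (pd1 w) (z + r *\<^sub>R ax DX)) (at r)"
proof -
  obtain t x y where z: "z = (t, x, y)" by (cases z)
  have "((\<lambda>s. w t s y) has_real_derivative pd1 w t (r + x) y) (at (r + x))"
    using assms by (simp add: pd1_def DERIV_deriv_iff_real_differentiable)
  then show ?thesis by (simp add: z DERIV_shift add.commute)
qed

lemma unc_line_derivative2:
  assumes "\<And>t x y. (\<lambda>s. w t x s) differentiable (at y)"
  shows "((\<lambda>r. unc w (z + r *\<^sub>R ax DY)) has_real_derivative unc (pd2 w) (z + r *\<^sub>R ax DY)) (at r)"
proof -
  obtain t x y where z: "z = (t, x, y)" by (cases z)
  have "((\<lambda>s. w t x s) has_real_derivative pd2 w t x (r + y)) (at (r + y))"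
    using assms by (simp add: pd2_def DERIV_deriv_iff_real_differentiable)
  then show ?thesis by (simp add: z DERIV_shift add.commute)
qed

definition cur :: "(pt \<Rightarrow> real) \<Rightarrow> fn3" where
  "cur f t x y = f (t, x, y)"

lemma cur_derivatives:
  assumes "smooth f"
  shows "((\<lambda>s. cur f s x y) has_real_derivative cur (pd DT f) t x y) (at t)"
    "((\<lambda>s. cur f t s y) has_real_derivative cur (pd DX f) t x y) (at x)"
    "((\<lambda>s. cur f t x s) has_real_derivative cur (pd DY f) t x y) (at y)"
  using pd_line[OF smooth_differentiable[OF assms], where z = "(0, x, y)" and r = t and a = DT]
    pd_line[OF smooth_differentiable[OF assms], where z = "(t, 0, y)" and r = x and a = DX]
    pd_line[OF smooth_differentiable[OF assms], where z = "(t, x, 0)" and r = y and a = DY]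
  by (simp_all add: cur_def)

lemma cur_pd:
  assumes "smooth f"
  shows "pdt (cur f) = cur (pd DT f)" "pd1 (cur f) = cur (pd DX f)" "pd2 (cur f) = cur (pd DY f)"
  using cur_derivatives[OF assms] by (auto simp: pdt_def pd1_def pd2_def fun_eq_iff intro!: DERIV_imp_deriv)

definition D3w :: "nat \<Rightarrow> nat \<Rightarrow> nat \<Rightarrow> dir list" where
  "D3w k j1 j2 = replicate k DT @ replicate j1 DX @ replicate j2 DY"

lemma D3_cur:
  assumes f: "smooth f"
  shows "D3 k j1 j2 (cur f) = cur (D (D3w k j1 j2) f)"
proof -
  have sp: "smooth ((pd a ^^ n) g)" if "smooth g" for a n g
    using smooth_D[OF that, of "replicate n a"] by simp
  have 2: "(pd2 ^^ n) (cur g) = cur (D (replicate n DY) g)" if "smooth g" for n g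
    by (induction n) (use that in \<open>auto simp: cur_pd sp\<close>)
  have 1: "(pd1 ^^ n) (cur g) = cur (D (replicate n DX) g)" if "smooth g" for n g
    by (induction n) (use that in \<open>auto simp: cur_pd sp\<close>)
  have 0: "(pdt ^^ n) (cur g) = cur (D (replicate n DT) g)" if "smooth g" for n g
    by (induction n) (use that in \<open>auto simp: cur_pd sp\<close>)
  show ?thesis unfolding D3_def using f by (simp add: 0 1 2 sp D3w_def)
qed

lemma tdist_le: "tdist a b \<le> 1/2"
  using of_int_round_abs_le[of "a - b"] by (simp add: tdist_def abs_minus_commute)

text \<open>A torus of diameter at most 1 makes each distance no larger than its power with exponent
  \<open>\<alpha>\<close>, so Lipschitz bounds imply Hoelder bounds.\<close>

lemma tdist3_le: "tdist3 p q \<le> 1"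
proof -
  have sq: "(tdist a b)\<^sup>2 \<le> 1/4" for a b
    using power_mono[OF tdist_le[of a b], of 2] by (simp add: tdist_def power2_eq_square)
  have "(tdist (fst p) (fst q))\<^sup>2 + (tdist (fst (snd p)) (fst (snd q)))\<^sup>2 + (tdist (snd (snd p)) (snd (snd q)))\<^sup>2 \<le> 1"
    using sq[of "fst p" "fst q"] sq[of "fst (snd p)" "fst (snd q)"] sq[of "snd (snd p)" "snd (snd q)"] by linarith
  then show ?thesis unfolding tdist3_def by simp
qed

text \<open>\<open>q\<close> is replaced by the lattice translate that is nearest to
  \<open>p\<close> in each coordinate. The increment then has norm \<open>tdist3 p q\<close>, and
  Taylor's formula of order one applies; the factor 3 counts the axes.\<close>

lemma lipschitz_tdist3:
  assumes g: "Sm g" and B: "\<And>a z. \<bar>pd a g z\<bar> \<le> B"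
  shows "\<bar>g p - g q\<bar> \<le> 3 * B * tdist3 p q"
proof -
  obtain t x y t' x' y' where pq: "p = (t, x, y)" "q = (t', x', y')" by (metis prod.exhaust)
  let ?r = "\<lambda>a b::real. a - b - of_int (round (a - b))"
  let ?h = "(?r t t', ?r x x', ?r y y')"
  let ?q = "((q + of_int (round (t - t')) *\<^sub>R ax DT) + of_int (round (x - x')) *\<^sub>R ax DX) + of_int (round (y - y')) *\<^sub>R ax DY"
  have per: "periodic g" using g by (simp add: Sm_def)
  have "g ?q = g q" by (simp only: periodic_int[OF per])
  moreover have "p = ?q + ?h" by (simp add: pq)
  moreover obtain u where "g (?q + ?h) = (\<Sum>m<1. (dird ?h ^^ m) g ?q / fact m) + (dird ?h ^^ 1) g u / fact 1"
    using dird_taylor[OF Sm_smooth[OF g], of ?q ?h 1] by blast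
  ultimately have "g p - g q = dird ?h g u" by simp
  then have "\<bar>g p - g q\<bar> \<le> norm ?h * (\<Sum>a\<in>UNIV. \<bar>pd a g u\<bar>)" using abs_dird[of ?h g u] by simp
  also have "\<dots> \<le> norm ?h * (\<Sum>a\<in>(UNIV::dir set). B)" by (intro mult_left_mono sum_mono B) auto
  also have "norm ?h = tdist3 p q" by (simp add: pq tdist3_def tdist_def norm_Pair add.assoc)
  finally show ?thesis by (simp add: sum_dir mult_ac del: sum_constant)
qed

lemma sup_vals_le:
  assumes "\<And>z. \<bar>g z\<bar> \<le> B"
  shows "bdd_above (sup_vals (cur g))" "Sup (sup_vals (cur g)) \<le> B"
proof -
  have *: "x \<le> B" if "x \<in> sup_vals (cur g)" for x using that assms by (auto simp: sup_vals_def cur_def)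
  then show "bdd_above (sup_vals (cur g))" unfolding bdd_above_def by blast
  have "\<bar>cur g 0 0 0\<bar> \<in> sup_vals (cur g)" unfolding sup_vals_def by blast
  then show "Sup (sup_vals (cur g)) \<le> B" using * by (intro cSup_least) auto
qed

lemma hoelder_quots_le:
  assumes g: "Sm g" and B: "\<And>a z. \<bar>pd a g z\<bar> \<le> B" and \<alpha>: "0 < \<alpha>" "\<alpha> < 1"
  shows "bdd_above (hoelder_quots \<alpha> (cur g))" "Sup (hoelder_quots \<alpha> (cur g)) \<le> 3 * B"
proof -
  have B0: "B \<ge> 0" using B[of DT 0] by linarith
  have *: "v \<le> 3 * B" if v: "v \<in> hoelder_quots \<alpha> (cur g)" for v
  proof -
    obtain p q where pq: "tdist3 p q > 0" "v = \<bar>g p - g q\<bar> / (tdist3 p q powr \<alpha>)"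
      using v by (auto simp: hoelder_quots_def cur_def)
    have "tdist3 p q = tdist3 p q powr 1" using pq by simp
    also have "\<dots> \<le> tdist3 p q powr \<alpha>" using \<alpha> pq tdist3_le by (intro powr_mono') auto
    finally have "3 * B * tdist3 p q \<le> 3 * B * tdist3 p q powr \<alpha>" using B0 by (intro mult_left_mono) auto
    then have "\<bar>g p - g q\<bar> \<le> 3 * B * tdist3 p q powr \<alpha>" using lipschitz_tdist3[OF g B, of p q] by linarith
    then show ?thesis using pq by (simp add: pos_divide_le_eq)
  qed
  then show "bdd_above (hoelder_quots \<alpha> (cur g))" unfolding bdd_above_def by blast
  \<comment> \<open>A pair at positive distance, so that the supremum is taken over a nonempty
    set.\<close>
  have "tdist3 (0, 0, 0) (1/4, 0, 0) > 0" by (simp add: tdist3_def tdist_small)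
  then have "hoelder_quots \<alpha> (cur g) \<noteq> {}" unfolding hoelder_quots_def by blast
  then show "Sup (hoelder_quots \<alpha> (cur g)) \<le> 3 * B" using * by (intro cSup_least) auto
qed

text \<open>Nine derivatives: eight for the index set and one more for the Hoelder seminorm.\<close>

lemma C26_cur:
  fixes B :: real
  assumes f: "Sm f" and B: "bnd 9 f B" and \<alpha>: "0 < \<alpha>" "\<alpha> < 1"
  shows "C26 \<alpha> (cur f)" "norm26 \<alpha> (cur f) \<le> card idx26 * (4 * B)"
proof -
  have sf: "smooth f" using f by (rule Sm_smooth)
  have bound: "\<bar>D w f z\<bar> \<le> B" if "length w \<le> 9" for w z
    using D_le_J[OF that, of f z] bndD[OF B, of z] by linarith
  have b: "bdd_above (sup_vals (D3 k j1 j2 (cur f)))" "Sup (sup_vals (D3 k j1 j2 (cur f))) \<le> B"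
    "bdd_above (hoelder_quots \<alpha> (D3 k j1 j2 (cur f)))" "Sup (hoelder_quots \<alpha> (D3 k j1 j2 (cur f))) \<le> 3 * B"
    if i: "k \<le> 2" "j1 + j2 \<le> 6" for k j1 j2
  proof -
    let ?w = "D3w k j1 j2"
    have w: "length ?w \<le> 8" using i by (simp add: D3w_def)
    have 1: "\<bar>D ?w f z\<bar> \<le> B" for z using w by (intro bound) auto
    have 2: "\<bar>pd a (D ?w f) z\<bar> \<le> B" for a z using bound[of "a # ?w" z] w by simp
    show "bdd_above (sup_vals (D3 k j1 j2 (cur f)))" "Sup (sup_vals (D3 k j1 j2 (cur f))) \<le> B"
      unfolding D3_cur[OF sf] by (rule sup_vals_le[OF 1])+
    show "bdd_above (hoelder_quots \<alpha> (D3 k j1 j2 (cur f)))" "Sup (hoelder_quots \<alpha> (D3 k j1 j2 (cur f))) \<le> 3 * B"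
      unfolding D3_cur[OF sf] by (rule hoelder_quots_le[OF Sm_D[OF f] 2 \<alpha>])+
  qed
  have dif: "(\<lambda>s. D3 k j1 j2 (cur f) s x y) differentiable (at t)" "(\<lambda>s. D3 k j1 j2 (cur f) t s y) differentiable (at x)"
     "(\<lambda>s. D3 k j1 j2 (cur f) t x s) differentiable (at y)" for k j1 j2 t x y
    unfolding D3_cur[OF sf] using cur_derivatives[OF smooth_D[OF sf]] real_differentiable_def by blast+
  have per: "periodic3 (cur f)"
  proof -
    have "f (z + ax a) = f z" for z a using f by (simp add: Sm_def periodic_def)
    from this[of _ DT] this[of _ DX] this[of _ DY] show ?thesis by (auto simp: periodic3_def cur_def)
  qed
  show "C26 \<alpha> (cur f)" unfolding C26_def using per b dif by (auto simp: idx26_def)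
  show "norm26 \<alpha> (cur f) \<le> card idx26 * (4 * B)"
    unfolding norm26_def
  proof (rule sum_bounded_above)
    fix i assume "i \<in> idx26"
    then obtain k j1 j2 where i: "i = (k, j1, j2)" "k \<le> 2" "j1 + j2 \<le> 6" by (auto simp: idx26_def)
    \<comment> \<open>\<open>B\<close> for the supremum and \<open>3 * B\<close> for the Hoelder
      quotients.\<close>
    show "(case i of (k, j1, j2) \<Rightarrow> Sup (sup_vals (D3 k j1 j2 (cur f))) + Sup (hoelder_quots \<alpha> (D3 k j1 j2 (cur f)))) \<le> 4 * B"
      using b(2,4)[OF i(2,3)] by (simp add: i(1))
  qed
qed

theorem theorem4p4:
  fixes v1 v2 :: "real \<Rightarrow> real \<Rightarrow> real" and \<sigma> \<alpha> :: real and \<chi>1 :: fn3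
  assumes "\<sigma> > 0" and "0 < \<alpha>" and "\<alpha> < 1"
    and "smooth2 v1" and "smooth2 v2" and "periodic2 v1" and "periodic2 v2"
    and "\<And>t. integral {0..1} (\<lambda>x2. v1 t x2) = 0"
    and "\<And>t. integral {0..1} (\<lambda>x1. v2 t x1) = 0"
    and "C26_0 \<alpha> \<chi>1"
    and "\<And>t x1 x2. gen v1 v2 \<sigma> \<chi>1 t x1 x2 = - v1 t x2"
  shows "\<exists>C N0. \<forall>N \<ge> N0.
           C26 \<alpha> (\<lambda>t x1 x2. \<chi>1 t x1 x2 - vhat1 v1 v2 \<sigma> N t x1 x2) \<and>
           norm26 \<alpha> (\<lambda>t x1 x2. \<chi>1 t x1 x2 - vhat1 v1 v2 \<sigma> N t x1 x2) \<le> C * (1 / real N)"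
proof -
  \<comment> \<open>As functions on space-time, the drifts ignore the coordinate in which they
    transport, as the locale demands.\<close>
  define b1 where "b1 = (\<lambda>z. v1 (z \<bullet> ax DT) (z \<bullet> ax DY))"
  define b2 where "b2 = (\<lambda>z. v2 (z \<bullet> ax DT) (z \<bullet> ax DX))"
  have bs: "b1 (t, x, y) = v1 t y" "b2 (t, x, y) = v2 t x" for t x y by (simp_all add: b1_def b2_def)
  have Sb: "Sm b1" "Sm b2"
    unfolding b1_def b2_def
    using Sm_embed[OF assms(4,6), of DY] Sm_embed[OF assms(5,7), of DX] by (simp_all del: ax.simps)
  have Au0: "Au DY b1 = (\<lambda>z. 0)"
  proof
    fix z :: pt
    obtain t x y where z: "z = (t, x, y)" by (cases z)
    have "Au DY b1 z = Au DY b1 ((t, x, 0) + y *\<^sub>R ax DY)" by (simp add: z)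
    also have "\<dots> = Au DY b1 (t, x, 0)" by (rule Au_shift[OF Sm_Cp[OF Sb(1)]])
    also have "\<dots> = integral {0..1} (\<lambda>x2. v1 t x2)" using Sb by (simp add: Au_eq Sm_Cp bs)
    finally show "Au DY b1 z = 0" using assms(8) by simp
  qed
  interpret mean_zero_scheme b1 b2 \<sigma>
  proof
    show "M b1 = (\<lambda>z. 0)" unfolding M_def Au0 by (rule ext) simp
  qed (use Sb assms in \<open>auto simp: inner_add_left b1_def b2_def\<close>)
  obtain V where V: "Sm V" "M V = (\<lambda>z. 0)" "\<And>z. L V z = - b1 z"
    and Vb: "\<And>m. \<exists>C\<ge>0. \<forall>s\<in>{0<..1}. bnd m (\<lambda>z. V z - vh s z) (C * s)"
    using limit_solution by blast
  \<comment> \<open>The only place where the given solution is compared with the constructed one: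
    uniqueness is applied to their difference.\<close>
  have chi: "unc \<chi>1 z = V z" for z
  proof -
    have C26: "C26 \<alpha> \<chi>1" and mz: "mean_zero \<chi>1" using assms(10) by (auto simp: C26_0_def)
    have per: "periodic3 \<chi>1" using C26 by (simp add: C26_def)
    have D: "D3 0 0 0 \<chi>1 = \<chi>1" "D3 1 0 0 \<chi>1 = pdt \<chi>1" "D3 0 1 0 \<chi>1 = pd1 \<chi>1" "D3 0 0 1 \<chi>1 = pd2 \<chi>1"
      "D3 0 2 0 \<chi>1 = pd1 (pd1 \<chi>1)" "D3 0 0 2 \<chi>1 = pd2 (pd2 \<chi>1)"
      by (simp_all add: D3_def numeral_2_eq_2)
    have h: "bdd_above (hoelder_quots \<alpha> (D3 k j1 j2 \<chi>1))"
      and d: "k > 0 \<longrightarrow> (\<forall>t x1 x2. (\<lambda>s. D3 (k - 1) j1 j2 \<chi>1 s x1 x2) differentiable (at t))"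
        "k = 0 \<and> j1 > 0 \<longrightarrow> (\<forall>t x1 x2. (\<lambda>s. D3 0 (j1 - 1) j2 \<chi>1 t s x2) differentiable (at x1))"
        "k = 0 \<and> j1 = 0 \<and> j2 > 0 \<longrightarrow> (\<forall>t x1 x2. (\<lambda>s. D3 0 0 (j2 - 1) \<chi>1 t x1 s) differentiable (at x2))"
      if "k \<le> 2" "j1 + j2 \<le> 6" for k j1 j2
    proof -
      have "(k, j1, j2) \<in> idx26" using that by (simp add: idx26_def)
      note r = C26[unfolded C26_def, THEN conjunct2, THEN bspec, OF this, unfolded prod.case]
      show "bdd_above (hoelder_quots \<alpha> (D3 k j1 j2 \<chi>1))" by (rule r[THEN conjunct2, THEN conjunct2, THEN conjunct2, THEN conjunct2])
      show "k > 0 \<longrightarrow> (\<forall>t x1 x2. (\<lambda>s. D3 (k - 1) j1 j2 \<chi>1 s x1 x2) differentiable (at t))" using r by blast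
      show "k = 0 \<and> j1 > 0 \<longrightarrow> (\<forall>t x1 x2. (\<lambda>s. D3 0 (j1 - 1) j2 \<chi>1 t s x2) differentiable (at x1))" using r by blast
      show "k = 0 \<and> j1 = 0 \<and> j2 > 0 \<longrightarrow> (\<forall>t x1 x2. (\<lambda>s. D3 0 0 (j2 - 1) \<chi>1 t x1 s) differentiable (at x2))" using r by blast
    qed
    have C: "Cp (unc \<chi>1)" "Cp (unc (pdt \<chi>1))" "Cp (unc (pd1 \<chi>1))" "Cp (unc (pd2 \<chi>1))"
        "Cp (unc (pd1 (pd1 \<chi>1)))" "Cp (unc (pd2 (pd2 \<chi>1)))"
      using h[of 0 0 0] h[of 1 0 0] h[of 0 1 0] h[of 0 0 1] h[of 0 2 0] h[of 0 0 2] unfolding D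
      by (auto simp: Cp_def intro!: continuous_unc[OF assms(2)] periodic_unc periodic3_deriv per)
    have sV: "smooth V" "\<And>a. smooth (pd a V)" using V(1) by (auto intro: Sm_smooth Sm_pd)
    have CV: "Cp V" "\<And>a. Cp (pd a V)" "\<And>a b. Cp (pd a (pd b V))" using V(1) by (auto intro: Sm_Cp Sm_pd)
    have lV: "((\<lambda>r. V (z + r *\<^sub>R ax a)) has_real_derivative pd a V (z + r *\<^sub>R ax a)) (at r)"
      "((\<lambda>r. pd b V (z + r *\<^sub>R ax a)) has_real_derivative pd a (pd b V) (z + r *\<^sub>R ax a)) (at r)" for z r a b
      by (intro pd_line smooth_differentiable sV)+
    have dt: "(\<lambda>s. \<chi>1 s x y) differentiable (at t)" and dx: "(\<lambda>s. \<chi>1 t s y) differentiable (at x)"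
      and dy: "(\<lambda>s. \<chi>1 t x s) differentiable (at y)" and dxx: "(\<lambda>s. pd1 \<chi>1 t s y) differentiable (at x)"
      and dyy: "(\<lambda>s. pd2 \<chi>1 t x s) differentiable (at y)" for t x y
      using d(1)[of 1 0 0] d(2)[of 0 1 0] d(3)[of 0 0 1] d(2)[of 0 2 0] d(3)[of 0 0 2] D by auto
    have "unc \<chi>1 z - V z = 0"
    proof (rule homogeneous_solution[where W = "\<lambda>z. unc \<chi>1 z - V z" and Wt = "\<lambda>z. unc (pdt \<chi>1) z - pd DT V z"
          and ?W1.0 = "\<lambda>z. unc (pd1 \<chi>1) z - pd DX V z" and ?W2.0 = "\<lambda>z. unc (pd2 \<chi>1) z - pd DY V z"
          and ?W11.0 = "\<lambda>z. unc (pd1 (pd1 \<chi>1)) z - pd DX (pd DX V) z" and ?W22.0 = "\<lambda>z. unc (pd2 (pd2 \<chi>1)) z - pd DY (pd DY V) z"])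
      show "((\<lambda>r. unc \<chi>1 (z + r *\<^sub>R ax DT) - V (z + r *\<^sub>R ax DT)) has_real_derivative
          unc (pdt \<chi>1) (z + r *\<^sub>R ax DT) - pd DT V (z + r *\<^sub>R ax DT)) (at r)" for z r
        by (intro DERIV_diff unc_line_derivative dt lV)
      show "((\<lambda>r. unc \<chi>1 (z + r *\<^sub>R ax DX) - V (z + r *\<^sub>R ax DX)) has_real_derivative
          unc (pd1 \<chi>1) (z + r *\<^sub>R ax DX) - pd DX V (z + r *\<^sub>R ax DX)) (at r)" for z r
        by (intro DERIV_diff unc_line_derivative1 dx lV)
      show "((\<lambda>r. unc \<chi>1 (z + r *\<^sub>R ax DY) - V (z + r *\<^sub>R ax DY)) has_real_derivative
          unc (pd2 \<chi>1) (z + r *\<^sub>R ax DY) - pd DY V (z + r *\<^sub>R ax DY)) (at r)" for z r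
        by (intro DERIV_diff unc_line_derivative2 dy lV)
      show "((\<lambda>r. unc (pd1 \<chi>1) (z + r *\<^sub>R ax DX) - pd DX V (z + r *\<^sub>R ax DX)) has_real_derivative
          unc (pd1 (pd1 \<chi>1)) (z + r *\<^sub>R ax DX) - pd DX (pd DX V) (z + r *\<^sub>R ax DX)) (at r)" for z r
        by (intro DERIV_diff unc_line_derivative1 dxx lV)
      show "((\<lambda>r. unc (pd2 \<chi>1) (z + r *\<^sub>R ax DY) - pd DY V (z + r *\<^sub>R ax DY)) has_real_derivative
          unc (pd2 (pd2 \<chi>1)) (z + r *\<^sub>R ax DY) - pd DY (pd DY V) (z + r *\<^sub>R ax DY)) (at r)" for z r
        by (intro DERIV_diff unc_line_derivative2 dyy lV)
      fix z :: pt
      obtain t x y where z: "z = (t, x, y)" by (cases z)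
      show "unc (pdt \<chi>1) z - pd DT V z + b1 z * (unc (pd1 \<chi>1) z - pd DX V z) + b2 z * (unc (pd2 \<chi>1) z - pd DY V z)
          + \<sigma>\<^sup>2 / 2 * (unc (pd1 (pd1 \<chi>1)) z - pd DX (pd DX V) z + (unc (pd2 (pd2 \<chi>1)) z - pd DY (pd DY V) z)) = 0"
      proof -
        have 1: "pd DT V z + b1 z * pd DX V z + b2 z * pd DY V z + \<sigma>\<^sup>2 / 2 * (pd DX (pd DX V) z + pd DY (pd DY V) z) = - b1 z"
          using V(3)[of z] unfolding L_def .
        have 2: "unc (pdt \<chi>1) z + b1 z * unc (pd1 \<chi>1) z + b2 z * unc (pd2 \<chi>1) z
            + \<sigma>\<^sup>2 / 2 * (unc (pd1 (pd1 \<chi>1)) z + unc (pd2 (pd2 \<chi>1)) z) = - b1 z"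
          using assms(11)[of t x y] by (simp add: z gen_def bs)
        \<comment> \<open>Linearity of the generator as a bare identity, so that the two equations
          can be substituted.\<close>
        have id: "a - a' + b * (c - c') + d * (e - e') + k * (f - f' + (g - g'))
            = (a + b * c + d * e + k * (f + g)) - (a' + b * c' + d * e' + k * (f' + g'))" for a a' b c c' d e e' f f' g g' k :: real
          by (simp add: algebra_simps)
        show ?thesis unfolding id 1 2 by simp
      qed
    next
      show "M (\<lambda>z. unc \<chi>1 z - V z) = (\<lambda>z. 0)"
        by (rule ext) (simp add: M_diff C CV M_unc[OF C(1) mz] V(2))
    qed (intro Cp_diff C CV)+
    then show ?thesis by simp
  qed
  \<comment> \<open>The outer integral of \<open>step_op\<close> is the noise in the first
    coordinate, in agreement with the order of the averages in \<open>G\<close>.\<close>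
  have step: "step_op v1 v2 \<sigma> s (cur f) = cur (I s f)" if f: "Sm f" and s: "s \<ge> 0" for s f
  proof (intro ext)
    fix t x y
    let ?c = "\<sigma> * sqrt s"
    define y1 where "y1 = x + v1 (t + s/2) y * s"
    define y2 where "y2 = y + v2 (t + s/2) y1 * s"
    have S: "Sx s (t, x, y) = (t + s, y1, y2)"
      by (simp add: Sx_def shear_def y1_def y2_def bs mult.commute)
    have Cf: "Cp f" "Cp (Ga ?c DY f)" using f by (auto intro: Sm_Cp Cp_Av)
    have "cur (I s f) t x y = Ga ?c DX (Ga ?c DY f) (t + s, y1, y2)" by (simp add: cur_def I_def G_def S)
    also have "\<dots> = (\<integral>\<xi>. std_normal_density \<xi> * (\<integral>\<zeta>. std_normal_density \<zeta> * f (t + s, y1 + ?c * \<xi>, y2 + ?c * \<zeta>) \<partial>lborel) \<partial>lborel)"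
      unfolding Ga_eq[OF Cf(2)] Ga_eq[OF Cf(1)] by simp
    also have "\<dots> = (\<integral>\<xi>. (\<integral>\<zeta>. f (t + s, y1 + ?c * \<xi>, y2 + ?c * \<zeta>) * std_normal_density \<xi> * std_normal_density \<zeta> \<partial>lborel) \<partial>lborel)"
      by (subst integral_mult_right_zero[symmetric]) (simp only: mult_ac)
    also have "\<dots> = step_op v1 v2 \<sigma> s (cur f) t x y"
      by (simp add: step_op_def Let_def cur_def y1_def y2_def)
    finally show "step_op v1 v2 \<sigma> s (cur f) t x y = cur (I s f) t x y" by simp
  qed
  have vhat: "vhat1 v1 v2 \<sigma> N = cur (vh (1 / real N))" if N: "N \<ge> 1" for N
  proof (intro ext)
    fix t x y
    let ?s = "1 / real N"
    have s: "?s \<in> {0<..1}" using N by simp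
    have hc: "(\<lambda>s y1 y2. v1 (s + ?s / 2) y2) = cur (h ?s)" by (auto simp: cur_def h_def shear_def bs fun_eq_iff)
    have it: "(step_op v1 v2 \<sigma> ?s ^^ i) (cur (h ?s)) = cur ((I ?s ^^ i) (h ?s))" for i
      by (induction i) (simp_all add: step Sm_I_pow Sm_h)
    have "(\<lambda>i. ?s * (I ?s ^^ i) (h ?s) (t, x, y)) sums vh ?s (t, x, y)"
      using vh_limit[OF s, of "[]" "(t, x, y)"] unfolding sums_def ps_def by simp
    \<comment> \<open>The step size stands inside the series in \<open>vh\<close> and in front of it
      in \<open>vhat1\<close>; multiplying by \<open>real N\<close> takes it out.\<close>
    then have "(\<lambda>i. real N * (?s * (I ?s ^^ i) (h ?s) (t, x, y))) sums (real N * vh ?s (t, x, y))"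
      by (rule sums_mult)
    then have "(\<lambda>i. (I ?s ^^ i) (h ?s) (t, x, y)) sums (real N * vh ?s (t, x, y))" using N by simp
    then have "(\<Sum>i. (I ?s ^^ i) (h ?s) (t, x, y)) = real N * vh ?s (t, x, y)" by (rule sums_unique[symmetric])
    then show "vhat1 v1 v2 \<sigma> N t x y = cur (vh ?s) t x y"
      using N unfolding vhat1_def Let_def hc it by (simp add: cur_def)
  qed
  obtain C where C: "C \<ge> 0" "\<forall>s\<in>{0<..1}. bnd 9 (\<lambda>z. V z - vh s z) (C * s)" using Vb by blast
  show ?thesis
  \<comment> \<open>For \<open>N \<ge> 1\<close> the step \<open>1 / real N\<close> lies in the
    range of all estimates; for \<open>N = 0\<close> it would be 0. The constant is the same for
    every \<open>\<alpha>\<close>.\<close>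
  proof (intro exI[of _ "card idx26 * (4 * C)"] exI[of _ 1] allI impI)
    fix N :: nat assume N: "N \<ge> 1"
    let ?s = "1 / real N"
    have s: "?s \<in> {0<..1}" using N by simp
    have eq: "(\<lambda>t x1 x2. \<chi>1 t x1 x2 - vhat1 v1 v2 \<sigma> N t x1 x2) = cur (\<lambda>z. V z - vh ?s z)"
      using chi[of "(_, _, _)"] by (auto simp: vhat[OF N] cur_def fun_eq_iff)
    have Sm: "Sm (\<lambda>z. V z - vh ?s z)" by (intro Sm_diff V vh_smooth s)
    have b: "bnd 9 (\<lambda>z. V z - vh ?s z) (C * ?s)" using C(2) s by blast
    show "C26 \<alpha> (\<lambda>t x1 x2. \<chi>1 t x1 x2 - vhat1 v1 v2 \<sigma> N t x1 x2) \<and>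
       norm26 \<alpha> (\<lambda>t x1 x2. \<chi>1 t x1 x2 - vhat1 v1 v2 \<sigma> N t x1 x2) \<le> card idx26 * (4 * C) * (1 / real N)"
      unfolding eq using C26_cur[OF Sm b assms(2,3)] by (simp add: mult_ac)
  qed
qed

end
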